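(* Let $(\mathbb{X},\mathbb{Y},\mathbb{A},P,Q,c)$ be a POMDP and let $\alpha$ be a discount factor. Suppose that the following assumptions hold: (a) either Assumption (D) or Assumption (P) holds; (b) the function $c$ is $\mathbb{K}$-inf-compact on $\mathbb{X}\times\mathbb{A}$; (c) either (i) the stochastic kernel $R'(dy|z,a)$ on $\mathbb{Y}$ given $\mathbb{P}(\mathbb{X})\times\mathbb{A}$ is setwise continuous and Assumption (H) holds, or (ii) the stochastic kernels $P(dx'|x,a)$ on $\mathbb{X}$ given $\mathbb{X}\times\mathbb{A}$ and $Q(dy|a,x)$ on $\mathbb{Y}$ given $\mathbb{A}\times\mathbb{X}$ are weakly continuous and there exists a weakly continuous stochastic kernel $H(dx|z,a,y)$ on $\mathbb{X}$ given $\mathbb{P}(\mathbb{X})\times\mathbb{A}\times\mathbb{Y}$ satisfying the filtering equation (F). Then the COMDP $(\mathbb{P}(\mathbb{X}),\mathbb{A},q,\bar c)$ satisfies Assumption (W* ), and therefore it has the optimality properties (O1)--(O6).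
   Context: Notation. $\overline{\mathbb{R}}=\mathbb{R}\cup\{+\infty\}$. For a metric space $\mathbb{S}$, $\mathcal{B}(\mathbb{S})$ is its Borel $\sigma$-field and $\mathbb{P}(\mathbb{S})$ is the set of probability measures on $(\mathbb{S},\mathcal{B}(\mathbb{S}))$, endowed with the topology of weak convergence. Measures $\mu^{(n)}$ converge weakly (setwise) to $\mu$ if $\int f\,d\mu^{(n)}\to\int f\,d\mu$ for every bounded continuous (bounded Borel) $f$. A stochastic kernel $T(ds_1|s_2)$ on $\mathbb{S}_1$ given $\mathbb{S}_2$ is a map such that $T(\cdot|s_2)\in\mathbb{P}(\mathbb{S}_1)$ for each $s_2$ and $T(B|\cdot)$ is Borel for each $B\in\mathcal{B}(\mathbb{S}_1)$; it is weakly (setwise) continuous if $s_2^{(n)}\to s_2$ implies $T(\cdot|s_2^{(n)})\to T(\cdot|s_2)$ weakly (setwise). POMDP. A POMDP $(\mathbb{X},\mathbb{Y},\mathbb{A},P,Q,c)$ consists of nonempty Borel subsets $\mathbb{X}$ (states), $\mathbb{Y}$ (observations), $\mathbb{A}$ (actions) of Polish spaces, a stochastic kernel $P(dx'|x,a)$ on $\mathbb{X}$ given $\mathbb{X}\times\mathbb{A}$, a stochastic kernel $Q(dy|a,x)$ on $\mathbb{Y}$ given $\mathbb{A}\times\mathbb{X}$, and a bounded below Borel function $c:\mathbb{X}\times\mathbb{A}\to\overline{\mathbb{R}}$. Assumption (D): $c$ is bounded below on $\mathbb{X}\times\mathbb{A}$ and $\alpha\in[0,1)$. Assumption (P): $c$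 is nonnegative on $\mathbb{X}\times\mathbb{A}$ and $\alpha\in[0,1]$. Inf-compactness. A function $f:\mathbb{S}_1\times\mathbb{S}_2\to\overline{\mathbb{R}}$ ($\mathbb{S}_1,\mathbb{S}_2$ metric spaces) is inf-compact if $\{f\le\lambda\}$ is compact for every $\lambda\in\mathbb{R}$ (similarly for functions on a single metric space); it is $\mathbb{K}$-inf-compact on $\mathbb{S}_1\times\mathbb{S}_2$ if for every compact $K\subseteq\mathbb{S}_1$ its restriction to $K\times\mathbb{S}_2$ is inf-compact. Filtering. For $z\in\mathbb{P}(\mathbb{X})$, $a\in\mathbb{A}$, $B\in\mathcal{B}(\mathbb{X})$, $C\in\mathcal{B}(\mathbb{Y})$ let $R(B\times C|z,a)=\int_{\mathbb{X}}\int_B Q(C|a,x')P(dx'|x,a)z(dx)$, which defines a stochastic kernel on $\mathbb{X}\times\mathbb{Y}$ given $\mathbb{P}(\mathbb{X})\times\mathbb{A}$, and let $R'(C|z,a)=R(\mathbb{X}\times C|z,a)$. There exists a stochastic kernel $H(dx|z,a,y)$ on $\mathbb{X}$ given $\mathbb{P}(\mathbb{X})\times\mathbb{A}\times\mathbb{Y}$ satisfying the filtering equation (F) $R(B\times C|z,a)=\int_C H(B|z,a,y)R'(dy|z,a)$ for all $B\in\mathcal{B}(\mathbb{X})$, $C\in\mathcal{B}(\mathbb{Y})$, $z\in\mathbb{P}(\mathbb{X})$, $a\in\mathbb{A}$. Write $H(z,a,y)=H(\cdot|z,a,y)\in\mathbb{P}(\mathbb{X})$. Define the stochastic kernel $q$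 on $\mathbb{P}(\mathbb{X})$ given $\mathbb{P}(\mathbb{X})\times\mathbb{A}$ by $q(D|z,a)=\int_{\mathbb{Y}}\mathbf{1}\{H(z,a,y)\in D\}R'(dy|z,a)$, $D\in\mathcal{B}(\mathbb{P}(\mathbb{X}))$; it does not depend on the choice of $H$ satisfying (F). Assumption (H): there exists a stochastic kernel $H$ on $\mathbb{X}$ given $\mathbb{P}(\mathbb{X})\times\mathbb{A}\times\mathbb{Y}$ satisfying (F) such that, if $z^{(n)}\to z$ weakly in $\mathbb{P}(\mathbb{X})$ and $a^{(n)}\to a$ in $\mathbb{A}$, then there exist a subsequence $\{(z^{(n_k)},a^{(n_k)})\}_{k}$ and a measurable set $C\subseteq\mathbb{Y}$ with $R'(C|z,a)=1$ such that $H(z^{(n_k)},a^{(n_k)},y)\to H(z,a,y)$ weakly for all $y\in C$. COMDP. The COMDP $(\mathbb{P}(\mathbb{X}),\mathbb{A},q,\bar c)$ is the Markov decision process with state space $\mathbb{P}(\mathbb{X})$, action set $\mathbb{A}$ at every state, transition kernel $q$ and one-step cost $\bar c(z,a)=\int_{\mathbb{X}}c(x,a)z(dx)$. An $I$-policy is a sequence $\delta=\{\delta_t\}_{t\ge0}$ of stochastic kernels $\delta_t$ on $\mathbb{A}$ given $\mathbb{P}(\mathbb{X})\times(\mathbb{A}\times\mathbb{P}(\mathbb{X}))^t$ (histories $z_0,a_0,\dots,z_t$); it is Markov if it is given by Borel maps $\phi_t:\mathbb{P}(\mathbb{X})\to\mathbb{A}$ with $a_t=\phi_t(z_t)$, and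 stationary if moreover $\phi_t=\phi$ does not depend on $t$. For $T\in\{0,1,\dots\}\cup\{\infty\}$, $\bar v^{\delta}_{T,\alpha}(z)=\mathbb{E}^\delta_z\sum_{t=0}^{T-1}\alpha^t\bar c(z_t,a_t)$ with $z_0=z$, $\bar v_{T,\alpha}(z)=\inf_\delta\bar v^\delta_{T,\alpha}(z)$, and the subscript $T$ is dropped if $T=\infty$; $\bar v_{0,\alpha}=0$. A policy is $T$-horizon optimal (discount-optimal) if it attains the infimum for all $z$, for horizon $T$ (for $T=\infty$). Assumption (W* ) for the COMDP: $\bar c$ is $\mathbb{K}$-inf-compact on $\mathbb{P}(\mathbb{X})\times\mathbb{A}$, and $q(\cdot|z,a)$ is weakly continuous in $(z,a)\in\mathbb{P}(\mathbb{X})\times\mathbb{A}$. Optimality properties of the COMDP: (O1) $\bar v_{t,\alpha}$, $t=0,1,\dots$, and $\bar v_\alpha$ are lower semi-continuous on $\mathbb{P}(\mathbb{X})$, and $\bar v_{t,\alpha}(z)\to\bar v_\alpha(z)$ as $t\to\infty$ for all $z$. (O2) For all $z\in\mathbb{P}(\mathbb{X})$, $t=0,1,\dots$: $\bar v_{t+1,\alpha}(z)=\min_{a\in\mathbb{A}}\{\bar c(z,a)+\alpha\int\bar v_{t,\alpha}(z')q(dz'|z,a)\}=\min_{a\in\mathbb{A}}\{\int_{\mathbb{X}}c(x,a)z(dx)+\alpha\int_{\mathbb{X}}\int_{\mathbb{X}}\int_{\mathbb{Y}}\bar v_{t,\alpha}(H(z,a,y))Q(dy|a,x')P(dx'|x,a)z(dx)\}$;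 and the nonempty sets $A_{t,\alpha}(z)=\{a\in\mathbb{A}:\bar v_{t+1,\alpha}(z)=\bar c(z,a)+\alpha\int\bar v_{t,\alpha}(z')q(dz'|z,a)\}$ satisfy: the graph $\{(z,a):a\in A_{t,\alpha}(z)\}$ is a Borel subset of $\mathbb{P}(\mathbb{X})\times\mathbb{A}$; $A_{t,\alpha}(z)=\mathbb{A}$ if $\bar v_{t+1,\alpha}(z)=+\infty$, and $A_{t,\alpha}(z)$ is compact if $\bar v_{t+1,\alpha}(z)<+\infty$. (O3) For each $T=1,2,\dots$ there is an optimal Markov $T$-horizon $I$-policy $(\phi_0,\dots,\phi_{T-1})$; and any $T$-horizon Markov $I$-policy with $\phi_{T-1-t}(z)\in A_{t,\alpha}(z)$ for all $z$ and $t=0,\dots,T-1$ is $T$-horizon optimal. (O4) For all $z\in\mathbb{P}(\mathbb{X})$: $\bar v_\alpha(z)=\min_{a\in\mathbb{A}}\{\bar c(z,a)+\alpha\int\bar v_\alpha(z')q(dz'|z,a)\}=\min_{a\in\mathbb{A}}\{\int_{\mathbb{X}}c(x,a)z(dx)+\alpha\int_{\mathbb{X}}\int_{\mathbb{X}}\int_{\mathbb{Y}}\bar v_\alpha(H(z,a,y))Q(dy|a,x')P(dx'|x,a)z(dx)\}$; and the nonempty sets $A_\alpha(z)=\{a\in\mathbb{A}:\bar v_\alpha(z)=\bar c(z,a)+\alpha\int\bar v_\alpha(z')q(dz'|z,a)\}$ satisfy: the graph $\{(z,a):a\in A_\alpha(z)\}$ is a Borel subset of $\mathbb{P}(\mathbb{X})\times\mathbb{A}$;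 $A_\alpha(z)=\mathbb{A}$ if $\bar v_\alpha(z)=+\infty$, and $A_\alpha(z)$ is compact if $\bar v_\alpha(z)<+\infty$. (O5) For the infinite horizon there is a stationary discount-optimal $I$-policy, and a stationary $I$-policy $\phi$ is optimal if and only if $\phi(z)\in A_\alpha(z)$ for all $z\in\mathbb{P}(\mathbb{X})$. (O6) If $\bar c$ is inf-compact on $\mathbb{P}(\mathbb{X})\times\mathbb{A}$, then $\bar v_{t,\alpha}$, $t=1,2,\dots$, and $\bar v_\alpha$ are inf-compact on $\mathbb{P}(\mathbb{X})$. *)

theory Defs
  imports "HOL-Probability.Probability"
begin

section \<open>Borel structure, weak topology, stochastic kernels\<close>

text \<open>
  Spaces are given as \<^typ>\<open>'a topology\<close>: a Borel subset \<open>X\<close> of a Polish space is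
  \<^term>\<open>top_of_set X\<close>, and the space of probability measures on \<open>S\<close> is \<open>weak_topology S\<close> below.
\<close>

definition borel_of :: "'a topology \<Rightarrow> 'a measure" where
  "borel_of S = sigma (topspace S) {U. openin S U}"

abbreviation prob_measures :: "'a topology \<Rightarrow> 'a measure set" where
  "prob_measures S \<equiv> space (prob_algebra (borel_of S))"

definition bounded_continuous :: "'a topology \<Rightarrow> ('a \<Rightarrow> real) \<Rightarrow> bool" where
  "bounded_continuous S f \<longleftrightarrow> continuous_map S euclideanreal f \<and> bounded (f ` topspace S)"

definition converges_weakly :: "'a topology \<Rightarrow> (nat \<Rightarrow> 'a measure) \<Rightarrow> 'a measure \<Rightarrow> bool" where
  "converges_weakly S \<mu>s \<mu> \<longleftrightarrow>
     (\<forall>f. bounded_continuous S f \<longrightarrow> (\<lambda>n. \<integral>s. f s \<partial>\<mu>s n) \<longlonglongrightarrow> (\<integral>s. f s \<partial>\<mu>))"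

definition converges_setwise :: "'a topology \<Rightarrow> (nat \<Rightarrow> 'a measure) \<Rightarrow> 'a measure \<Rightarrow> bool" where
  "converges_setwise S \<mu>s \<mu> \<longleftrightarrow>
     (\<forall>f::'a \<Rightarrow> real. f \<in> borel_measurable (borel_of S) \<and> bounded (f ` topspace S) \<longrightarrow>
        (\<lambda>n. \<integral>s. f s \<partial>\<mu>s n) \<longlonglongrightarrow> (\<integral>s. f s \<partial>\<mu>))"

text \<open>
  The topology of weak convergence on the probability measures on \<open>S\<close>: the coarsest one making
  \<open>\<mu> \<mapsto> \<integral>f d\<mu>\<close> continuous for every bounded continuous \<open>f\<close>. For separable metrizable \<open>S\<close> it is
  itself separable and metrizable, hence determined by its convergent sequences, which are
  described by \<open>limitin_weak_topology\<close>.
\<close>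

definition weak_topology :: "'a topology \<Rightarrow> 'a measure topology" where
  "weak_topology S = topology_generated_by
     {{\<mu> \<in> prob_measures S. (\<integral>s. f s \<partial>\<mu>) \<in> U} | f U. bounded_continuous S f \<and> open U}"

definition stochastic_kernel :: "'b measure \<Rightarrow> 'a measure \<Rightarrow> ('a \<Rightarrow> 'b measure) \<Rightarrow> bool" where
  "stochastic_kernel N M T \<longleftrightarrow>
     (\<forall>s\<in>space M. T s \<in> space (prob_algebra N)) \<and>
     (\<forall>B\<in>sets N. (\<lambda>s. emeasure (T s) B) \<in> borel_measurable M)"

definition weakly_continuous_kernel :: "'b topology \<Rightarrow> 'a topology \<Rightarrow> ('a \<Rightarrow> 'b measure) \<Rightarrow> bool" where
  "weakly_continuous_kernel S1 S2 T \<longleftrightarrow>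
     stochastic_kernel (borel_of S1) (borel_of S2) T \<and>
     (\<forall>\<sigma> s. range \<sigma> \<subseteq> topspace S2 \<and> limitin S2 \<sigma> s sequentially \<longrightarrow>
        converges_weakly S1 (\<lambda>n. T (\<sigma> n)) (T s))"

definition setwise_continuous_kernel :: "'b topology \<Rightarrow> 'a topology \<Rightarrow> ('a \<Rightarrow> 'b measure) \<Rightarrow> bool" where
  "setwise_continuous_kernel S1 S2 T \<longleftrightarrow>
     stochastic_kernel (borel_of S1) (borel_of S2) T \<and>
     (\<forall>\<sigma> s. range \<sigma> \<subseteq> topspace S2 \<and> limitin S2 \<sigma> s sequentially \<longrightarrow>
        converges_setwise S1 (\<lambda>n. T (\<sigma> n)) (T s))"

lemma space_borel_of [simp]: "space (borel_of S) = topspace S"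
  unfolding borel_of_def by (rule space_measure_of) (auto dest: openin_subset)

lemma stochastic_kernel_iff: "stochastic_kernel N M T \<longleftrightarrow> T \<in> M \<rightarrow>\<^sub>M prob_algebra N"
proof
  assume T: "stochastic_kernel N M T"
  then have "T \<in> M \<rightarrow>\<^sub>M subprob_algebra N"
    by (intro measurable_subprob_algebra)
       (auto simp: stochastic_kernel_def space_prob_algebra intro: prob_space_imp_subprob_space)
  with T show "T \<in> M \<rightarrow>\<^sub>M prob_algebra N"
    by (intro measurable_prob_algebraI) (auto simp: stochastic_kernel_def space_prob_algebra)
next
  assume T: "T \<in> M \<rightarrow>\<^sub>M prob_algebra N"
  then show "stochastic_kernel N M T"
    using measurable_space[OF T]
    by (auto simp: stochastic_kernel_def
             intro!: measurable_emeasure_kernel measurable_prob_algebraD)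
qed

lemma topspace_weak_topology [simp]: "topspace (weak_topology S) = prob_measures S"
proof -
  have "bounded_continuous S (\<lambda>_. 0)"
    by (auto simp: bounded_continuous_def intro: finite_imp_bounded finite_subset[of _ "{0}"])
  then have "prob_measures S \<in>
      {{\<mu> \<in> prob_measures S. (\<integral>s. f s \<partial>\<mu>) \<in> U} | f U. bounded_continuous S f \<and> open U}"
    by (intro CollectI exI[of _ "\<lambda>_. 0"] exI[of _ UNIV]) auto
  then show ?thesis
    unfolding weak_topology_def topology_generated_by_topspace by blast
qed

lemma limitin_weak_topology:
  assumes "range \<mu>s \<subseteq> prob_measures S" "\<mu> \<in> prob_measures S"
  shows "limitin (weak_topology S) \<mu>s \<mu> sequentially \<longleftrightarrow> converges_weakly S \<mu>s \<mu>"
proof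
  assume lim: "limitin (weak_topology S) \<mu>s \<mu> sequentially"
  show "converges_weakly S \<mu>s \<mu>"
    unfolding converges_weakly_def
  proof (intro allI impI topological_tendstoI)
    fix f U assume f: "bounded_continuous S f" and U: "open U" "(\<integral>s. f s \<partial>\<mu>) \<in> U"
    have "openin (weak_topology S) {\<nu> \<in> prob_measures S. (\<integral>s. f s \<partial>\<nu>) \<in> U}"
      unfolding weak_topology_def using f U(1) by (intro topology_generated_by_Basis) blast
    with lim U(2) assms(2)
    have "\<forall>\<^sub>F n in sequentially. \<mu>s n \<in> {\<nu> \<in> prob_measures S. (\<integral>s. f s \<partial>\<nu>) \<in> U}"
      unfolding limitin_def by blast
    then show "\<forall>\<^sub>F n in sequentially. (\<integral>s. f s \<partial>\<mu>s n) \<in> U"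
      by eventually_elim auto
  qed
next
  assume conv: "converges_weakly S \<mu>s \<mu>"
  let ?B = "{{\<mu> \<in> prob_measures S. (\<integral>s. f s \<partial>\<mu>) \<in> U} | f U. bounded_continuous S f \<and> open U}"
  have "\<mu> \<in> W \<longrightarrow> (\<forall>\<^sub>F n in sequentially. \<mu>s n \<in> W)" if "generate_topology_on ?B W" for W
    using that
  proof induction
    case (Int a b)
    then show ?case by (auto simp: eventually_conj_iff)
  next
    case (UN K)
    then show ?case by (blast intro: eventually_mono)
  next
    case (Basis W)
    then obtain f U where W: "W = {\<mu> \<in> prob_measures S. (\<integral>s. f s \<partial>\<mu>) \<in> U}"
      and f: "bounded_continuous S f" and U: "open U" by blast
    show ?case
    proof
      assume "\<mu> \<in> W"
      with conv f U have "\<forall>\<^sub>F n in sequentially. (\<integral>s. f s \<partial>\<mu>s n) \<in> U"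
        unfolding converges_weakly_def W by (auto dest: topological_tendstoD)
      then show "\<forall>\<^sub>F n in sequentially. \<mu>s n \<in> W"
        unfolding W by eventually_elim (use assms(1) in auto)
    qed
  qed auto
  then show "limitin (weak_topology S) \<mu>s \<mu> sequentially"
    using assms(2) unfolding limitin_def topspace_weak_topology
    by (auto simp: weak_topology_def openin_topology_generated_by_iff)
qed


section \<open>Extended-real functions\<close>

text \<open>
  Integral of an extended-real function that is bounded below (for which the negative part is
  integrable against a probability measure); functions with values in \<open>\<real> \<union> {+\<infinity>}\<close> have type
  \<^typ>\<open>ereal\<close>.
\<close>

definition ereal_integral :: "'a measure \<Rightarrow> ('a \<Rightarrow> ereal) \<Rightarrow> ereal" where
  "ereal_integral M f =
     enn2ereal (\<integral>\<^sup>+x. e2ennreal (f x) \<partial>M) - enn2ereal (\<integral>\<^sup>+x. e2ennreal (- f x) \<partial>M)"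

definition inf_compact :: "'a topology \<Rightarrow> ('a \<Rightarrow> ereal) \<Rightarrow> bool" where
  "inf_compact S f \<longleftrightarrow> (\<forall>l::real. compactin S {s \<in> topspace S. f s \<le> ereal l})"

definition K_inf_compact :: "'a topology \<Rightarrow> 'b topology \<Rightarrow> ('a \<times> 'b \<Rightarrow> ereal) \<Rightarrow> bool" where
  "K_inf_compact S1 S2 f \<longleftrightarrow>
     (\<forall>K. compactin S1 K \<longrightarrow> inf_compact (prod_topology (subtopology S1 K) S2) f)"

definition lower_semicontinuous :: "'a topology \<Rightarrow> ('a \<Rightarrow> ereal) \<Rightarrow> bool" where
  "lower_semicontinuous S f \<longleftrightarrow> (\<forall>l. openin S {s \<in> topspace S. l < f s})"

definition is_min :: "'a set \<Rightarrow> ('a \<Rightarrow> ereal) \<Rightarrow> ereal \<Rightarrow> bool" where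
  "is_min A f m \<longleftrightarrow> (\<exists>a\<in>A. f a = m) \<and> (\<forall>a\<in>A. m \<le> f a)"


section \<open>Markov decision processes with all actions available at every state\<close>

record ('s, 'a) mdp =
  state_space :: "'s topology"
  action_space :: "'a topology"
  transition :: "'s \<times> 'a \<Rightarrow> 's measure"
  step_cost :: "'s \<times> 'a \<Rightarrow> ereal"

abbreviation (input) state_action_algebra :: "('s, 'a) mdp \<Rightarrow> ('s \<times> 'a) measure" where
  "state_action_algebra D \<equiv> borel_of (state_space D) \<Otimes>\<^sub>M borel_of (action_space D)"

text \<open>
  A history \<open>z\<^sub>0, a\<^sub>0, \<dots>, a\<^sub>t\<^sub>-\<^sub>1, z\<^sub>t\<close> is encoded as \<open>(\<omega>, z\<^sub>t)\<close>, where \<open>\<omega>\<close> is the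
  function \<open>i \<mapsto> (z\<^sub>i, a\<^sub>i)\<close> on \<open>{0..<t}\<close>. Histories carry the product \<open>\<sigma>\<close>-field, which for
  second-countable spaces is the Borel \<open>\<sigma>\<close>-field of the product topology.
\<close>

type_synonym ('s, 'a) policy = "nat \<Rightarrow> (nat \<Rightarrow> 's \<times> 'a) \<times> 's \<Rightarrow> 'a measure"

definition is_policy :: "('s, 'a) mdp \<Rightarrow> ('s, 'a) policy \<Rightarrow> bool" where
  "is_policy D \<delta> \<longleftrightarrow>
     (\<forall>t. stochastic_kernel (borel_of (action_space D))
            (PiM {0..<t} (\<lambda>_. state_action_algebra D) \<Otimes>\<^sub>M borel_of (state_space D)) (\<delta> t))"

definition is_markov :: "('s, 'a) mdp \<Rightarrow> (nat \<Rightarrow> 's \<Rightarrow> 'a) \<Rightarrow> bool" where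
  "is_markov D \<phi> \<longleftrightarrow> (\<forall>t. \<phi> t \<in> borel_of (state_space D) \<rightarrow>\<^sub>M borel_of (action_space D))"

definition markov_policy :: "('s, 'a) mdp \<Rightarrow> (nat \<Rightarrow> 's \<Rightarrow> 'a) \<Rightarrow> ('s, 'a) policy" where
  "markov_policy D \<phi> = (\<lambda>t (\<omega>, s). return (borel_of (action_space D)) (\<phi> t s))"

text \<open>The conditional law of \<open>(z\<^sub>t, a\<^sub>t)\<close> given \<open>(z\<^sub>i, a\<^sub>i)\<close>, \<open>i < t\<close>.\<close>

definition step_kernel ::
    "('s, 'a) mdp \<Rightarrow> ('s, 'a) policy \<Rightarrow> 's \<Rightarrow> nat \<Rightarrow> (nat \<Rightarrow> 's \<times> 'a) \<Rightarrow> ('s \<times> 'a) measure" where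
  "step_kernel D \<delta> z t \<omega> =
     (if t = 0 then return (borel_of (state_space D)) z else transition D (\<omega> (t - 1))) \<bind>
       (\<lambda>s. \<delta> t (\<omega>, s) \<bind> (\<lambda>a. return (state_action_algebra D) (s, a)))"

lemma Ionescu_Tulcea_step_kernel:
  assumes q: "stochastic_kernel (borel_of (state_space D)) (state_action_algebra D) (transition D)"
    and \<delta>: "is_policy D \<delta>" and z: "z \<in> topspace (state_space D)"
  shows "Ionescu_Tulcea (step_kernel D \<delta> z) (\<lambda>_. state_action_algebra D)"
proof -
  let ?S = "borel_of (state_space D)" and ?A = "borel_of (action_space D)"
  let ?H = "\<lambda>t. PiM {0..<t} (\<lambda>_. state_action_algebra D)"
  have \<delta>' [measurable]: "\<delta> t \<in> ?H t \<Otimes>\<^sub>M ?S \<rightarrow>\<^sub>M prob_algebra ?A" for t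
    using \<delta> by (simp add: is_policy_def stochastic_kernel_iff)
  have q' [measurable]: "transition D \<in> ?S \<Otimes>\<^sub>M ?A \<rightarrow>\<^sub>M prob_algebra ?S"
    using q by (simp add: stochastic_kernel_iff)
  have init: "(\<lambda>\<omega>. if t = 0 then return ?S z else transition D (\<omega> (t - 1)))
      \<in> ?H t \<rightarrow>\<^sub>M prob_algebra ?S" for t :: nat
  proof (cases t)
    case 0
    then show ?thesis using z by (auto simp: space_prob_algebra intro!: measurable_const prob_space_return)
  next
    case (Suc n)
    then have "(\<lambda>\<omega>. \<omega> n) \<in> ?H t \<rightarrow>\<^sub>M ?S \<Otimes>\<^sub>M ?A"
      by (intro measurable_component_singleton) auto
    from measurable_compose[OF this q'] Suc show ?thesis by simp
  qed
  have step: "step_kernel D \<delta> z t \<in> ?H t \<rightarrow>\<^sub>M prob_algebra (?S \<Otimes>\<^sub>M ?A)" for t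
    unfolding step_kernel_def
    by (rule measurable_bind_prob_space2[OF init]) measurable
  then have "step_kernel D \<delta> z t \<in> ?H t \<rightarrow>\<^sub>M subprob_algebra (?S \<Otimes>\<^sub>M ?A)" for t
    by (rule measurable_prob_algebraD)
  moreover have "prob_space (step_kernel D \<delta> z t \<omega>)" if "\<omega> \<in> space (?H t)" for t \<omega>
    using measurable_space[OF step that] by (simp add: space_prob_algebra)
  ultimately show ?thesis
    by (rule Ionescu_Tulcea.intro)
qed

definition trajectory_law ::
    "('s, 'a) mdp \<Rightarrow> ('s, 'a) policy \<Rightarrow> 's \<Rightarrow> (nat \<Rightarrow> 's \<times> 'a) measure" where
  "trajectory_law D \<delta> z =
     projective_family.lim UNIV
       (Ionescu_Tulcea.CI (step_kernel D \<delta> z) (\<lambda>_. state_action_algebra D))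
       (\<lambda>_. state_action_algebra D)"

definition policy_cost ::
    "('s, 'a) mdp \<Rightarrow> real \<Rightarrow> enat \<Rightarrow> ('s, 'a) policy \<Rightarrow> 's \<Rightarrow> ereal" where
  "policy_cost D \<alpha> T \<delta> z =
     ereal_integral (trajectory_law D \<delta> z)
       (\<lambda>\<omega>. case T of
           enat n \<Rightarrow> (\<Sum>t<n. ereal (\<alpha> ^ t) * step_cost D (\<omega> t))
         | \<infinity> \<Rightarrow> (\<Sum>t. ereal (\<alpha> ^ t) * step_cost D (\<omega> t)))"

definition opt_value :: "('s, 'a) mdp \<Rightarrow> real \<Rightarrow> enat \<Rightarrow> 's \<Rightarrow> ereal" where
  "opt_value D \<alpha> T z = (INF \<delta>\<in>{\<delta>. is_policy D \<delta>}. policy_cost D \<alpha> T \<delta> z)"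

definition is_optimal :: "('s, 'a) mdp \<Rightarrow> real \<Rightarrow> enat \<Rightarrow> ('s, 'a) policy \<Rightarrow> bool" where
  "is_optimal D \<alpha> T \<delta> \<longleftrightarrow>
     (\<forall>z\<in>topspace (state_space D). policy_cost D \<alpha> T \<delta> z = opt_value D \<alpha> T z)"

definition bellman :: "('s, 'a) mdp \<Rightarrow> real \<Rightarrow> ('s \<Rightarrow> ereal) \<Rightarrow> 's \<Rightarrow> 'a \<Rightarrow> ereal" where
  "bellman D \<alpha> v z a = step_cost D (z, a) + ereal \<alpha> * ereal_integral (transition D (z, a)) v"

text \<open>
  \<open>opt_actions D \<alpha> T z\<close> is \<open>A\<^sub>T\<^sub>,\<^sub>\<alpha>(z)\<close>; since \<open>eSuc \<infinity> = \<infinity>\<close>, the case \<open>T = \<infinity>\<close> is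
  \<open>A\<^sub>\<alpha>(z)\<close>.
\<close>

definition opt_actions :: "('s, 'a) mdp \<Rightarrow> real \<Rightarrow> enat \<Rightarrow> 's \<Rightarrow> 'a set" where
  "opt_actions D \<alpha> T z =
     {a \<in> topspace (action_space D). opt_value D \<alpha> (eSuc T) z = bellman D \<alpha> (opt_value D \<alpha> T) z a}"

definition assumption_W_star :: "('s, 'a) mdp \<Rightarrow> bool" where
  "assumption_W_star D \<longleftrightarrow>
     K_inf_compact (state_space D) (action_space D) (step_cost D) \<and>
     weakly_continuous_kernel (state_space D) (prod_topology (state_space D) (action_space D))
       (transition D)"


section \<open>POMDPs and the filtering equation\<close>

record ('x, 'y, 'a) pomdp =
  states :: "'x set"
  observations :: "'y set"
  actions :: "'a set"
  trans_kernel :: "'x \<times> 'a \<Rightarrow> 'x measure"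
  obs_kernel :: "'a \<times> 'x \<Rightarrow> 'y measure"
  cost :: "'x \<times> 'a \<Rightarrow> ereal"

abbreviation "X_top M \<equiv> top_of_set (states M)"
abbreviation "Y_top M \<equiv> top_of_set (observations M)"
abbreviation "A_top M \<equiv> top_of_set (actions M)"
abbreviation "PX_top M \<equiv> weak_topology (X_top M)"

definition bounded_below_cost :: "('x, 'y, 'a) pomdp \<Rightarrow> bool" where
  "bounded_below_cost M \<longleftrightarrow> (\<exists>b::real. \<forall>x\<in>states M. \<forall>a\<in>actions M. ereal b \<le> cost M (x, a))"

definition is_POMDP :: "('x::polish_space, 'y::polish_space, 'a::polish_space) pomdp \<Rightarrow> bool" where
  "is_POMDP M \<longleftrightarrow>
     states M \<noteq> {} \<and> states M \<in> sets borel \<and>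
     observations M \<noteq> {} \<and> observations M \<in> sets borel \<and>
     actions M \<noteq> {} \<and> actions M \<in> sets borel \<and>
     stochastic_kernel (borel_of (X_top M)) (borel_of (prod_topology (X_top M) (A_top M)))
       (trans_kernel M) \<and>
     stochastic_kernel (borel_of (Y_top M)) (borel_of (prod_topology (A_top M) (X_top M)))
       (obs_kernel M) \<and>
     cost M \<in> borel_measurable (borel_of (prod_topology (X_top M) (A_top M))) \<and>
     bounded_below_cost M"

definition assumption_D :: "('x, 'y, 'a) pomdp \<Rightarrow> real \<Rightarrow> bool" where
  "assumption_D M \<alpha> \<longleftrightarrow> bounded_below_cost M \<and> 0 \<le> \<alpha> \<and> \<alpha> < 1"

definition assumption_P :: "('x, 'y, 'a) pomdp \<Rightarrow> real \<Rightarrow> bool" where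
  "assumption_P M \<alpha> \<longleftrightarrow> (\<forall>x\<in>states M. \<forall>a\<in>actions M. 0 \<le> cost M (x, a)) \<and> 0 \<le> \<alpha> \<and> \<alpha> \<le> 1"

text \<open>\<open>R_rect M z a B C\<close> is \<open>R(B \<times> C | z, a)\<close>, and \<open>R'\<close> is its marginal on the observations.\<close>

definition R_rect ::
    "('x::topological_space, 'y, 'a) pomdp \<Rightarrow> 'x measure \<Rightarrow> 'a \<Rightarrow> 'x set \<Rightarrow> 'y set \<Rightarrow> ennreal" where
  "R_rect M z a B C =
     (\<integral>\<^sup>+x. (\<integral>\<^sup>+x'\<in>B. emeasure (obs_kernel M (a, x')) C \<partial>trans_kernel M (x, a)) \<partial>z)"

definition R' ::
    "('x::topological_space, 'y::topological_space, 'a) pomdp \<Rightarrow> 'x measure \<times> 'a \<Rightarrow> 'y measure" where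
  "R' M = (\<lambda>(z, a). measure_of (observations M) (sets (borel_of (Y_top M)))
                      (\<lambda>C. R_rect M z a (states M) C))"

lemma emeasure_R':
  fixes M :: "('x::polish_space, 'y::polish_space, 'a::polish_space) pomdp"
  assumes M: "is_POMDP M" and z: "z \<in> prob_measures (X_top M)" and a: "a \<in> actions M"
    and C: "C \<in> sets (borel_of (Y_top M))"
  shows "emeasure (R' M (z, a)) C = R_rect M z a (states M) C"
proof -
  let ?X = "borel_of (X_top M)" and ?Y = "borel_of (Y_top M)"
  let ?XA = "borel_of (prod_topology (X_top M) (A_top M))"
  let ?AX = "borel_of (prod_topology (A_top M) (X_top M))"
  have cont: "f \<in> borel_of S \<rightarrow>\<^sub>M borel_of T" if "continuous_map S T f" for S T and f :: "'c \<Rightarrow> 'd"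
    unfolding borel_of_def[of T]
  proof (rule measurable_measure_of)
    show "{U. openin T U} \<subseteq> Pow (topspace T)" by (auto dest: openin_subset)
    show "f \<in> space (borel_of S) \<rightarrow> topspace T"
      using that by (auto simp: continuous_map_def)
    fix U assume "U \<in> {U. openin T U}"
    then have "openin S {x \<in> topspace S. f x \<in> U}" using that by (auto simp: continuous_map_def)
    moreover have "f -` U \<inter> space (borel_of S) = {x \<in> topspace S. f x \<in> U}" by auto
    ultimately show "f -` U \<inter> space (borel_of S) \<in> sets (borel_of S)"
      by (auto simp: borel_of_def intro!: in_measure_of dest: openin_subset)
  qed
  have "(\<lambda>x. (x, a)) \<in> ?X \<rightarrow>\<^sub>M ?XA" "(\<lambda>x. (a, x)) \<in> ?X \<rightarrow>\<^sub>M ?AX"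
    using a by (auto intro!: cont continuous_map_pairedI continuous_intros)
  moreover have "trans_kernel M \<in> ?XA \<rightarrow>\<^sub>M prob_algebra ?X" "obs_kernel M \<in> ?AX \<rightarrow>\<^sub>M prob_algebra ?Y"
    using M by (auto simp: is_POMDP_def stochastic_kernel_iff)
  ultimately have P: "(\<lambda>x. trans_kernel M (x, a)) \<in> ?X \<rightarrow>\<^sub>M prob_algebra ?X"
    and Q: "(\<lambda>x. obs_kernel M (a, x)) \<in> ?X \<rightarrow>\<^sub>M prob_algebra ?Y"
    by (auto intro: measurable_compose)
  let ?N = "z \<bind> (\<lambda>x. trans_kernel M (x, a) \<bind> (\<lambda>x'. obs_kernel M (a, x')))"
  have PQ: "(\<lambda>x. trans_kernel M (x, a) \<bind> (\<lambda>x'. obs_kernel M (a, x'))) \<in> ?X \<rightarrow>\<^sub>M prob_algebra ?Y"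
    by (rule measurable_bind_prob_space[OF P Q])
  have rect: "R_rect M z a (states M) C = emeasure ?N C" if C: "C \<in> sets ?Y" for C
  proof -
    have "R_rect M z a (states M) C =
        (\<integral>\<^sup>+x. (\<integral>\<^sup>+x'. emeasure (obs_kernel M (a, x')) C \<partial>trans_kernel M (x, a)) \<partial>z)"
      unfolding R_rect_def
    proof (intro nn_integral_cong)
      fix x x' assume "x \<in> space z" "x' \<in> space (trans_kernel M (x, a))"
      then have "x' \<in> states M"
        using z measurable_space[OF P, of x]
        by (auto simp: space_prob_algebra dest!: sets_eq_imp_space_eq)
      then show "emeasure (obs_kernel M (a, x')) C * indicator (states M) x' =
          emeasure (obs_kernel M (a, x')) C" by simp
    qed
    also have "\<dots> = (\<integral>\<^sup>+x. emeasure (trans_kernel M (x, a) \<bind> (\<lambda>x'. obs_kernel M (a, x'))) C \<partial>z)"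
    proof (intro nn_integral_cong)
      fix x assume "x \<in> space z"
      then have "trans_kernel M (x, a) \<in> space (prob_algebra ?X)"
        using z measurable_space[OF P, of x] by (auto simp: space_prob_algebra dest!: sets_eq_imp_space_eq)
      from emeasure_bind_prob_algebra[OF this Q C]
      show "(\<integral>\<^sup>+x'. emeasure (obs_kernel M (a, x')) C \<partial>trans_kernel M (x, a)) =
          emeasure (trans_kernel M (x, a) \<bind> (\<lambda>x'. obs_kernel M (a, x'))) C" ..
    qed
    also have "\<dots> = emeasure ?N C"
      using emeasure_bind_prob_algebra[OF z PQ C] ..
    finally show ?thesis .
  qed
  have sets: "sets ?N = sets ?Y" by (rule sets_bind'[OF z PQ])
  have "R' M (z, a) = measure_of (observations M) (sets ?Y) (emeasure ?N)"
    unfolding R'_def prod.case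
    using sets.space_closed[of ?Y] sets.sigma_sets_eq[of ?Y]
    by (intro measure_of_eq) (auto simp: rect)
  also have "\<dots> = ?N"
    using measure_of_of_measure[of ?N] sets sets_eq_imp_space_eq[OF sets] by simp
  finally show ?thesis using rect[OF C] by simp
qed

definition filter_kernel ::
    "('x::topological_space, 'y::topological_space, 'a::topological_space) pomdp \<Rightarrow>
     ('x measure \<times> 'a \<times> 'y \<Rightarrow> 'x measure) \<Rightarrow> bool" where
  "filter_kernel M H \<longleftrightarrow>
     stochastic_kernel (borel_of (X_top M))
       (borel_of (prod_topology (PX_top M) (prod_topology (A_top M) (Y_top M)))) H \<and>
     (\<forall>B\<in>sets (borel_of (X_top M)). \<forall>C\<in>sets (borel_of (Y_top M)).
      \<forall>z\<in>prob_measures (X_top M). \<forall>a\<in>actions M.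
        R_rect M z a B C = (\<integral>\<^sup>+y\<in>C. emeasure (H (z, a, y)) B \<partial>R' M (z, a)))"

definition assumption_H ::
    "('x::topological_space, 'y::topological_space, 'a::topological_space) pomdp \<Rightarrow> bool" where
  "assumption_H M \<longleftrightarrow>
     (\<exists>H. filter_kernel M H \<and>
       (\<forall>zs z as a.
          range zs \<subseteq> prob_measures (X_top M) \<and> z \<in> prob_measures (X_top M) \<and>
          converges_weakly (X_top M) zs z \<and>
          range as \<subseteq> actions M \<and> a \<in> actions M \<and> as \<longlonglongrightarrow> a \<longrightarrow>
          (\<exists>r C. strict_mono (r :: nat \<Rightarrow> nat) \<and> C \<in> sets (borel_of (Y_top M)) \<and>
             emeasure (R' M (z, a)) C = 1 \<and>
             (\<forall>y\<in>C. converges_weakly (X_top M) (\<lambda>k. H (zs (r k), as (r k), y)) (H (z, a, y))))))"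

text \<open>
  The transition kernel of the COMDP is built from a given solution \<open>H\<close> of the filtering equation;
  it does not depend on the choice of that solution.
\<close>

definition COMDP ::
    "('x::topological_space, 'y::topological_space, 'a::topological_space) pomdp \<Rightarrow>
     ('x measure \<times> 'a \<times> 'y \<Rightarrow> 'x measure) \<Rightarrow> ('x measure, 'a) mdp" where
  "COMDP M H =
     \<lparr> state_space = PX_top M,
       action_space = A_top M,
       transition = (\<lambda>(z, a). distr (R' M (z, a)) (borel_of (PX_top M)) (\<lambda>y. H (z, a, y))),
       step_cost = (\<lambda>(z, a). ereal_integral z (\<lambda>x. cost M (x, a))) \<rparr>"

definition bellman_filter ::
    "('x, 'y, 'a) pomdp \<Rightarrow> ('x measure \<times> 'a \<times> 'y \<Rightarrow> 'x measure) \<Rightarrow> real \<Rightarrow>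
     ('x measure \<Rightarrow> ereal) \<Rightarrow> 'x measure \<Rightarrow> 'a \<Rightarrow> ereal" where
  "bellman_filter M H \<alpha> v z a =
     ereal_integral z (\<lambda>x. cost M (x, a)) +
     ereal \<alpha> * ereal_integral z (\<lambda>x. ereal_integral (trans_kernel M (x, a))
       (\<lambda>x'. ereal_integral (obs_kernel M (a, x')) (\<lambda>y. v (H (z, a, y)))))"


section \<open>Optimality properties of the COMDP\<close>

definition property_O1 :: "('s, 'a) mdp \<Rightarrow> real \<Rightarrow> bool" where
  "property_O1 D \<alpha> \<longleftrightarrow>
     (\<forall>t::nat. lower_semicontinuous (state_space D) (opt_value D \<alpha> (enat t))) \<and>
     lower_semicontinuous (state_space D) (opt_value D \<alpha> \<infinity>) \<and>
     (\<forall>z\<in>topspace (state_space D). (\<lambda>t::nat. opt_value D \<alpha> (enat t) z) \<longlonglongrightarrow> opt_value D \<alpha> \<infinity> z)"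

text \<open>Shared form of (O2), for \<open>T = enat t\<close>, and (O4), for \<open>T = \<infinity>\<close>.\<close>

definition optimality_equation ::
    "('x::topological_space, 'y::topological_space, 'a::topological_space) pomdp \<Rightarrow>
     ('x measure \<times> 'a \<times> 'y \<Rightarrow> 'x measure) \<Rightarrow> real \<Rightarrow> enat \<Rightarrow> bool" where
  "optimality_equation M H \<alpha> T \<longleftrightarrow>
     (let D = COMDP M H in
      (\<forall>z\<in>prob_measures (X_top M).
         is_min (actions M) (bellman D \<alpha> (opt_value D \<alpha> T) z) (opt_value D \<alpha> (eSuc T) z) \<and>
         is_min (actions M) (bellman_filter M H \<alpha> (opt_value D \<alpha> T) z) (opt_value D \<alpha> (eSuc T) z) \<and>
         opt_actions D \<alpha> T z \<noteq> {} \<and>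
         (opt_value D \<alpha> (eSuc T) z = \<infinity> \<longrightarrow> opt_actions D \<alpha> T z = actions M) \<and>
         (opt_value D \<alpha> (eSuc T) z < \<infinity> \<longrightarrow> compactin (A_top M) (opt_actions D \<alpha> T z))) \<and>
      {(z, a). z \<in> prob_measures (X_top M) \<and> a \<in> opt_actions D \<alpha> T z}
        \<in> sets (borel_of (prod_topology (PX_top M) (A_top M))))"

definition property_O2 where
  "property_O2 M H \<alpha> \<longleftrightarrow> (\<forall>t::nat. optimality_equation M H \<alpha> (enat t))"

text \<open>
  Costs up to horizon \<open>T\<close> only involve the first \<open>T\<close> decision rules, so a \<open>T\<close>-horizon Markov
  policy is represented by any Markov policy that extends it.
\<close>

definition property_O3 :: "('s, 'a) mdp \<Rightarrow> real \<Rightarrow> bool" where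
  "property_O3 D \<alpha> \<longleftrightarrow>
     (\<forall>T::nat. 1 \<le> T \<longrightarrow>
        (\<exists>\<phi>. is_markov D \<phi> \<and> is_optimal D \<alpha> (enat T) (markov_policy D \<phi>)) \<and>
        (\<forall>\<phi>. is_markov D \<phi> \<and>
             (\<forall>z\<in>topspace (state_space D). \<forall>t<T. \<phi> (T - 1 - t) z \<in> opt_actions D \<alpha> (enat t) z) \<longrightarrow>
             is_optimal D \<alpha> (enat T) (markov_policy D \<phi>)))"

definition property_O4 where
  "property_O4 M H \<alpha> \<longleftrightarrow> optimality_equation M H \<alpha> \<infinity>"

definition property_O5 :: "('s, 'a) mdp \<Rightarrow> real \<Rightarrow> bool" where
  "property_O5 D \<alpha> \<longleftrightarrow>
     (\<exists>\<phi>. is_markov D (\<lambda>_. \<phi>) \<and> is_optimal D \<alpha> \<infinity> (markov_policy D (\<lambda>_. \<phi>))) \<and>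
     (\<forall>\<phi>. is_markov D (\<lambda>_. \<phi>) \<longrightarrow>
        (is_optimal D \<alpha> \<infinity> (markov_policy D (\<lambda>_. \<phi>)) \<longleftrightarrow>
         (\<forall>z\<in>topspace (state_space D). \<phi> z \<in> opt_actions D \<alpha> \<infinity> z)))"

definition property_O6 :: "('s, 'a) mdp \<Rightarrow> real \<Rightarrow> bool" where
  "property_O6 D \<alpha> \<longleftrightarrow>
     (inf_compact (prod_topology (state_space D) (action_space D)) (step_cost D) \<longrightarrow>
        (\<forall>t::nat. 1 \<le> t \<longrightarrow> inf_compact (state_space D) (opt_value D \<alpha> (enat t))) \<and>
        inf_compact (state_space D) (opt_value D \<alpha> \<infinity>))"

end

theory Submission
  imports Defs
begin

text \<open>
  Everything rests on one inequality, Fatou's lemma for weakly convergent measures with varying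
  integrands (\<open>fatou_weak_convergence\<close>): if \<open>\<mu>\<^sub>n \<rightarrow> \<mu>\<close> weakly and
  \<open>F x \<le> liminf f\<^sub>n x\<^sub>n\<close> whenever \<open>x\<^sub>n \<rightarrow> x\<close>, then
  \<open>\<integral>F d\<mu> \<le> liminf \<integral>f\<^sub>n d\<mu>\<^sub>n\<close>. Bounded Lipschitz functions \<open>h\<^sub>N\<close> that lie below all \<open>f\<^sub>n\<close>
  with \<open>n \<ge> N\<close> and have a supremum above \<open>F\<close> reduce it to the definition of weak convergence.
  Lower semicontinuity is therefore used in its sequential form throughout. Sequences
  determine the topology because the space of beliefs \<open>\<P>(X)\<close> is separable and metrizable
  (\<open>metrizable_second_countable_weak_topology\<close>): countably many integrals, those of finite maxima
  of tent functions, generate its topology.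

  Assumption (W*). Fatou's lemma makes \<open>\<integral>c(x, a) z(dx)\<close> lower semicontinuous in \<open>(z, a)\<close>. It also
  gives compactness in \<open>a\<close>: if \<open>z\<^sub>n\<close> converges weakly and \<open>a\<^sub>n\<close> has no convergent subsequence, then
  \<open>c(x\<^sub>n, a\<^sub>n) \<rightarrow> \<infinity>\<close> along every convergent \<open>x\<^sub>n\<close>, so Fatou's lemma with \<open>F = \<infinity>\<close> shows that
  \<open>\<integral>c(x, a\<^sub>n) z\<^sub>n(dx) \<rightarrow> \<infinity>\<close> (\<open>nn_integral_seq_K_inf_compact\<close>). For the weak continuity of \<open>q\<close> it
  suffices that \<open>\<integral>f dq(z, a)\<close> is lower semicontinuous for all nonnegative bounded continuous
  \<open>f\<close>. The filter is almost everywhere unique (\<open>AE_filter_unique\<close>), so this integral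
  equals \<open>\<integral>f(H'(z, a, y)) R'(dy|z, a)\<close> with whichever filter \<open>H'\<close> the hypothesis provides. In the
  first alternative the claim is Fatou's lemma for setwise convergent measures along the subsequences
  given by assumption (H) (\<open>q_weakly_continuous_of_setwise\<close>). In the second the integral is an
  iterated one, against \<open>z\<close>, then \<open>P\<close>, then \<open>Q\<close>, and each integration against a weakly continuous
  kernel preserves lower semicontinuity (\<open>q_weakly_continuous_of_weak\<close>).

  Optimality. Adding a constant \<open>b\<close> to the cost makes it nonnegative and changes the total costs
  by the constant \<open>\<Sum>t. \<alpha>\<^sup>t b\<close>, which is finite since \<open>b = 0\<close> or \<open>\<alpha> < 1\<close>; hence the
  dynamic programming takes place in \<open>[0, \<infinity>]\<close>. The value iterates \<open>W n\<close> are lower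
  semicontinuous, and the compactness in the actions does three things: it makes every minimum over
  actions attained, by a Borel map of the state (\<open>exists_measurable_minimizer\<close>); it keeps the
  minimum lower semicontinuous; and it makes the limit \<open>W_lim\<close> of the iterates a fixed point of the
  Bellman equation (\<open>W_lim_fixed_point\<close>). To compare the iterates with actual costs, follow the
  expected cost of the first \<open>n\<close> stages plus a terminal value at stage \<open>n\<close>: as \<open>n\<close> grows, this
  quantity increases for every policy and is constant for one that minimizes in the Bellman
  equation. The iterates are thus lower bounds (\<open>W_le_J\<close>, \<open>W_lim_le_J_lim\<close>) and minimizing
  policies attain them (\<open>J_greedy\<close>, \<open>J_lim_greedy\<close>). Conversely an optimal stationary policy
  satisfies the Bellman equation, because its own cost does (\<open>J_lim_stationary\<close>).
\<close>

section \<open>Fatou's lemma for weakly convergent measures\<close>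

lemma (in Metric_space) Lipschitz_real_continuous_map:
  assumes "\<And>x y. x \<in> M \<Longrightarrow> y \<in> M \<Longrightarrow> \<bar>f x - f y\<bar> \<le> L * d x y"
  shows "continuous_map mtopology euclideanreal f"
  unfolding continuous_map_def
proof (intro conjI allI impI)
  fix U :: "real set" assume U: "openin euclidean U"
  show "openin mtopology {x \<in> topspace mtopology. f x \<in> U}"
    unfolding openin_mtopology
  proof (intro conjI allI impI subsetI)
    fix x assume x: "x \<in> {x \<in> topspace mtopology. f x \<in> U}"
    with U obtain e where e: "e > 0" "ball (f x) e \<subseteq> U" by (auto simp: open_contains_ball)
    have "mball x (e / (\<bar>L\<bar> + 1)) \<subseteq> {x \<in> topspace mtopology. f x \<in> U}"
    proof
      fix y assume "y \<in> mball x (e / (\<bar>L\<bar> + 1))"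
      then have y: "x \<in> M" "y \<in> M" "d x y < e / (\<bar>L\<bar> + 1)" by auto
      have "\<bar>f x - f y\<bar> \<le> L * d x y" using assms y by auto
      also have "\<dots> \<le> (\<bar>L\<bar> + 1) * d x y" by (intro mult_right_mono) auto
      also have "\<dots> < e" using y(3) by (simp add: field_simps)
      finally show "y \<in> {x \<in> topspace mtopology. f x \<in> U}"
        using y e by (auto simp: dist_real_def mem_ball subset_iff)
    qed
    then show "\<exists>r>0. mball x r \<subseteq> {x \<in> topspace mtopology. f x \<in> U}"
      using e(1) by (intro exI[of _ "e / (\<bar>L\<bar> + 1)"]) auto
  qed auto
qed auto

lemma continuous_map_borel_of_measurable:
  assumes f: "continuous_map S T f"
  shows "f \<in> borel_of S \<rightarrow>\<^sub>M borel_of T"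
  unfolding borel_of_def[of T]
proof (rule measurable_measure_of)
  show "{U. openin T U} \<subseteq> Pow (topspace T)" by (auto dest: openin_subset)
  show "f \<in> space (borel_of S) \<rightarrow> topspace T"
    using f by (auto simp: continuous_map_def)
  fix U assume "U \<in> {U. openin T U}"
  then have "openin S {x \<in> topspace S. f x \<in> U}" using f by (auto simp: continuous_map_def)
  moreover have "f -` U \<inter> space (borel_of S) = {x \<in> topspace S. f x \<in> U}" by auto
  ultimately show "f -` U \<inter> space (borel_of S) \<in> sets (borel_of S)"
    by (auto simp: borel_of_def intro!: in_measure_of dest: openin_subset)
qed

lemma openin_sets_borel_of: "openin S U \<Longrightarrow> U \<in> sets (borel_of S)"
  unfolding borel_of_def by (auto intro!: in_measure_of dest: openin_subset)

lemma borel_of_euclidean [simp]: "borel_of euclidean = borel"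
  by (simp add: borel_of_def borel_def)

lemma continuous_map_real_borel_of:
  "continuous_map S euclidean f \<Longrightarrow> f \<in> borel_measurable (borel_of S)"
  using continuous_map_borel_of_measurable[of S euclidean f] by simp

lemma prob_measuresD:
  assumes "\<mu> \<in> prob_measures S"
  shows "sets \<mu> = sets (borel_of S)" "space \<mu> = topspace S" "prob_space \<mu>"
  using assms sets_eq_imp_space_eq[of \<mu> "borel_of S"] by (simp_all add: space_prob_algebra)

lemma bounded_continuous_shift:
  assumes "bounded_continuous S f"
  shows "bounded_continuous S (\<lambda>x. f x + c)"
proof -
  from assms obtain B where "\<And>x. x \<in> topspace S \<Longrightarrow> \<bar>f x\<bar> \<le> B"
    by (auto simp: bounded_continuous_def bounded_iff)
  then have "norm (f x + c) \<le> B + \<bar>c\<bar>" if "x \<in> topspace S" for x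
    using that by (intro order_trans[OF norm_triangle_ineq]) auto
  then have "bounded ((\<lambda>x. f x + c) ` topspace S)" unfolding bounded_iff by blast
  then show ?thesis using assms by (auto simp: bounded_continuous_def intro!: continuous_intros)
qed

lemma bounded_continuous_uminus: "bounded_continuous S f \<Longrightarrow> bounded_continuous S (\<lambda>x. - f x)"
  by (auto simp: bounded_continuous_def bounded_iff intro!: continuous_intros)

lemma bounded_continuous_integrable:
  assumes f: "bounded_continuous S f" and \<mu>: "\<mu> \<in> prob_measures S"
  shows "integrable \<mu> f"
proof -
  note \<mu>' = prob_measuresD[OF \<mu>]
  interpret prob_space \<mu> by fact
  have [measurable]: "f \<in> borel_measurable \<mu>"
    using f continuous_map_real_borel_of[of S f] measurable_cong_sets[OF \<mu>'(1) refl]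
    by (auto simp: bounded_continuous_def)
  from f obtain B where B: "\<And>x. x \<in> topspace S \<Longrightarrow> \<bar>f x\<bar> \<le> B"
    by (auto simp: bounded_continuous_def bounded_iff)
  show ?thesis
    by (rule integrable_const_bound[where B=B]) (use B \<mu>' in auto)
qed

lemma integral_shift:
  assumes "bounded_continuous S f" and \<mu>: "\<mu> \<in> prob_measures S"
  shows "(\<integral>x. f x + c \<partial>\<mu>) = (\<integral>x. f x \<partial>\<mu>) + c"
proof -
  interpret prob_space \<mu> using prob_measuresD(3)[OF \<mu>] .
  show ?thesis using bounded_continuous_integrable[OF assms] by (simp add: prob_space)
qed

lemma nn_integral_bounded_continuous:
  assumes f: "bounded_continuous S f" and nonneg: "\<And>x. x \<in> topspace S \<Longrightarrow> 0 \<le> f x"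
    and \<mu>: "\<mu> \<in> prob_measures S"
  shows "(\<integral>\<^sup>+x. ennreal (f x) \<partial>\<mu>) = ennreal (\<integral>x. f x \<partial>\<mu>)"
  using bounded_continuous_integrable[OF f \<mu>] nonneg prob_measuresD(2)[OF \<mu>]
  by (intro nn_integral_eq_integral) auto

text \<open>
  The part of Fatou's lemma that weak and setwise convergence share: it is enough to find
  functions \<open>h N\<close> that lie below the integrands from index \<open>N\<close> on, have convergent integrals, and
  together reach the limit integrand.
\<close>
lemma fatou_of_approximation:
  fixes h :: "nat \<Rightarrow> 'a \<Rightarrow> ennreal"
  assumes lim: "\<And>N. (\<lambda>n. \<integral>\<^sup>+x. h N x \<partial>\<mu>s n) \<longlonglongrightarrow> (\<integral>\<^sup>+x. h N x \<partial>\<mu>)"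
    and inc: "incseq h" and meas: "\<And>N. h N \<in> borel_measurable \<mu>"
    and le: "\<And>N n x. N \<le> n \<Longrightarrow> x \<in> space (\<mu>s n) \<Longrightarrow> h N x \<le> f n x"
    and F: "AE x in \<mu>. F x \<le> (SUP N. h N x)"
  shows "(\<integral>\<^sup>+x. F x \<partial>\<mu>) \<le> liminf (\<lambda>n. \<integral>\<^sup>+x. f n x \<partial>\<mu>s n)"
proof -
  have "(\<integral>\<^sup>+x. h N x \<partial>\<mu>) \<le> liminf (\<lambda>n. \<integral>\<^sup>+x. f n x \<partial>\<mu>s n)" for N
  proof -
    have "(\<integral>\<^sup>+x. h N x \<partial>\<mu>) = liminf (\<lambda>n. \<integral>\<^sup>+x. h N x \<partial>\<mu>s n)"
      using lim[of N] by (simp add: lim_imp_Liminf)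
    also have "\<dots> \<le> liminf (\<lambda>n. \<integral>\<^sup>+x. f n x \<partial>\<mu>s n)"
      by (rule Liminf_mono, rule eventually_mono[OF eventually_ge_at_top[of N]])
         (auto intro!: nn_integral_mono le)
    finally show ?thesis .
  qed
  then have "(SUP N. \<integral>\<^sup>+x. h N x \<partial>\<mu>) \<le> liminf (\<lambda>n. \<integral>\<^sup>+x. f n x \<partial>\<mu>s n)" by (rule SUP_least)
  moreover have "(\<integral>\<^sup>+x. F x \<partial>\<mu>) \<le> (\<integral>\<^sup>+x. (SUP N. h N x) \<partial>\<mu>)" by (rule nn_integral_mono_AE[OF F])
  ultimately show ?thesis
    using nn_integral_monotone_convergence_SUP[OF inc meas] by simp
qed

text \<open>
  The approximating functions are the Lipschitz envelopes
  \<open>h N x = inf {min (f n x') N + N d(x, x') | n \<ge> N, x' \<in> M}\<close>. They are \<open>N\<close>-Lipschitz and bounded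
  by \<open>N\<close>, hence admissible in the definition of weak convergence. If \<open>h N x < t < F x\<close> for all \<open>N\<close>,
  then the infima are approached at points \<open>x'\<close> ever closer to \<open>x\<close> where \<open>f n x' < t\<close> for ever
  larger \<open>n\<close>, and these points contradict the hypothesis on \<open>F\<close>.
\<close>
lemma (in Metric_space) nn_integral_fatou_weak:
  assumes conv: "converges_weakly mtopology \<mu>s \<mu>"
    and \<mu>s: "\<And>n. \<mu>s n \<in> prob_measures mtopology" and \<mu>: "\<mu> \<in> prob_measures mtopology"
    and F: "\<And>\<sigma> x. range \<sigma> \<subseteq> M \<Longrightarrow> limitin mtopology \<sigma> x sequentially \<Longrightarrow>
              F x \<le> liminf (\<lambda>n. f n (\<sigma> n))"
  shows "(\<integral>\<^sup>+x. F x \<partial>\<mu>) \<le> liminf (\<lambda>n. \<integral>\<^sup>+x. f n x \<partial>\<mu>s n)"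
proof -
  have sp: "space \<mu> = M" "space (\<mu>s n) = M" for n
    using prob_measuresD(2)[OF \<mu>] prob_measuresD(2)[OF \<mu>s[of n]] by simp_all
  define h :: "nat \<Rightarrow> 'a \<Rightarrow> ennreal" where
    "h N x = (INF p\<in>{N..}\<times>M. min (f (fst p) (snd p)) (of_nat N) + ennreal (real N * d x (snd p)))" for N x
  have h_le: "h N x \<le> min (f n x') (of_nat N) + ennreal (real N * d x x')"
    if "N \<le> n" "x' \<in> M" for N n x x'
    unfolding h_def using that by (intro INF_lower2[of "(n, x')"]) auto
  have h_le_f: "h N x \<le> f n x" if "N \<le> n" "x \<in> M" for N n x
    using h_le[OF that, of x] that(2) by simp
  have h_bound: "h N x \<le> of_nat N" if "x \<in> M" for N x
    using h_le[OF order_refl that, of N x] that by simp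
  have h_fin: "h N x < top" if "x \<in> M" for N x
    using h_bound[OF that, of N] by (rule le_less_trans) (simp add: ennreal_of_nat_eq_real_of_nat)
  have h_Lip: "h N x \<le> h N y + ennreal (real N * d x y)" if "x \<in> M" "y \<in> M" for N x y
  proof -
    have "h N x \<le> min (f n x') (of_nat N) + ennreal (real N * d y x') + ennreal (real N * d x y)"
      if "N \<le> n" "x' \<in> M" for n x'
    proof -
      have "real N * d x x' \<le> real N * d y x' + real N * d x y"
        using triangle[of x y x'] \<open>x \<in> M\<close> \<open>y \<in> M\<close> \<open>x' \<in> M\<close>
        by (metis add.commute distrib_left mult_left_mono of_nat_0_le_iff)
      then have "ennreal (real N * d x x') \<le> ennreal (real N * d y x') + ennreal (real N * d x y)"
        using ennreal_leI by (subst ennreal_plus[symmetric]) (simp_all del: ennreal_plus)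
      then show ?thesis
        using h_le[OF that, of x] by (metis add.assoc add_left_mono order_trans)
    qed
    then have "h N x - ennreal (real N * d x y) \<le> min (f n x') (of_nat N) + ennreal (real N * d y x')"
      if "N \<le> n" "x' \<in> M" for n x'
      using that by (simp add: ennreal_minus_le_iff add.commute[of "ennreal (real N * d x y)"])
    then have "h N x - ennreal (real N * d x y) \<le> h N y"
      unfolding h_def[of N y] by (intro INF_greatest) (auto simp: mem_Times_iff)
    then show ?thesis by (simp add: ennreal_minus_le_iff add.commute[of "ennreal (real N * d x y)"])
  qed
  define g where "g N x = enn2real (h N x)" for N x
  have hg: "h N x = ennreal (g N x)" if "x \<in> M" for N x
    using h_fin[OF that, of N] by (simp add: g_def)
  have g_bound: "g N x \<le> real N" "0 \<le> g N x" if "x \<in> M" for N x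
  proof -
    show "0 \<le> g N x" by (simp add: g_def)
    show "g N x \<le> real N"
      using h_bound[OF that, of N] unfolding g_def
      by (intro enn2real_leI) (simp_all add: ennreal_of_nat_eq_real_of_nat)
  qed
  have g_Lip1: "g N x \<le> g N y + real N * d x y" if "x \<in> M" "y \<in> M" for N x y
  proof -
    have "ennreal (g N x) \<le> ennreal (g N y) + ennreal (real N * d x y)"
      using h_Lip[OF that, of N] by (simp only: hg[OF that(1)] hg[OF that(2)])
    also have "\<dots> = ennreal (g N y + real N * d x y)"
      using g_bound(2)[OF that(2), of N] by (intro ennreal_plus[symmetric]) auto
    finally show ?thesis using g_bound(2)[OF that(2), of N] by (simp add: ennreal_le_iff del: ennreal_plus)
  qed
  have g_Lip: "\<bar>g N x - g N y\<bar> \<le> real N * d x y" if "x \<in> M" "y \<in> M" for N x y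
    using g_Lip1[OF that, of N] g_Lip1[OF that(2,1), of N] commute[of x y] by auto
  have bc: "bounded_continuous mtopology (g N)" for N
    unfolding bounded_continuous_def
    using Lipschitz_real_continuous_map[OF g_Lip, of N] g_bound
    by (auto simp: bounded_iff intro!: exI[of _ "real N"])
  have int_h: "(\<integral>\<^sup>+x. h N x \<partial>\<nu>) = ennreal (\<integral>x. g N x \<partial>\<nu>)" if "\<nu> \<in> prob_measures mtopology" for N \<nu>
  proof -
    have "space \<nu> = M" using prob_measuresD(2)[OF that] by simp
    then have "(\<integral>\<^sup>+x. h N x \<partial>\<nu>) = (\<integral>\<^sup>+x. ennreal (g N x) \<partial>\<nu>)" by (intro nn_integral_cong) (simp add: hg)
    then show ?thesis using nn_integral_bounded_continuous[OF bc _ that, of N] g_bound by simp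
  qed
  have h_inc: "h N x \<le> h N' x" if "N \<le> N'" for N N' x
  proof -
    have "h N x \<le> min (f n x') (of_nat N') + ennreal (real N' * d x x')" if "N' \<le> n" "x' \<in> M" for n x'
    proof -
      have "min (f n x') (of_nat N) \<le> min (f n x') (of_nat N')"
        using \<open>N \<le> N'\<close> by (intro min.mono) auto
      moreover have "ennreal (real N * d x x') \<le> ennreal (real N' * d x x')"
        using \<open>N \<le> N'\<close> by (intro ennreal_leI mult_right_mono) auto
      ultimately show ?thesis
        using h_le[of N n x' x] that \<open>N \<le> N'\<close> by (meson add_mono order_trans)
    qed
    then show ?thesis unfolding h_def[of N'] by (intro INF_greatest) auto
  qed
  have F_le: "F x \<le> (SUP N. h N x)" if x: "x \<in> M" for x
  proof (rule ccontr)
    assume "\<not> F x \<le> (SUP N. h N x)"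
    then obtain t where t: "(SUP N. h N x) < t" "t < F x" using dense[of "SUP N. h N x" "F x"] by (auto simp: not_le)
    have "t < top" by (rule less_le_trans[OF t(2) top_greatest])
    then obtain r where r: "t = ennreal r" "0 \<le> r" by (cases t) auto
    have h_lt: "h N x < t" for N using t(1) by (meson SUP_upper UNIV_I order_le_less_trans)
    have "\<exists>n\<ge>N. \<exists>x'\<in>M. d x x' < inverse (real (Suc N)) \<and> f n x' < t" for N
    proof -
      \<comment> \<open>\<open>K\<close> is so large that the truncation at \<open>K\<close> lies above \<open>t = r\<close>
        and that the penalty \<open>K d(x, x')\<close> stays below \<open>r\<close> only if \<open>d(x, x') < 1 / (N + 1)\<close>\<close>
      define K where "K = nat \<lceil>r * real (Suc N)\<rceil> + N"
      have K: "real K \<ge> r * real (Suc N)" "K \<ge> N" unfolding K_def by linarith+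
      have rK: "r \<le> real K"
        using K(1) mult_left_mono[of 1 "real (Suc N)" r] r(2) by simp
      from h_lt[of K] obtain n x' where n: "n \<ge> K" "x' \<in> M"
        and lt: "min (f n x') (of_nat K) + ennreal (real K * d x x') < t"
        unfolding h_def INF_less_iff by auto
      have "f n x' < t"
      proof -
        have "min (f n x') (of_nat K) < t" by (rule le_less_trans[OF _ lt]) simp
        moreover have "t \<le> of_nat K" using rK r by (simp add: ennreal_of_nat_eq_real_of_nat ennreal_leI)
        ultimately show ?thesis by (auto simp: min_def split: if_splits)
      qed
      moreover have "d x x' < inverse (real (Suc N))"
      proof (rule ccontr)
        assume "\<not> d x x' < inverse (real (Suc N))"
        then have ge: "inverse (real (Suc N)) \<le> d x x'" by simp
        have "r = r * real (Suc N) * inverse (real (Suc N))" by (simp add: field_simps)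
        also have "\<dots> \<le> real K * d x x'" using K(1) ge r(2) by (intro mult_mono) auto
        finally have "t \<le> ennreal (real K * d x x')" using r by (simp add: ennreal_leI)
        then show False using lt by (meson add_increasing leD order_trans zero_le)
      qed
      ultimately show ?thesis using n K(2) by (meson order_trans)
    qed
    then obtain n' y' where n': "\<And>N. n' N \<ge> N" "\<And>N. y' N \<in> M"
      "\<And>N. d x (y' N) < inverse (real (Suc N))" "\<And>N. f (n' N) (y' N) < t" by metis
    \<comment> \<open>the bad points are placed at their own indices; all other entries are \<open>x\<close>\<close>
    define \<sigma> where "\<sigma> m = (if \<exists>N. n' N = m then y' (SOME N. n' N = m) else x)" for m
    have n'_inf: "\<exists>N. n' N = m \<Longrightarrow> n' (SOME N. n' N = m) = m" for m by (rule someI_ex)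
    have sub: "range \<sigma> \<subseteq> M" using n' x by (auto simp: \<sigma>_def)
    have "limitin mtopology \<sigma> x sequentially"
      unfolding limit_metric_sequentially
    proof (intro conjI allI impI)
      fix e :: real assume "e > 0"
      then obtain K where K: "inverse (real (Suc K)) < e" using reals_Archimedean by blast
      have "\<sigma> m \<in> M \<and> d (\<sigma> m) x < e" if m: "m \<ge> Suc (\<Sum>N<K. n' N)" for m
      proof (cases "\<exists>N. n' N = m")
        case True
        define N where "N = (SOME N. n' N = m)"
        have N: "n' N = m" using n'_inf[OF True] by (simp add: N_def)
        have "K \<le> N"
        proof (rule ccontr)
          assume "\<not> K \<le> N"
          then have "n' N \<le> (\<Sum>N<K. n' N)" by (intro member_le_sum) auto
          then show False using N m by simp
        qed
        then have "inverse (real (Suc N)) \<le> inverse (real (Suc K))" by simp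
        then have "d x (y' N) < e" using n'(3)[of N] K by linarith
        then show ?thesis using True n'(2) by (auto simp: \<sigma>_def N_def[symmetric] commute)
      next
        case False
        then show ?thesis using x \<open>e > 0\<close> by (simp add: \<sigma>_def)
      qed
      then show "\<exists>Na. \<forall>n\<ge>Na. \<sigma> n \<in> M \<and> d (\<sigma> n) x < e" by blast
    qed (rule x)
    then have "F x \<le> liminf (\<lambda>n. f n (\<sigma> n))" by (rule F[OF sub])
    then have "\<forall>\<^sub>F n in sequentially. t < f n (\<sigma> n)" using t(2) by (auto simp: le_Liminf_iff)
    then obtain N where "\<And>n. n \<ge> N \<Longrightarrow> t < f n (\<sigma> n)" by (auto simp: eventually_sequentially)
    from this[OF n'(1)[of N]] have "t < f (n' N) (\<sigma> (n' N))" .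
    moreover have "f (n' N) (\<sigma> (n' N)) < t"
    proof -
      have ex: "\<exists>k. n' k = n' N" by blast
      show ?thesis using n'(4)[of "SOME k. n' k = n' N"] n'_inf[OF ex] ex by (auto simp: \<sigma>_def)
    qed
    ultimately show False by simp
  qed
  show ?thesis
  proof (rule fatou_of_approximation)
    show "(\<lambda>n. \<integral>\<^sup>+x. h N x \<partial>\<mu>s n) \<longlonglongrightarrow> (\<integral>\<^sup>+x. h N x \<partial>\<mu>)" for N
      using conv bc by (simp add: int_h \<mu> \<mu>s tendsto_ennrealI converges_weakly_def)
    show "incseq h" by (auto simp: incseq_def le_fun_def intro: h_inc)
    have "(\<lambda>x. ennreal (g N x)) \<in> borel_measurable \<mu>" for N
      using bounded_continuous_integrable[OF bc \<mu>] by auto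
    then show "h N \<in> borel_measurable \<mu>" for N
      by (rule measurable_cong[THEN iffD2, rotated]) (simp add: sp hg)
    show "AE x in \<mu>. F x \<le> (SUP N. h N x)" by (rule AE_I2) (simp add: sp F_le)
  qed (simp add: sp h_le_f)
qed

section \<open>Sequential lower semicontinuity and Borel sets\<close>

lemma metrizable_closedin_sequentially:
  assumes "metrizable_space S"
  shows "closedin S C \<longleftrightarrow>
    C \<subseteq> topspace S \<and> (\<forall>\<sigma> l. range \<sigma> \<subseteq> C \<and> limitin S \<sigma> l sequentially \<longrightarrow> l \<in> C)"
proof -
  from assms obtain M d where "Metric_space M d" and S: "S = Metric_space.mtopology M d"
    by (auto simp: metrizable_space_def)
  then interpret Metric_space M d by simp
  show ?thesis unfolding S metric_closedin_iff_sequentially_closed by simp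
qed

lemma metrizable_compactin_sequentially:
  assumes "metrizable_space S"
  shows "compactin S C \<longleftrightarrow> C \<subseteq> topspace S \<and>
    (\<forall>\<sigma>::nat \<Rightarrow> _. range \<sigma> \<subseteq> C \<longrightarrow> (\<exists>l r. l \<in> C \<and> strict_mono r \<and> limitin S (\<sigma> \<circ> r) l sequentially))"
proof -
  from assms obtain M d where "Metric_space M d" and S: "S = Metric_space.mtopology M d"
    by (auto simp: metrizable_space_def)
  then interpret Metric_space M d by simp
  show ?thesis unfolding S compactin_sequentially by simp
qed

lemma second_countable_euclidean: "second_countable (euclidean :: 'a::second_countable_topology topology)"
proof -
  obtain B :: "'a set set" where "countable B" "topological_basis B"
    using ex_countable_basis by blast
  then show ?thesis
    unfolding second_countable_def
    by (intro exI[of _ B]) (simp, metis topological_basisE topological_basis_open)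
qed

lemma sets_borel_of_prod_topology:
  assumes "second_countable S" "second_countable T"
  shows "sets (borel_of (prod_topology S T)) = sets (borel_of S \<Otimes>\<^sub>M borel_of T)"
proof
  have "fst \<in> borel_of (prod_topology S T) \<rightarrow>\<^sub>M borel_of S" "snd \<in> borel_of (prod_topology S T) \<rightarrow>\<^sub>M borel_of T"
    by (auto intro!: continuous_map_borel_of_measurable continuous_map_fst continuous_map_snd)
  then have "(\<lambda>p. (fst p, snd p)) \<in> borel_of (prod_topology S T) \<rightarrow>\<^sub>M borel_of S \<Otimes>\<^sub>M borel_of T"
    by (rule measurable_Pair)
  from measurable_sets[OF this]
  have "A \<inter> space (borel_of (prod_topology S T)) \<in> sets (borel_of (prod_topology S T))"
    if "A \<in> sets (borel_of S \<Otimes>\<^sub>M borel_of T)" for A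
    using that by simp
  moreover have "A \<inter> space (borel_of (prod_topology S T)) = A" if "A \<in> sets (borel_of S \<Otimes>\<^sub>M borel_of T)" for A
    using sets.sets_into_space[OF that] by (auto simp: space_pair_measure)
  ultimately show "sets (borel_of S \<Otimes>\<^sub>M borel_of T) \<subseteq> sets (borel_of (prod_topology S T))"
    by auto
  from assms(1) obtain B where B: "countable B" "\<forall>V\<in>B. openin S V"
    "\<forall>U x. openin S U \<and> x \<in> U \<longrightarrow> (\<exists>V\<in>B. x \<in> V \<and> V \<subseteq> U)"
    unfolding second_countable_def by blast
  from assms(2) obtain C where C: "countable C" "\<forall>V\<in>C. openin T V"
    "\<forall>U x. openin T U \<and> x \<in> U \<longrightarrow> (\<exists>V\<in>C. x \<in> V \<and> V \<subseteq> U)"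
    unfolding second_countable_def by blast
  have "W \<in> sets (borel_of S \<Otimes>\<^sub>M borel_of T)" if W: "openin (prod_topology S T) W" for W
  proof -
    let ?I = "{(U, V). U \<in> B \<and> V \<in> C \<and> U \<times> V \<subseteq> W}"
    have "W = (\<Union>(U, V)\<in>?I. U \<times> V)"
    proof
      show "W \<subseteq> (\<Union>(U, V)\<in>?I. U \<times> V)"
      proof
        fix p assume p: "p \<in> W"
        then have "(fst p, snd p) \<in> W" by simp
        from W[unfolded openin_prod_topology_alt, rule_format, OF this]
        obtain U V where UV: "openin S U" "openin T V" "fst p \<in> U" "snd p \<in> V" "U \<times> V \<subseteq> W"
          by blast
        obtain U' where U': "U' \<in> B" "fst p \<in> U'" "U' \<subseteq> U" using B(3) UV by blast
        obtain V' where V': "V' \<in> C" "snd p \<in> V'" "V' \<subseteq> V" using C(3) UV by blast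
        have "(U', V') \<in> ?I" "p \<in> U' \<times> V'" using U' V' UV by (auto simp: mem_Times_iff)
        then show "p \<in> (\<Union>(U, V)\<in>?I. U \<times> V)" by blast
      qed
    qed auto
    moreover have "(\<Union>p\<in>?I. (case p of (U, V) \<Rightarrow> U \<times> V)) \<in> sets (borel_of S \<Otimes>\<^sub>M borel_of T)"
    proof (rule sets.countable_UN'')
      show "countable ?I" by (rule countable_subset[of _ "B \<times> C"]) (use B(1) C(1) in auto)
      show "(case p of (U, V) \<Rightarrow> U \<times> V) \<in> sets (borel_of S \<Otimes>\<^sub>M borel_of T)" if "p \<in> ?I" for p
        using that B(2) C(2) by (auto intro!: pair_measureI openin_sets_borel_of)
    qed
    ultimately show ?thesis by (rule ssubst)
  qed
  then have "sigma_sets (space (borel_of S \<Otimes>\<^sub>M borel_of T)) {W. openin (prod_topology S T) W}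
      \<subseteq> sets (borel_of S \<Otimes>\<^sub>M borel_of T)"
    by (intro sets.sigma_sets_subset) auto
  moreover have "sets (borel_of (prod_topology S T)) =
      sigma_sets (space (borel_of S \<Otimes>\<^sub>M borel_of T)) {W. openin (prod_topology S T) W}"
    unfolding borel_of_def[of "prod_topology S T"]
    using openin_subset[of "prod_topology S T"]
    by (subst sets_measure_of) (auto simp: space_pair_measure)
  ultimately show "sets (borel_of (prod_topology S T)) \<subseteq> sets (borel_of S \<Otimes>\<^sub>M borel_of T)" by simp
qed

definition seq_lsc :: "'a topology \<Rightarrow> ('a \<Rightarrow> ennreal) \<Rightarrow> bool" where
  "seq_lsc S f \<longleftrightarrow> (\<forall>\<sigma> s. range \<sigma> \<subseteq> topspace S \<longrightarrow> limitin S \<sigma> s sequentially \<longrightarrow>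
     f s \<le> liminf (\<lambda>n. f (\<sigma> n)))"

lemma seq_lscD:
  "seq_lsc S f \<Longrightarrow> range \<sigma> \<subseteq> topspace S \<Longrightarrow> limitin S \<sigma> s sequentially \<Longrightarrow> f s \<le> liminf (\<lambda>n. f (\<sigma> n))"
  by (auto simp: seq_lsc_def)

lemma seq_lsc_openin:
  assumes "metrizable_space S" "seq_lsc S f"
  shows "openin S {s \<in> topspace S. l < f s}"
proof -
  have "closedin S {s \<in> topspace S. f s \<le> l}"
    unfolding metrizable_closedin_sequentially[OF assms(1)]
  proof (intro conjI allI impI CollectI; (elim conjE)?)
    fix \<sigma> s assume \<sigma>: "range \<sigma> \<subseteq> {s \<in> topspace S. f s \<le> l}" "limitin S \<sigma> s sequentially"
    then show "s \<in> topspace S" by (simp add: limitin_topspace)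
    have "f s \<le> liminf (\<lambda>n. f (\<sigma> n))" using \<sigma> by (intro seq_lscD[OF assms(2)]) auto
    also have "\<dots> \<le> l" using \<sigma>(1) by (intro Liminf_le) (auto simp: image_subset_iff)
    finally show "f s \<le> l" .
  qed auto
  then have "openin S (topspace S - {s \<in> topspace S. f s \<le> l})" by (auto simp: closedin_def)
  also have "topspace S - {s \<in> topspace S. f s \<le> l} = {s \<in> topspace S. l < f s}" by auto
  finally show ?thesis .
qed

lemma seq_lsc_measurable:
  assumes "metrizable_space S" "seq_lsc S f"
  shows "f \<in> borel_measurable (borel_of S)"
  by (rule borel_measurableI_greater) (use seq_lsc_openin[OF assms, THEN openin_sets_borel_of] in simp)

lemma seq_lsc_indicator_openin:
  assumes "openin S U"
  shows "seq_lsc S (indicator U)"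
  unfolding seq_lsc_def
proof (intro allI impI)
  fix \<sigma> s assume \<sigma>: "limitin S \<sigma> s sequentially"
  show "indicator U s \<le> liminf (\<lambda>n. indicator U (\<sigma> n) :: ennreal)"
  proof (cases "s \<in> U")
    case True
    then have "\<forall>\<^sub>F n in sequentially. \<sigma> n \<in> U" using \<sigma> assms by (auto simp: limitin_def)
    then have "\<forall>\<^sub>F n in sequentially. 1 \<le> (indicator U (\<sigma> n) :: ennreal)"
      by eventually_elim simp
    then show ?thesis using True by (simp add: Liminf_bounded)
  qed simp
qed

lemma fatou_weak_convergence:
  assumes S: "metrizable_space S" and conv: "converges_weakly S \<mu>s \<mu>"
    and \<mu>s: "\<And>n. \<mu>s n \<in> prob_measures S" and \<mu>: "\<mu> \<in> prob_measures S"
    and F: "\<And>\<sigma> x. range \<sigma> \<subseteq> topspace S \<Longrightarrow> limitin S \<sigma> x sequentially \<Longrightarrow>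
              F x \<le> liminf (\<lambda>n. f n (\<sigma> n))"
  shows "(\<integral>\<^sup>+x. F x \<partial>\<mu>) \<le> liminf (\<lambda>n. \<integral>\<^sup>+x. f n x \<partial>\<mu>s n)"
proof -
  from S obtain M d where "Metric_space M d" and S': "S = Metric_space.mtopology M d"
    by (auto simp: metrizable_space_def)
  then interpret Metric_space M d by simp
  show ?thesis
    using assms(2-) nn_integral_fatou_weak[of \<mu>s \<mu> F f] unfolding S' by simp
qed

lemma Int_stable_openin: "Int_stable {U. openin S U}"
  by (auto simp: Int_stable_def)

lemma sets_borel_of: "sets (borel_of S) = sigma_sets (topspace S) {U. openin S U}"
  unfolding borel_of_def by (subst sets_measure_of) (auto dest: openin_subset)

text \<open>
  A constant sequence \<open>\<nu>\<close> converges weakly to \<open>\<mu>\<close> under the hypothesis, so Fatou's lemma for the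
  indicator of an open set \<open>U\<close> yields \<open>\<mu> U \<le> \<nu> U\<close>, and symmetrically the reverse inequality.
\<close>
lemma prob_measure_eqI_weak:
  assumes S: "metrizable_space S" and \<mu>: "\<mu> \<in> prob_measures S" and \<nu>: "\<nu> \<in> prob_measures S"
    and eq: "\<And>f. bounded_continuous S f \<Longrightarrow> (\<integral>x. f x \<partial>\<mu>) = (\<integral>x. f x \<partial>\<nu>)"
  shows "\<mu> = \<nu>"
proof -
  have le: "emeasure \<mu> U \<le> emeasure \<nu> U" if U: "openin S U" and \<mu>: "\<mu> \<in> prob_measures S"
    and \<nu>: "\<nu> \<in> prob_measures S"
    and eq: "\<And>f. bounded_continuous S f \<Longrightarrow> (\<integral>x. f x \<partial>\<mu>) = (\<integral>x. f x \<partial>\<nu>)" for U \<mu> \<nu>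
  proof -
    have "(\<integral>\<^sup>+x. indicator U x \<partial>\<mu>) \<le> liminf (\<lambda>n::nat. \<integral>\<^sup>+x. indicator U x \<partial>\<nu>)"
      by (rule fatou_weak_convergence[OF S _ \<nu> \<mu>])
         (use eq seq_lscD[OF seq_lsc_indicator_openin[OF U]] in \<open>auto simp: converges_weakly_def\<close>)
    then show ?thesis
      using openin_sets_borel_of[OF U] prob_measuresD(1)[OF \<mu>] prob_measuresD(1)[OF \<nu>]
      by (simp add: Liminf_const)
  qed
  have fin: "emeasure \<mu> (topspace S) \<noteq> \<infinity>"
    using prob_measuresD[OF \<mu>] prob_space.emeasure_space_1[of \<mu>] by auto
  show ?thesis
  proof (rule measure_eqI_generator_eq[OF Int_stable_openin, where A="\<lambda>_. topspace S"])
    show "{U. openin S U} \<subseteq> Pow (topspace S)" by (auto dest: openin_subset)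
    show "emeasure \<mu> X = emeasure \<nu> X" if "X \<in> {U. openin S U}" for X
      using that le[of X \<mu> \<nu>] le[of X \<nu> \<mu>] \<mu> \<nu> eq by (auto intro!: antisym)
    show "sets \<mu> = sigma_sets (topspace S) {U. openin S U}" "sets \<nu> = sigma_sets (topspace S) {U. openin S U}"
      using prob_measuresD[OF \<mu>] prob_measuresD[OF \<nu>] by (auto simp: sets_borel_of)
    show "range (\<lambda>_::nat. topspace S) \<subseteq> {U. openin S U}" by auto
    show "(\<Union>i::nat. topspace S) = topspace S" by auto
  qed (use fin in auto)
qed

text \<open>
  Weak continuity alone makes a family of probability measures a stochastic kernel: the measure of
  an open set is lower semicontinuous, hence Borel, in the parameter, and the open sets generate
  the Borel sets.
\<close>
lemma weakly_continuous_kernelI: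
  assumes S1: "metrizable_space S1" and S2: "metrizable_space S2"
    and T: "\<And>s. s \<in> topspace S2 \<Longrightarrow> T s \<in> prob_measures S1"
    and conv: "\<And>\<sigma> s. range \<sigma> \<subseteq> topspace S2 \<Longrightarrow> limitin S2 \<sigma> s sequentially \<Longrightarrow>
        converges_weakly S1 (\<lambda>n. T (\<sigma> n)) (T s)"
  shows "weakly_continuous_kernel S1 S2 T"
proof -
  have open': "(\<lambda>s. emeasure (T s) U) \<in> borel_measurable (borel_of S2)" if U: "openin S1 U" for U
  proof (rule seq_lsc_measurable[OF S2])
    show "seq_lsc S2 (\<lambda>s. emeasure (T s) U)"
      unfolding seq_lsc_def
    proof (intro allI impI)
      fix \<sigma> s assume \<sigma>: "range \<sigma> \<subseteq> topspace S2" "limitin S2 \<sigma> s sequentially"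
      have s: "s \<in> topspace S2" using \<sigma>(2) by (rule limitin_topspace)
      have \<sigma>': "\<sigma> n \<in> topspace S2" for n using \<sigma>(1) by auto
      have "(\<integral>\<^sup>+x. indicator U x \<partial>T s) \<le> liminf (\<lambda>n. \<integral>\<^sup>+x. indicator U x \<partial>T (\<sigma> n))"
        by (rule fatou_weak_convergence[OF S1 conv[OF \<sigma>] T[OF \<sigma>'] T[OF s]])
           (rule seq_lscD[OF seq_lsc_indicator_openin[OF U]])
      then show "emeasure (T s) U \<le> liminf (\<lambda>n. emeasure (T (\<sigma> n)) U)"
        using openin_sets_borel_of[OF U] prob_measuresD(1)[OF T[OF s]] prob_measuresD(1)[OF T[OF \<sigma>']]
        by simp
    qed
  qed
  have "T \<in> borel_of S2 \<rightarrow>\<^sub>M subprob_algebra (borel_of S1)"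
    by (rule measurable_subprob_algebra_generated[OF sets_borel_of Int_stable_openin])
       (use T open' openin_subset[of S1] prob_measuresD[of "T _" S1] in
         \<open>auto intro!: prob_space_imp_subprob_space\<close>)
  then have "T \<in> borel_of S2 \<rightarrow>\<^sub>M prob_algebra (borel_of S1)"
    by (intro measurable_prob_algebraI) (use T prob_measuresD(3) in auto)
  then show ?thesis
    using conv by (auto simp: weakly_continuous_kernel_def stochastic_kernel_iff)
qed

section \<open>The weak topology is separable and metrizable\<close>

context Metric_space
begin

definition tent :: "'a \<Rightarrow> nat \<Rightarrow> rat \<Rightarrow> 'a \<Rightarrow> real" where
  "tent c n q x = real_of_rat q * max 0 (1 - real n * d c x)"

text \<open>
  With \<open>c\<close> in a countable dense set these are countably many functions. The default \<open>0\<close> covers the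
  empty set \<open>K\<close>.
\<close>
definition tent_max :: "('a \<times> nat \<times> rat) set \<Rightarrow> 'a \<Rightarrow> real" where
  "tent_max K x = Max (insert 0 ((\<lambda>(c, n, q). tent c n q x) ` K))"

lemma continuous_map_tent:
  assumes "c \<in> M"
  shows "continuous_map mtopology euclideanreal (tent c n q)"
proof -
  have "\<bar>d c x - d c y\<bar> \<le> 1 * d x y" if "x \<in> M" "y \<in> M" for x y
    using triangle[of c x y] triangle[of c y x] that assms by (simp add: commute)
  from Lipschitz_real_continuous_map[OF this]
  have "continuous_map mtopology euclideanreal (d c)" by simp
  then show ?thesis unfolding tent_def by (intro continuous_intros)
qed

lemma tent_bound: "0 \<le> q \<Longrightarrow> 0 \<le> tent c n q x \<and> tent c n q x \<le> real_of_rat q"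
  by (auto simp: tent_def max_def mult_left_le)

lemma bounded_continuous_tent_max:
  assumes "finite K" "K \<subseteq> M \<times> UNIV \<times> {q. 0 \<le> q}"
  shows "bounded_continuous mtopology (tent_max K)"
  using assms
proof (induction K)
  case empty
  then show ?case
    by (auto simp: bounded_continuous_def tent_max_def intro: finite_imp_bounded finite_subset[of _ "{0}"])
next
  case (insert p K)
  obtain c n q where p: "p = (c, n, q)" by (cases p) auto
  have ins: "tent_max (insert p K) x = max (tent c n q x) (tent_max K x)" for x
    unfolding tent_max_def using insert(1) p
    by (simp add: insert_commute[of 0])
  have "bounded_continuous mtopology (tent_max K)" using insert by auto
  then have K: "continuous_map mtopology euclideanreal (tent_max K)" and bd: "bounded (tent_max K ` M)"
    by (auto simp: bounded_continuous_def)
  have "c \<in> M" and q: "0 \<le> q" using insert(4) p by auto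
  have "continuous_map mtopology euclideanreal (tent_max (insert p K))"
    unfolding ins using K continuous_map_tent[OF \<open>c \<in> M\<close>, of n q] by (intro continuous_intros)
  moreover from bd obtain B where B: "\<And>x. x \<in> M \<Longrightarrow> \<bar>tent_max K x\<bar> \<le> B"
    by (auto simp: bounded_iff)
  have "bounded (tent_max (insert p K) ` M)"
    unfolding bounded_iff
  proof (intro exI[of _ "max (real_of_rat q) B"] ballI; elim imageE)
    fix y x assume "y = tent_max (insert p K) x" "x \<in> M"
    then show "norm y \<le> max (real_of_rat q) B"
      using B[of x] tent_bound[OF q, of c n x] by (auto simp: ins max_def)
  qed
  ultimately show ?case by (simp add: bounded_continuous_def)
qed

text \<open>
  Near \<open>x\<close> the function \<open>f\<close> exceeds a rational \<open>q\<close> with \<open>t < q\<close>. A tent of height \<open>q\<close> that is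
  centred at a point of \<open>C\<close> close to \<open>x\<close> and is steep enough to vanish outside that neighbourhood
  stays below \<open>f\<close>.
\<close>
lemma tent_approximation:
  assumes C: "C \<subseteq> M" "mtopology closure_of C = M"
    and f: "continuous_map mtopology euclideanreal f"
    and x: "x \<in> M" and t: "0 \<le> t" "t < f x" and nonneg: "\<And>y. y \<in> M \<Longrightarrow> 0 \<le> f y"
  shows "\<exists>c\<in>C. \<exists>n. \<exists>q\<ge>0. t < tent c n q x \<and> (\<forall>y\<in>M. tent c n q y \<le> f y)"
proof -
  obtain q where q: "t < real_of_rat q" "real_of_rat q < f x" using of_rat_dense t(2) by blast
  then have q0: "0 < real_of_rat q" using t by linarith
  have "openin mtopology {y \<in> M. f y \<in> {real_of_rat q<..}}"
    using f by (auto simp: continuous_map_def simp del: greaterThan_iff)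
  then obtain e where e: "e > 0" "mball x e \<subseteq> {y \<in> M. f y \<in> {real_of_rat q<..}}"
    unfolding openin_mtopology using x q(2) by blast
  \<comment> \<open>slope \<open>n\<close> confines the tent to the ball of radius \<open>1 / n < e / 2\<close> around its centre\<close>
  obtain n :: nat where n: "2 / e < real n" using reals_Archimedean2 by blast
  then have n0: "real n > 0" "2 < real n * e"
    using e(1) divide_pos_pos[of 2 e] by (linarith, simp add: field_simps)
  \<comment> \<open>the first bound keeps the support inside the \<open>e\<close>-ball around \<open>x\<close>,
    the second keeps the value at \<open>x\<close> above \<open>t\<close>\<close>
  define r where "r = min (e / 2) ((1 - t / real_of_rat q) / real n)"
  have "r > 0" using e(1) q(1) q0 n0 by (auto simp: r_def)
  then obtain c where c: "c \<in> C" "d x c < r"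
    using C(2) x by (force simp: metric_closure_of)
  have cM: "c \<in> M" using c C by auto
  show ?thesis
  proof (intro bexI[OF _ c(1)] exI[of _ n] exI[of _ q] conjI ballI)
    show "0 \<le> q" using q0 by simp
    have "real n * d c x < 1 - t / real_of_rat q"
      using c(2) n0 by (auto simp: r_def commute field_simps)
    then have "t / real_of_rat q < 1 - real n * d c x" by simp
    then have "t < real_of_rat q * (1 - real n * d c x)" using q0 by (simp add: field_simps)
    also have "\<dots> \<le> tent c n q x" unfolding tent_def using q0 by (intro mult_left_mono) auto
    finally show "t < tent c n q x" .
    fix y assume y: "y \<in> M"
    show "tent c n q y \<le> f y"
    proof (cases "real n * d c y < 1")
      case True
      have "d c y < e / 2"
      proof (rule ccontr)
        assume "\<not> d c y < e / 2"
        then have "real n * (e / 2) \<le> real n * d c y" using n0 by (intro mult_left_mono) auto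
        then show False using True n0(2) by simp
      qed
      then have "d x y < e" using triangle[OF x cM y] c(2) by (auto simp: r_def)
      then have "real_of_rat q < f y" using e(2) x y by auto
      then show ?thesis using tent_bound[of q c n y] q0 by simp
    next
      case False
      then show ?thesis using nonneg[OF y] by (simp add: tent_def)
    qed
  qed
qed

text \<open>
  A nonnegative continuous function is the supremum of the countably many tents below it, hence an
  increasing limit of finite maxima of them; monotone convergence transfers this to the integrals.
\<close>
lemma integral_tent_max_approximation:
  assumes C: "countable C" "C \<subseteq> M" "mtopology closure_of C = M"
    and f: "bounded_continuous mtopology f" and nonneg: "\<And>y. y \<in> M \<Longrightarrow> 0 \<le> f y"
    and \<mu>: "\<mu> \<in> prob_measures mtopology" and t: "t < (\<integral>x. f x \<partial>\<mu>)"
  shows "\<exists>K. finite K \<and> K \<subseteq> C \<times> UNIV \<times> {q. 0 \<le> q} \<and> (\<forall>y\<in>M. tent_max K y \<le> f y) \<and>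
           t < (\<integral>x. tent_max K x \<partial>\<mu>)"
proof -
  define I where "I = {p \<in> C \<times> UNIV \<times> {q. 0 \<le> q}. \<forall>y\<in>M. (case p of (c, n, q) \<Rightarrow> tent c n q y) \<le> f y}"
  have cI: "countable I"
    by (rule countable_subset[of _ "C \<times> UNIV"]) (use C(1) in \<open>auto simp: I_def\<close>)
  define K where "K m = {p \<in> I. to_nat_on I p \<le> m}" for m
  have finK: "finite (K m)" for m
  proof (rule finite_imageD[of "to_nat_on I"])
    show "finite (to_nat_on I ` K m)" by (rule finite_subset[of _ "{..m}"]) (auto simp: K_def)
    show "inj_on (to_nat_on I) (K m)"
      using inj_on_to_nat_on[OF cI] by (rule inj_on_subset) (auto simp: K_def)
  qed
  have KI: "K m \<subseteq> C \<times> UNIV \<times> {q. 0 \<le> q}" "K m \<subseteq> M \<times> UNIV \<times> {q. 0 \<le> q}" for m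
    using C(2) by (auto simp: K_def I_def)
  have le_f: "tent_max (K m) y \<le> f y" if "y \<in> M" for m y
    unfolding tent_max_def using that finK[of m] nonneg by (auto simp: K_def I_def)
  have nn: "0 \<le> tent_max (K m) y" for m y
    unfolding tent_max_def using finK[of m] by simp
  have mono: "tent_max (K m) y \<le> tent_max (K m') y" if "m \<le> m'" for m m' y
    unfolding tent_max_def
  proof (rule Max_mono)
    have "K m \<subseteq> K m'" using that by (auto simp: K_def)
    then have "(\<lambda>(c, n, q). tent c n q y) ` K m \<subseteq> (\<lambda>(c, n, q). tent c n q y) ` K m'" by (rule image_mono)
    then show "insert 0 ((\<lambda>(c, n, q). tent c n q y) ` K m) \<subseteq> insert 0 ((\<lambda>(c, n, q). tent c n q y) ` K m')"
      by blast
  qed (use finK in auto)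
  have sp: "space \<mu> = M" using prob_measuresD[OF \<mu>] by simp
  have bc: "bounded_continuous mtopology (tent_max (K m))" for m
    by (rule bounded_continuous_tent_max[OF finK KI(2)])
  have sup: "ennreal (f x) \<le> (SUP m. ennreal (tent_max (K m) x))" if x: "x \<in> M" for x
  proof (rule ccontr)
    assume neg: "\<not> ?thesis"
    define s where "s = (SUP m. ennreal (tent_max (K m) x))"
    have "s < ennreal (f x)" using neg by (simp add: s_def not_le)
    then obtain t' where t': "s = ennreal t'" "0 \<le> t'" "t' < f x"
      by (cases s) (auto simp: ennreal_less_iff)
    from f have "continuous_map mtopology euclideanreal f" by (simp add: bounded_continuous_def)
    from tent_approximation[OF C(2,3) this x t'(2,3) nonneg]
    obtain c n q where cnq: "c \<in> C" "0 \<le> q" "t' < tent c n q x" "\<forall>y\<in>M. tent c n q y \<le> f y" by auto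
    then have "(c, n, q) \<in> I" by (auto simp: I_def)
    then have "(c, n, q) \<in> K (to_nat_on I (c, n, q))" by (auto simp: K_def)
    then have "tent c n q x \<in> (\<lambda>(c, n, q). tent c n q x) ` K (to_nat_on I (c, n, q))"
      by (rule image_eqI[rotated]) simp
    then have "tent c n q x \<le> tent_max (K (to_nat_on I (c, n, q))) x"
      unfolding tent_max_def using finK by (intro Max_ge) simp_all
    then have "ennreal t' < ennreal (tent_max (K (to_nat_on I (c, n, q))) x)"
      using cnq(3) t'(2) by (intro ennreal_lessI) auto
    also have "\<dots> \<le> s" unfolding s_def by (rule SUP_upper) simp
    finally show False using t'(1) by simp
  qed
  have f_int: "ennreal (\<integral>x. f x \<partial>\<mu>) = (\<integral>\<^sup>+x. ennreal (f x) \<partial>\<mu>)"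
    using nn_integral_bounded_continuous[OF f _ \<mu>] nonneg by simp
  also have "\<dots> \<le> (\<integral>\<^sup>+x. (SUP m. ennreal (tent_max (K m) x)) \<partial>\<mu>)"
    by (intro nn_integral_mono sup) (simp add: sp)
  also have "\<dots> = (SUP m. \<integral>\<^sup>+x. ennreal (tent_max (K m) x) \<partial>\<mu>)"
  proof (rule nn_integral_monotone_convergence_SUP)
    show "incseq (\<lambda>m x. ennreal (tent_max (K m) x))"
      using mono by (auto simp: incseq_def le_fun_def intro!: ennreal_leI)
    have "tent_max (K m) \<in> borel_measurable \<mu>" for m
      using bc[of m] continuous_map_real_borel_of[of mtopology "tent_max (K m)"] prob_measuresD(1)[OF \<mu>]
      by (auto simp: bounded_continuous_def cong: measurable_cong_sets)
    then show "(\<lambda>x. ennreal (tent_max (K m) x)) \<in> borel_measurable \<mu>" for m by simp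
  qed
  also have "\<dots> = (SUP m. ennreal (\<integral>x. tent_max (K m) x \<partial>\<mu>))"
    using nn_integral_bounded_continuous[OF bc _ \<mu>] nn by simp
  finally have le: "ennreal (\<integral>x. f x \<partial>\<mu>) \<le> (SUP m. ennreal (\<integral>x. tent_max (K m) x \<partial>\<mu>))" .
  have int_nn: "0 \<le> (\<integral>x. tent_max (K m) x \<partial>\<mu>)" for m using nn by simp
  show ?thesis
  proof (cases "t < 0")
    case True
    then show ?thesis using finK KI le_f int_nn by (intro exI[of _ "K 0"]) (auto intro: less_le_trans)
  next
    case False
    then have "ennreal t < ennreal (\<integral>x. f x \<partial>\<mu>)" using t by (intro ennreal_lessI) auto
    also note le
    finally obtain m where "ennreal t < ennreal (\<integral>x. tent_max (K m) x \<partial>\<mu>)" by (auto simp: less_SUP_iff)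
    then have "t < (\<integral>x. tent_max (K m) x \<partial>\<mu>)" using False by (simp add: ennreal_less_iff)
    then show ?thesis using finK KI le_f by (intro exI[of _ "K m"]) auto
  qed
qed

end

text \<open>
  Finite maxima of tents form a countable family \<open>G\<close>. Every set \<open>{\<mu>. t < \<integral>f d\<mu>}\<close> is the union of
  the sets \<open>{\<mu>. t + B < \<integral>G k d\<mu>}\<close> over those \<open>k\<close> with \<open>G k \<le> f + B\<close>, where \<open>B\<close> bounds \<open>\<bar>f\<bar>\<close>. The
  integrals of the family thus generate the weak topology, and the space of measures inherits its
  topology from \<open>\<real>\<^sup>\<nat>\<close>.
\<close>
lemma weak_topology_eq_pullback:
  assumes S: "metrizable_space S" "second_countable S"
  obtains G :: "nat \<Rightarrow> 'a \<Rightarrow> real" where "\<And>k. bounded_continuous S (G k)"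
    "weak_topology S = pullback_topology (prob_measures S) (\<lambda>\<mu> k. \<integral>x. G k x \<partial>\<mu>) euclidean"
proof -
  from S(1) obtain M d where "Metric_space M d" and S': "S = Metric_space.mtopology M d"
    by (auto simp: metrizable_space_def)
  then interpret Metric_space M d by simp
  from second_countable_imp_separable_space[OF S(2)]
  obtain C where C: "countable C" "C \<subseteq> M" "mtopology closure_of C = M"
    by (auto simp: separable_space_def S')
  define Ks where "Ks = {K. finite K \<and> K \<subseteq> C \<times> (UNIV :: nat set) \<times> {q::rat. 0 \<le> q}}"
  have Ks: "countable Ks" "Ks \<noteq> {}"
    unfolding Ks_def
    by (rule countable_Collect_finite_subset) (use C(1) in \<open>auto intro: countable_subset[of _ "UNIV"]\<close>)
  define G where "G k = tent_max (from_nat_into Ks k)" for k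
  have in_Ks: "from_nat_into Ks k \<in> Ks" for k using Ks(2) by (rule from_nat_into)
  have bc: "bounded_continuous S (G k)" for k
    unfolding G_def S' by (rule bounded_continuous_tent_max) (use in_Ks[of k] C(2) in \<open>auto simp: Ks_def\<close>)
  let ?P = "prob_measures S"
  let ?\<Phi> = "\<lambda>\<mu> k. \<integral>x. G k x \<partial>\<mu>"
  let ?T = "pullback_topology ?P ?\<Phi> (euclidean :: (nat \<Rightarrow> real) topology)"
  have topT: "topspace ?T = ?P" by (simp add: topspace_pullback_topology)
  have G_cont: "continuous_map ?T euclideanreal (\<lambda>\<mu>. \<integral>x. G k x \<partial>\<mu>)" for k
  proof -
    have "continuous_map euclidean euclideanreal (\<lambda>v::nat \<Rightarrow> real. v k)" 
      by (simp add: continuous_on_product_coordinates)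
    from continuous_map_pullback[OF this, of ?P ?\<Phi>] show ?thesis by (simp add: comp_def)
  qed
  have lower: "openin ?T {\<mu> \<in> ?P. t < (\<integral>x. f x \<partial>\<mu>)}"
    if f: "bounded_continuous S f" for f t
  proof -
    from f obtain B where B: "\<And>x. x \<in> M \<Longrightarrow> \<bar>f x\<bar> \<le> B" by (auto simp: bounded_continuous_def bounded_iff S')
    let ?f = "\<lambda>x. f x + B"
    note f' = bounded_continuous_shift[OF f, of B]
    note f'_int = integral_shift[OF f, where c=B]
    have "\<exists>U. openin ?T U \<and> \<mu> \<in> U \<and> U \<subseteq> {\<mu> \<in> ?P. t < (\<integral>x. f x \<partial>\<mu>)}"
      if \<mu>: "\<mu> \<in> ?P" "t < (\<integral>x. f x \<partial>\<mu>)" for \<mu>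
    proof -
      have "t + B < (\<integral>x. ?f x \<partial>\<mu>)" using f'_int[OF \<mu>(1)] \<mu>(2) by simp
      from integral_tent_max_approximation[OF C f'[unfolded S'] _ \<mu>(1)[unfolded S'] this]
      obtain K where K: "K \<in> Ks" "\<forall>y\<in>M. tent_max K y \<le> f y + B" "t + B < (\<integral>x. tent_max K x \<partial>\<mu>)"
        using B by (force simp: Ks_def abs_le_iff)
      obtain k where k: "from_nat_into Ks k = K" using from_nat_into_surj[OF Ks(1) K(1)] by blast
      let ?U = "{\<nu> \<in> ?P. (\<integral>x. G k x \<partial>\<nu>) \<in> {t + B<..}}"
      have "openin ?T {\<nu> \<in> topspace ?T. (\<integral>x. G k x \<partial>\<nu>) \<in> {t + B<..}}"
        using G_cont[of k] by (auto simp: continuous_map_def simp del: greaterThan_iff)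
      then have "openin ?T ?U" by (simp only: topT)
      moreover have "\<mu> \<in> ?U" using K(3) k \<mu>(1) by (simp add: G_def)
      moreover have "?U \<subseteq> {\<mu> \<in> ?P. t < (\<integral>x. f x \<partial>\<mu>)}"
      proof
        fix \<nu> assume \<nu>: "\<nu> \<in> ?U"
        then have \<nu>P: "\<nu> \<in> ?P" by simp
        have "(\<integral>x. G k x \<partial>\<nu>) \<le> (\<integral>x. ?f x \<partial>\<nu>)"
          using K(2) k prob_measuresD(2)[OF \<nu>P] 
          by (intro integral_mono bounded_continuous_integrable[OF _ \<nu>P] bc f') (auto simp: G_def S')
        then show "\<nu> \<in> {\<mu> \<in> ?P. t < (\<integral>x. f x \<partial>\<mu>)}" using \<nu> f'_int[OF \<nu>P] by auto
      qed
      ultimately show ?thesis by blast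
    qed
    then show ?thesis by (subst openin_subopen) auto
  qed
  have cont: "continuous_map ?T euclideanreal (\<lambda>\<mu>. \<integral>x. f x \<partial>\<mu>)" if f: "bounded_continuous S f" for f
    unfolding continuous_map_upper_lower_semicontinuous_lt topT
  proof (intro conjI allI)
    fix t
    show "openin ?T {\<mu> \<in> ?P. t < (\<integral>x. f x \<partial>\<mu>)}" by (rule lower[OF f])
    from lower[OF bounded_continuous_uminus[OF f], of "- t"] show "openin ?T {\<mu> \<in> ?P. (\<integral>x. f x \<partial>\<mu>) < t}" by simp
  qed
  have "openin (weak_topology S) W \<longleftrightarrow> openin ?T W" for W
  proof
    let ?B = "{{\<mu> \<in> ?P. (\<integral>s. f s \<partial>\<mu>) \<in> U} | f U. bounded_continuous S f \<and> open U}"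
    assume "openin (weak_topology S) W"
    then have "generate_topology_on ?B W" by (simp add: weak_topology_def openin_topology_generated_by_iff)
    then show "openin ?T W"
    proof induction
      case (Basis W)
      then obtain f U where W: "W = {\<mu> \<in> ?P. (\<integral>s. f s \<partial>\<mu>) \<in> U}" and f: "bounded_continuous S f" and U: "open U"
        by blast
      from cont[OF f] U have "openin ?T {\<mu> \<in> topspace ?T. (\<integral>s. f s \<partial>\<mu>) \<in> U}"
        by (simp add: continuous_map_def)
      then show ?case by (simp only: W topT)
    qed auto
  next
    assume "openin ?T W"
    then obtain V where V: "open V" "W = ?\<Phi> -` V \<inter> ?P" by (auto simp: openin_pullback_topology)
    have "continuous_map (weak_topology S) euclideanreal (\<lambda>\<mu>. \<integral>x. G k x \<partial>\<mu>)" for k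
      unfolding continuous_map_def topspace_weak_topology
    proof (intro conjI allI impI)
      fix U :: "real set" assume "openin euclidean U"
      then show "openin (weak_topology S) {\<mu> \<in> ?P. (\<integral>x. G k x \<partial>\<mu>) \<in> U}"
        unfolding weak_topology_def using bc[of k] by (intro topology_generated_by_Basis) auto
    qed auto
    then have "continuous_map (weak_topology S) (product_topology (\<lambda>k. euclideanreal) UNIV) ?\<Phi>"
      by (simp add: continuous_map_componentwise_UNIV)
    then have "continuous_map (weak_topology S) euclidean ?\<Phi>" by (simp only: euclidean_product_topology)
    then have "openin (weak_topology S) {\<mu> \<in> topspace (weak_topology S). ?\<Phi> \<mu> \<in> V}"
      using V(1) by (simp add: continuous_map_def)
    moreover have "{\<mu> \<in> topspace (weak_topology S). ?\<Phi> \<mu> \<in> V} = W" using V(2) by auto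
    ultimately show "openin (weak_topology S) W" by simp
  qed
  then have "weak_topology S = ?T" by (simp add: topology_eq)
  with bc that show thesis by blast
qed

text \<open>
  The map into \<open>\<real>\<^sup>\<nat>\<close> from which the topology is pulled back is injective, because measures that it
  identifies lie in the same weakly open sets. It is therefore a homeomorphism onto its image.
\<close>
lemma metrizable_second_countable_weak_topology:
  assumes S: "metrizable_space S" "second_countable S"
  shows "metrizable_space (weak_topology S)" "second_countable (weak_topology S)"
proof -
  obtain G :: "nat \<Rightarrow> 'a \<Rightarrow> real" where G: "\<And>k. bounded_continuous S (G k)" and
    eq: "weak_topology S = pullback_topology (prob_measures S) (\<lambda>\<mu> k. \<integral>x. G k x \<partial>\<mu>) euclidean"
    using weak_topology_eq_pullback[OF S] by blast
  let ?\<Phi> = "\<lambda>\<mu> k. \<integral>x. G k x \<partial>\<mu>" and ?P = "prob_measures S"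
  have inj: "inj_on ?\<Phi> ?P"
  proof (rule inj_onI)
    fix \<mu> \<nu> assume \<mu>: "\<mu> \<in> ?P" and \<nu>: "\<nu> \<in> ?P" and same: "?\<Phi> \<mu> = ?\<Phi> \<nu>"
    show "\<mu> = \<nu>"
    proof (rule prob_measure_eqI_weak[OF S(1) \<mu> \<nu>])
      fix f assume f: "bounded_continuous S f"
      have "openin (weak_topology S) {\<rho> \<in> ?P. (\<integral>x. f x \<partial>\<rho>) \<in> - {\<integral>x. f x \<partial>\<mu>}}"
        unfolding weak_topology_def
      proof (rule topology_generated_by_Basis)
        have "open (- {\<integral>x. f x \<partial>\<mu>})" by (rule open_Compl) simp
        then show "{\<rho> \<in> ?P. (\<integral>x. f x \<partial>\<rho>) \<in> - {\<integral>x. f x \<partial>\<mu>}} \<in>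
            {{\<mu> \<in> ?P. (\<integral>s. f s \<partial>\<mu>) \<in> U} | f U. bounded_continuous S f \<and> open U}"
          using f by blast
      qed
      then obtain V where "{\<rho> \<in> ?P. (\<integral>x. f x \<partial>\<rho>) \<in> - {\<integral>x. f x \<partial>\<mu>}} = ?\<Phi> -` V \<inter> ?P"
        unfolding eq openin_pullback_topology by blast
      then have "\<rho> \<in> ?P \<Longrightarrow> (\<integral>x. f x \<partial>\<rho>) \<noteq> (\<integral>x. f x \<partial>\<mu>) \<longleftrightarrow> ?\<Phi> \<rho> \<in> V" for \<rho> by auto
      from this[OF \<mu>] this[OF \<nu>] same show "(\<integral>x. f x \<partial>\<mu>) = (\<integral>x. f x \<partial>\<nu>)" by auto
    qed
  qed
  have "homeomorphic_map (weak_topology S) (top_of_set (?\<Phi> ` ?P)) ?\<Phi>"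
  proof (rule bijective_open_imp_homeomorphic_map)
    show "continuous_map (weak_topology S) (top_of_set (?\<Phi> ` ?P)) ?\<Phi>"
      unfolding continuous_map_in_subtopology
    proof
      have "continuous_map (pullback_topology ?P ?\<Phi> euclidean) euclidean (id \<circ> ?\<Phi>)"
        by (rule continuous_map_pullback) simp
      then show "continuous_map (weak_topology S) euclidean ?\<Phi>" by (simp add: eq)
    qed auto
    show "open_map (weak_topology S) (top_of_set (?\<Phi> ` ?P)) ?\<Phi>"
      unfolding open_map_def
    proof (intro allI impI)
      fix W assume "openin (weak_topology S) W"
      then obtain V where "open V" "W = ?\<Phi> -` V \<inter> ?P" by (auto simp: eq openin_pullback_topology)
      moreover from this have "?\<Phi> ` W = ?\<Phi> ` ?P \<inter> V" by auto
      ultimately show "openin (top_of_set (?\<Phi> ` ?P)) (?\<Phi> ` W)" by (auto simp: openin_open)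
    qed
  qed (use inj in auto)
  then have hom: "weak_topology S homeomorphic_space top_of_set (?\<Phi> ` ?P)"
    by (rule homeomorphic_map_imp_homeomorphic_space)
  show "metrizable_space (weak_topology S)"
    using homeomorphic_metrizable_space[OF hom] metrizable_space_subtopology[OF metrizable_space_euclidean] by blast
  show "second_countable (weak_topology S)"
    using homeomorphic_space_second_countability[OF hom] second_countable_subtopology[OF second_countable_euclidean] by blast
qed

lemma weakly_continuous_kernel_id:
  assumes S: "metrizable_space S" "second_countable S"
  shows "weakly_continuous_kernel S (weak_topology S) (\<lambda>\<mu>. \<mu>)"
proof (rule weakly_continuous_kernelI[OF S(1) metrizable_second_countable_weak_topology(1)[OF S]])
  fix \<sigma> \<mu> assume "range \<sigma> \<subseteq> topspace (weak_topology S)" "limitin (weak_topology S) \<sigma> \<mu> sequentially"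
  then show "converges_weakly S \<sigma> \<mu>"
    using limitin_weak_topology[of \<sigma> S \<mu>] limitin_topspace[of "weak_topology S" \<sigma> \<mu>] by simp
qed simp

text \<open>
  The Borel sets of the weak topology are generated by the evaluations \<open>\<mu> \<mapsto> \<mu> B\<close>. Hence a filter
  kernel is the same as a Borel map into the space of beliefs.
\<close>
lemma measurable_weak_topology_iff:
  assumes S: "metrizable_space S" "second_countable S"
  shows "g \<in> N \<rightarrow>\<^sub>M borel_of (weak_topology S) \<longleftrightarrow> g \<in> N \<rightarrow>\<^sub>M prob_algebra (borel_of S)"
proof
  from weakly_continuous_kernel_id[OF S] have id: "(\<lambda>\<mu>. \<mu>) \<in> borel_of (weak_topology S) \<rightarrow>\<^sub>M prob_algebra (borel_of S)"
    by (simp add: weakly_continuous_kernel_def stochastic_kernel_iff)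
  show "g \<in> N \<rightarrow>\<^sub>M prob_algebra (borel_of S)" if "g \<in> N \<rightarrow>\<^sub>M borel_of (weak_topology S)"
    using measurable_compose[OF that id] by simp
next
  assume g: "g \<in> N \<rightarrow>\<^sub>M prob_algebra (borel_of S)"
  obtain G :: "nat \<Rightarrow> 'a \<Rightarrow> real" where G: "\<And>k. bounded_continuous S (G k)" and
    eq: "weak_topology S = pullback_topology (prob_measures S) (\<lambda>\<mu> k. \<integral>x. G k x \<partial>\<mu>) euclidean"
    using weak_topology_eq_pullback[OF S] by blast
  let ?\<Phi> = "\<lambda>\<mu> k. \<integral>x. G k x \<partial>\<mu>" and ?P = "prob_measures S"
  have "G k \<in> borel_measurable (borel_of S)" for k
    using G[of k] by (auto simp: bounded_continuous_def intro: continuous_map_real_borel_of)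
  then have "(\<lambda>x. \<integral>y. G k y \<partial>g x) \<in> borel_measurable N" for k
    using measurable_prob_algebraD[OF g]
    by (rule measurable_compose[OF _ integral_measurable_subprob_algebra, rotated])
  then have \<Phi>: "(\<lambda>x. ?\<Phi> (g x)) \<in> borel_measurable N"
    by (rule measurable_coordinatewise_then_product)
  show "g \<in> N \<rightarrow>\<^sub>M borel_of (weak_topology S)"
    unfolding borel_of_def[of "weak_topology S"]
  proof (rule measurable_measure_of)
    show "{U. openin (weak_topology S) U} \<subseteq> Pow (topspace (weak_topology S))"
      using openin_subset[of "weak_topology S"] by auto
    show "g \<in> space N \<rightarrow> topspace (weak_topology S)" using measurable_space[OF g] by auto
    fix W assume "W \<in> {U. openin (weak_topology S) U}"
    then obtain V where V: "open V" "W = ?\<Phi> -` V \<inter> ?P" by (auto simp: eq openin_pullback_topology)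
    have "g -` W \<inter> space N = (\<lambda>x. ?\<Phi> (g x)) -` V \<inter> space N"
      using measurable_space[OF g] V(2) by auto
    then show "g -` W \<inter> space N \<in> sets N" using measurable_sets[OF \<Phi>, of V] V(1) by simp
  qed
qed

section \<open>Measurable selection of minimizers\<close>

lemma compactin_metrizable_imp_closedin:
  "metrizable_space X \<Longrightarrow> compactin X S \<Longrightarrow> closedin X S"
  by (intro compactin_imp_closedin metrizable_imp_Hausdorff_space)

lemma limitin_metrizable_unique:
  "metrizable_space X \<Longrightarrow> limitin X f a sequentially \<Longrightarrow> limitin X f b sequentially \<Longrightarrow> a = b"
  by (rule limitin_Hausdorff_unique[OF _ _ _ metrizable_imp_Hausdorff_space]) auto

lemma compactin_attains_min:
  fixes e :: "'a \<Rightarrow> real"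
  assumes "compactin X K" "K \<noteq> {}" "continuous_map X euclideanreal e"
  shows "\<exists>a\<in>K. \<forall>b\<in>K. e a \<le> e b"
  using compact_attains_inf[of "e ` K"] image_compactin[OF assms(1,3)] assms(2) by auto

lemma liminf_less_imp_subseq:
  fixes f :: "nat \<Rightarrow> 'a::complete_linorder"
  assumes "liminf f < l"
  obtains r :: "nat \<Rightarrow> nat" where "strict_mono r" "\<And>n. f (r n) \<le> l"
proof -
  have "\<not> (\<forall>\<^sub>F n in sequentially. l \<le> f n)"
    using assms Liminf_bounded[of l f sequentially] by auto
  then have "\<exists>\<^sub>F n in sequentially. f n \<le> l"
    unfolding frequently_def
  proof (rule contrapos_nn)
    assume "\<forall>\<^sub>F n in sequentially. \<not> f n \<le> l"
    then show "\<forall>\<^sub>F n in sequentially. l \<le> f n" by (rule eventually_mono) simp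
  qed
  then have "infinite {n. f n \<le> l}" by (simp add: frequently_sequentially infinite_nat_iff_unbounded_le)
  then obtain r :: "nat \<Rightarrow> nat" where "strict_mono r" "\<And>n. r n \<in> {n. f n \<le> l}"
    using infinite_enumerate by blast
  with that show thesis by auto
qed

text \<open>
  Measurability of a multifunction with nonempty compact values, tested on closed sets. This form
  is stable under passing to minimizers.
\<close>
definition hits_measurably :: "'s measure \<Rightarrow> 'a topology \<Rightarrow> ('s \<Rightarrow> 'a set) \<Rightarrow> bool" where
  "hits_measurably N A K \<longleftrightarrow>
     (\<forall>s\<in>space N. compactin A (K s) \<and> K s \<noteq> {}) \<and>
     (\<forall>F. closedin A F \<longrightarrow> {s \<in> space N. K s \<inter> F \<noteq> {}} \<in> sets N)"

text \<open>
  By compactness the minimum of \<open>e\<close> over \<open>K s\<close> is attained in \<open>F\<close> iff for every rational \<open>r\<close> the set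
  \<open>K s \<inter> F\<close> meets \<open>{e \<le> r}\<close> as soon as \<open>K s\<close> does, which is a countable condition on \<open>s\<close>.
\<close>
lemma hits_measurably_argmin:
  assumes A: "metrizable_space A" and K: "hits_measurably N A K"
    and e: "continuous_map A euclideanreal e"
  shows "hits_measurably N A (\<lambda>s. {a \<in> K s. \<forall>b\<in>K s. e a \<le> e b})"
  unfolding hits_measurably_def
proof (intro conjI ballI allI impI)
  fix s assume s: "s \<in> space N"
  then have c: "compactin A (K s)" "K s \<noteq> {}" using K by (auto simp: hits_measurably_def)
  from compactin_attains_min[OF this e] obtain m where m: "m \<in> K s" "\<forall>b\<in>K s. e m \<le> e b" by blast
  then show "{a \<in> K s. \<forall>b\<in>K s. e a \<le> e b} \<noteq> {}" by auto
  have "{a \<in> K s. \<forall>b\<in>K s. e a \<le> e b} = K s \<inter> {a \<in> topspace A. e a \<in> {..e m}}"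
    using m compactin_subset_topspace[OF c(1)] by force
  moreover have "closedin A {a \<in> topspace A. e a \<in> {..e m}}"
    by (rule closedin_continuous_map_preimage[OF e]) simp
  ultimately show "compactin A {a \<in> K s. \<forall>b\<in>K s. e a \<le> e b}"
    using c(1) by (simp add: compact_Int_closedin)
next
  fix F assume F: "closedin A F"
  let ?E = "\<lambda>r. {a \<in> topspace A. e a \<in> {..real_of_rat r}}"
  have E: "closedin A (?E r)" for r
    by (rule closedin_continuous_map_preimage[OF e]) simp
  have hit: "{s \<in> space N. K s \<inter> C \<noteq> {}} \<in> sets N" if "closedin A C" for C
    using K that by (auto simp: hits_measurably_def)
  have "{a \<in> K s. \<forall>b\<in>K s. e a \<le> e b} \<inter> F \<noteq> {} \<longleftrightarrow>
      (\<forall>r. K s \<inter> ?E r \<noteq> {} \<longrightarrow> K s \<inter> (F \<inter> ?E r) \<noteq> {})" if s: "s \<in> space N" for s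
  proof
    assume "{a \<in> K s. \<forall>b\<in>K s. e a \<le> e b} \<inter> F \<noteq> {}"
    then show "\<forall>r. K s \<inter> ?E r \<noteq> {} \<longrightarrow> K s \<inter> (F \<inter> ?E r) \<noteq> {}"
      using closedin_subset[OF F] by fastforce
  next
    assume R: "\<forall>r. K s \<inter> ?E r \<noteq> {} \<longrightarrow> K s \<inter> (F \<inter> ?E r) \<noteq> {}"
    have c: "compactin A (K s)" "K s \<noteq> {}" using K s by (auto simp: hits_measurably_def)
    from compactin_attains_min[OF this e] obtain m where m: "m \<in> K s" "\<forall>b\<in>K s. e m \<le> e b" by blast
    have mA: "m \<in> topspace A" using m(1) compactin_subset_topspace[OF c(1)] by auto
    have R': "K s \<inter> (F \<inter> ?E r) \<noteq> {}" if "e m < real_of_rat r" for r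
    proof (rule R[rule_format])
      show "K s \<inter> ?E r \<noteq> {}" using m(1) mA that by fastforce
    qed
    obtain r where r: "e m < real_of_rat r" using of_rat_dense[of "e m" "e m + 1"] by auto
    then have "K s \<inter> F \<noteq> {}" using R'[OF r] by auto
    from compactin_attains_min[OF compact_Int_closedin[OF c(1) F] this e]
    obtain a where a: "a \<in> K s \<inter> F" "\<forall>b\<in>K s \<inter> F. e a \<le> e b" by blast
    have "e a \<le> e m"
    proof (rule ccontr)
      assume "\<not> e a \<le> e m"
      then obtain r where r: "e m < real_of_rat r" "real_of_rat r < e a"
        using of_rat_dense[of "e m" "e a"] by auto
      from R'[OF r(1)] obtain b where "b \<in> K s \<inter> F" "e b \<le> real_of_rat r" by auto
      then have "e a \<le> e b" using a(2) by blast
      then show False using \<open>e b \<le> real_of_rat r\<close> r(2) by linarith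
    qed
    then show "{a \<in> K s. \<forall>b\<in>K s. e a \<le> e b} \<inter> F \<noteq> {}" using a(1) m(2) by (auto intro: order_trans)
  qed
  then have "{s \<in> space N. {a \<in> K s. \<forall>b\<in>K s. e a \<le> e b} \<inter> F \<noteq> {}} =
     {s \<in> space N. \<forall>r. s \<in> {s \<in> space N. K s \<inter> ?E r \<noteq> {}} \<longrightarrow> s \<in> {s \<in> space N. K s \<inter> (F \<inter> ?E r) \<noteq> {}}}"
    by (intro Collect_cong conj_cong refl) simp
  also have "\<dots> \<in> sets N"
  proof (intro sets.sets_Collect_countable_All sets.sets_Collect_imp)
    fix r
    have 1: "{s \<in> space N. K s \<inter> ?E r \<noteq> {}} \<in> sets N" by (rule hit[OF E])
    have 2: "{s \<in> space N. K s \<inter> (F \<inter> ?E r) \<noteq> {}} \<in> sets N" by (rule hit[OF closedin_Int[OF F E]])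
    show "{x \<in> space N. x \<in> {s \<in> space N. K s \<inter> ?E r \<noteq> {}}} \<in> sets N" using 1 by simp
    show "{x \<in> space N. x \<in> {s \<in> space N. K s \<inter> (F \<inter> ?E r) \<noteq> {}}} \<in> sets N" using 2 by simp
  qed
  finally show "{s \<in> space N. {a \<in> K s. \<forall>b\<in>K s. e a \<le> e b} \<inter> F \<noteq> {}} \<in> sets N" .
qed

lemma compactin_decreasing_Inter:
  assumes A: "metrizable_space A" and K: "\<And>k::nat. compactin A (K k)" "\<And>k. K k \<noteq> {}"
    and dec: "\<And>k. K (Suc k) \<subseteq> K k"
  shows "(\<Inter>k. K k) \<noteq> {}"
proof -
  have dec': "K n \<subseteq> K k" if "k \<le> n" for k n
    using lift_Suc_antimono_le[of K, OF dec that] .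
  obtain a where a: "\<And>k. a k \<in> K k" using K(2) by (meson all_not_in_conv)
  then have "range a \<subseteq> K 0" using dec'[of 0] by blast
  then obtain l r where lr: "strict_mono (r::nat \<Rightarrow> nat)" "limitin A (a \<circ> r) l sequentially"
    using K(1)[of 0] unfolding metrizable_compactin_sequentially[OF A] by blast
  have "l \<in> K k" for k
  proof (rule limitin_closedin[OF lr(2) compactin_metrizable_imp_closedin[OF A K(1)[of k]]])
    show "\<forall>\<^sub>F n in sequentially. (a \<circ> r) n \<in> K k"
      using eventually_ge_at_top[of k]
    proof eventually_elim
      case (elim n)
      then have "k \<le> r n" using seq_suble[OF lr(1), of n] by linarith
      then show ?case using a[of "r n"] dec' by auto
    qed
  qed simp
  then show ?thesis by blast
qed

text \<open>
  Minimize the distances to the points of a countable dense set over \<open>K s\<close> lexicographically. By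
  compactness the decreasing sets of minimizers have a common point, and two common points would
  have equal distances to a dense set. This point lies in a closed set \<open>F\<close> iff every stage of the
  minimization meets \<open>F\<close>, so it depends measurably on \<open>s\<close>.
\<close>
lemma exists_measurable_selection:
  assumes A: "metrizable_space A" "second_countable A" and K: "hits_measurably N A K"
  shows "\<exists>\<phi>\<in>N \<rightarrow>\<^sub>M borel_of A. \<forall>s\<in>space N. \<phi> s \<in> K s"
proof -
  from A(1) obtain M d where "Metric_space M d" and A': "A = Metric_space.mtopology M d"
    by (auto simp: metrizable_space_def)
  then interpret Metric_space M d by simp
  from second_countable_imp_separable_space[OF A(2)]
  obtain C where C: "countable C" "C \<subseteq> M" "mtopology closure_of C = M"
    by (auto simp: separable_space_def A')
  \<comment> \<open>if \<open>C\<close> is empty, so is the space, and any continuous function serves\<close>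
  define e where "e k = (if C = {} then (\<lambda>_. 0) else d (from_nat_into C k))" for k
  have e_cont: "continuous_map A euclideanreal (e k)" for k
  proof (cases "C = {}")
    case False
    then have c: "from_nat_into C k \<in> M" using C(2) from_nat_into[of C k] by auto
    have "\<bar>d (from_nat_into C k) x - d (from_nat_into C k) y\<bar> \<le> 1 * d x y" if "x \<in> M" "y \<in> M" for x y
      using triangle[OF c that] triangle[OF c that(2,1)] by (simp add: commute)
    from Lipschitz_real_continuous_map[OF this] show ?thesis using False by (simp add: e_def A')
  qed (simp add: e_def)
  define KK where "KK = rec_nat K (\<lambda>k L s. {a \<in> L s. \<forall>b\<in>L s. e k a \<le> e k b})"
  have KK_0: "KK 0 = K" and KK_Suc: "KK (Suc k) = (\<lambda>s. {a \<in> KK k s. \<forall>b\<in>KK k s. e k a \<le> e k b})" for k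
    by (simp_all add: KK_def)
  have KK: "hits_measurably N A (KK k)" for k
    by (induction k) (simp_all add: KK_0 KK_Suc K hits_measurably_argmin[OF A(1) _ e_cont])
  have KKc: "compactin A (KK k s)" "KK k s \<noteq> {}" if "s \<in> space N" for k s
    using KK[of k] that by (auto simp: hits_measurably_def)
  have dec: "KK (Suc k) s \<subseteq> KK k s" for k s by (auto simp: KK_Suc)
  have unique: "a = b" if s: "s \<in> space N" and ab: "\<And>k. a \<in> KK k s" "\<And>k. b \<in> KK k s" for s a b
  proof (rule ccontr)
    have aM: "a \<in> M" and bM: "b \<in> M"
      using ab[of 0] compactin_subset_topspace[OF KKc(1)[OF s, of 0]] by (auto simp: A')
    assume "a \<noteq> b"
    then have "d a b > 0" using aM bM by simp
    then obtain c where c: "c \<in> C" "d a c < d a b / 2" 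
      using C(3) aM by (force simp: metric_closure_of dest: spec[of _ "d a b / 2"])
    then obtain k where "from_nat_into C k = c" using from_nat_into_surj[OF C(1)] by blast
    then have "e k = d c" using c(1) by (auto simp: e_def)
    moreover have "e k a = e k b"
      using ab[of "Suc k"] by (auto simp: KK_Suc intro!: antisym)
    ultimately have "d a b < d a b"
      using triangle[of a c b] aM bM c C(2) by (auto simp: commute)
    then show False by simp
  qed
  define \<phi> where "\<phi> s = (SOME a. \<forall>k. a \<in> KK k s)" for s
  have \<phi>: "\<phi> s \<in> KK k s" if "s \<in> space N" for s k
  proof -
    have "\<exists>a. \<forall>k. a \<in> KK k s"
      using compactin_decreasing_Inter[of A "\<lambda>k. KK k s", OF A(1) KKc[OF that] dec] by auto
    then show ?thesis unfolding \<phi>_def by (rule someI2_ex) auto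
  qed
  have closed_iff: "\<phi> s \<in> F \<longleftrightarrow> (\<forall>k. KK k s \<inter> F \<noteq> {})" if s: "s \<in> space N" and F: "closedin A F" for s F
  proof
    assume "\<forall>k. KK k s \<inter> F \<noteq> {}"
    then have "(\<Inter>k. KK k s \<inter> F) \<noteq> {}"
      using dec by (intro compactin_decreasing_Inter[OF A(1)] compact_Int_closedin KKc(1)[OF s] F) auto
    then obtain b where b: "\<And>k. b \<in> KK k s" "b \<in> F" by auto
    with unique[OF s \<phi>[OF s] b(1)] show "\<phi> s \<in> F" by simp
  qed (use \<phi>[OF s] in auto)
  have "\<phi> \<in> N \<rightarrow>\<^sub>M borel_of A"
    unfolding borel_of_def[of A]
  proof (rule measurable_measure_of)
    show "{U. openin A U} \<subseteq> Pow (topspace A)" using openin_subset[of A] by auto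
    have \<phi>A: "\<phi> s \<in> topspace A" if "s \<in> space N" for s
      using \<phi>[OF that, of 0] compactin_subset_topspace[OF KKc(1)[OF that, of 0]] by auto
    then show "\<phi> \<in> space N \<rightarrow> topspace A" by auto
    fix U assume "U \<in> {U. openin A U}"
    then have F: "closedin A (topspace A - U)" by auto
    have "\<phi> -` U \<inter> space N = space N - {s \<in> space N. \<forall>k. KK k s \<inter> (topspace A - U) \<noteq> {}}"
      using closed_iff[OF _ F] \<phi>A by auto
    also have "\<dots> \<in> sets N"
      using KK F by (intro sets.Diff sets.sets_Collect_countable_All) (auto simp: hits_measurably_def)
    finally show "\<phi> -` U \<inter> space N \<in> sets N" .
  qed
  moreover have "\<forall>s\<in>space N. \<phi> s \<in> K s" using \<phi>[of _ 0] by (simp add: KK_0)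
  ultimately show ?thesis by blast
qed

text \<open>
  \<open>\<K>\<close>-inf-compactness of a function with values in \<open>[0, \<infinity>]\<close>, in the form in which it is applied:
  actions with bounded cost along a convergent sequence of states accumulate, and the bound
  passes to the limit. The connection with the definition by compact sublevel sets is made by
  \<open>K_inf_compact_iff_level\<close>.
\<close>
definition seq_K_inf_compact :: "'s topology \<Rightarrow> 'a topology \<Rightarrow> ('s \<times> 'a \<Rightarrow> ennreal) \<Rightarrow> bool" where
  "seq_K_inf_compact S A f \<longleftrightarrow>
     (\<forall>\<sigma> s as l. range \<sigma> \<subseteq> topspace S \<longrightarrow> limitin S \<sigma> s sequentially \<longrightarrow> range as \<subseteq> topspace A \<longrightarrow>
        l < top \<longrightarrow> (\<forall>n. f (\<sigma> n, as n) \<le> l) \<longrightarrow>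
        (\<exists>r a. strict_mono (r::nat \<Rightarrow> nat) \<and> limitin A (as \<circ> r) a sequentially \<and> f (s, a) \<le> l))"

lemma seq_K_inf_compactD:
  assumes "seq_K_inf_compact S A f" "range \<sigma> \<subseteq> topspace S" "limitin S \<sigma> s sequentially"
    "range as \<subseteq> topspace A" "l < top" "\<And>n. f (\<sigma> n, as n) \<le> l"
  obtains r a where "strict_mono (r::nat \<Rightarrow> nat)" "limitin A (as \<circ> r) a sequentially" "f (s, a) \<le> l"
  using assms unfolding seq_K_inf_compact_def by blast

context
  fixes S :: "'s topology" and A :: "'a topology" and f :: "'s \<times> 'a \<Rightarrow> ennreal"
  assumes A: "metrizable_space A" and f: "seq_K_inf_compact S A f"
begin

lemma seq_K_inf_compact_imp_lsc: "seq_lsc (prod_topology S A) f"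
  unfolding seq_lsc_def
proof (intro allI impI, rule ccontr)
  fix \<sigma> p assume \<sigma>: "range \<sigma> \<subseteq> topspace (prod_topology S A)" "limitin (prod_topology S A) \<sigma> p sequentially"
    and "\<not> f p \<le> liminf (\<lambda>n. f (\<sigma> n))"
  then have "liminf (\<lambda>n. f (\<sigma> n)) < f p" by (simp add: not_le)
  then obtain l where l: "liminf (\<lambda>n. f (\<sigma> n)) < l" "l < f p" using dense by blast
  from liminf_less_imp_subseq[OF l(1)] obtain r :: "nat \<Rightarrow> nat" where r: "strict_mono r" "\<And>n. f (\<sigma> (r n)) \<le> l" by blast
  have lim: "limitin S (fst \<circ> \<sigma>) (fst p) sequentially" "limitin A (snd \<circ> \<sigma>) (snd p) sequentially"
    using \<sigma>(2) by (auto simp: limitin_pairwise)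
  have "l < top" using l(2) by (rule less_le_trans) simp
  moreover have "range (fst \<circ> \<sigma> \<circ> r) \<subseteq> topspace S" "range (snd \<circ> \<sigma> \<circ> r) \<subseteq> topspace A"
    using \<sigma>(1) by (auto simp: image_subset_iff mem_Times_iff)
  moreover have "f ((fst \<circ> \<sigma> \<circ> r) n, (snd \<circ> \<sigma> \<circ> r) n) \<le> l" for n using r(2) by simp
  ultimately obtain r' a where r': "strict_mono (r'::nat \<Rightarrow> nat)" "limitin A (snd \<circ> \<sigma> \<circ> r \<circ> r') a sequentially" "f (fst p, a) \<le> l"
    using seq_K_inf_compactD[OF f _ limitin_subsequence[OF r(1) lim(1)], of "snd \<circ> \<sigma> \<circ> r" l] by blast
  have "limitin A (snd \<circ> \<sigma> \<circ> r \<circ> r') (snd p) sequentially"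
    by (intro limitin_subsequence r r' lim)
  then have "a = snd p" by (rule limitin_metrizable_unique[OF A r'(2)])
  then show False using r'(3) l(2) by simp
qed

lemma seq_K_inf_compact_attained:
  assumes s: "s \<in> topspace S" and ne: "topspace A \<noteq> {}"
  shows "\<exists>a\<in>topspace A. f (s, a) = (INF a\<in>topspace A. f (s, a))"
proof (cases "(INF a\<in>topspace A. f (s, a)) = top")
  case True
  obtain a where a: "a \<in> topspace A" using ne by blast
  have "(INF a\<in>topspace A. f (s, a)) \<le> f (s, a)" using a by (rule INF_lower)
  then show ?thesis using True a top.extremum_unique by metis
next
  case False
  define m where "m = (INF a\<in>topspace A. f (s, a))"
  have m: "m < top" using False unfolding m_def by (simp only: less_top)
  obtain u :: "nat \<Rightarrow> ennreal" where u: "decseq u" "range u \<subseteq> (\<lambda>a. f (s, a)) ` topspace A" "m = (INF i. u i)"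
    using ennreal_Inf_countable_INF[of "(\<lambda>a. f (s, a)) ` topspace A"] ne unfolding m_def by blast
  have "\<forall>n. \<exists>a. a \<in> topspace A \<and> f (s, a) = u n"
  proof
    fix n
    have "u n \<in> (\<lambda>a. f (s, a)) ` topspace A" using u(2) by blast
    then show "\<exists>a. a \<in> topspace A \<and> f (s, a) = u n" by (metis imageE)
  qed
  then obtain as where as: "\<And>n. as n \<in> topspace A" "\<And>n. f (s, as n) = u n" by metis
  have "\<exists>k. u k < top" using m u(3) by (auto simp: INF_less_iff)
  then obtain k where k: "u k < top" by blast
  have le: "f (s, as (n + k)) \<le> u k" for n
    using u(1) by (auto simp: as decseq_def)
  have const: "range (\<lambda>_::nat. s) \<subseteq> topspace S" "limitin S (\<lambda>_. s) s sequentially"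
    using s by (auto simp: limitin_const)
  obtain r a where r: "strict_mono (r::nat \<Rightarrow> nat)" "limitin A ((\<lambda>n. as (n + k)) \<circ> r) a sequentially"
  proof (rule seq_K_inf_compactD[OF f const _ k])
    show "range (\<lambda>n. as (n + k)) \<subseteq> topspace A" using as(1) by auto
  qed (rule le)
  have aA: "a \<in> topspace A" using r(2) by (rule limitin_topspace)
  have "f (s, a) \<le> liminf (\<lambda>n. f (s, as (r n + k)))"
    using seq_lscD[OF seq_K_inf_compact_imp_lsc, of "\<lambda>n. (s, as (r n + k))" "(s, a)"] s as(1) r(2) const(2)
    by (auto simp: limitin_pairwise comp_def)
  also have "\<dots> = liminf (u \<circ> (\<lambda>n. r n + k))" by (simp add: as comp_def)
  also have "\<dots> = m"
  proof (rule lim_imp_Liminf)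
    have "strict_mono (\<lambda>n. r n + k)" using r(1) by (auto simp: strict_mono_def)
    then show "(u \<circ> (\<lambda>n. r n + k)) \<longlonglongrightarrow> m"
      using LIMSEQ_INF[OF u(1)] u(3) by (auto intro: LIMSEQ_subseq_LIMSEQ)
  qed simp
  finally have "f (s, a) \<le> m" .
  moreover have "m \<le> f (s, a)" unfolding m_def using aA by (rule INF_lower)
  ultimately show ?thesis using aA unfolding m_def by (auto intro: antisym)
qed

lemma seq_K_inf_compact_INF_lsc: "seq_lsc S (\<lambda>s. INF a\<in>topspace A. f (s, a))"
  unfolding seq_lsc_def
proof (intro allI impI, rule ccontr)
  let ?m = "\<lambda>s. INF a\<in>topspace A. f (s, a)"
  fix \<sigma> s assume \<sigma>: "range \<sigma> \<subseteq> topspace S" "limitin S \<sigma> s sequentially"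
    and "\<not> ?m s \<le> liminf (\<lambda>n. ?m (\<sigma> n))"
  then have "liminf (\<lambda>n. ?m (\<sigma> n)) < ?m s" by (simp only: not_le)
  then obtain l where l: "liminf (\<lambda>n. ?m (\<sigma> n)) < l" "l < ?m s" using dense by blast
  have lt: "l < top" using l(2) by (rule less_le_trans) simp
  from liminf_less_imp_subseq[OF l(1)] obtain r :: "nat \<Rightarrow> nat" where r: "strict_mono r" "\<And>n. ?m (\<sigma> (r n)) \<le> l" by blast
  have ne: "topspace A \<noteq> {}"
  proof
    assume "topspace A = {}"
    then show False using r(2)[of 0] lt by simp
  qed
  have "\<exists>a\<in>topspace A. f (\<sigma> (r n), a) \<le> l" for n
    using seq_K_inf_compact_attained[OF _ ne, of "\<sigma> (r n)"] \<sigma>(1) r(2)[of n] by (metis range_subsetD)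
  then obtain as where as: "\<And>n. as n \<in> topspace A" "\<And>n. f (\<sigma> (r n), as n) \<le> l" by metis
  obtain r' a where r': "strict_mono (r'::nat \<Rightarrow> nat)" "limitin A (as \<circ> r') a sequentially" "f (s, a) \<le> l"
    using seq_K_inf_compactD[OF f _ limitin_subsequence[OF r(1) \<sigma>(2)] _ lt, of as] as \<sigma>(1) by force
  have "?m s \<le> f (s, a)" using limitin_topspace[OF r'(2)] by (rule INF_lower)
  then show False using r'(3) l(2) by simp
qed

text \<open>
  Restricting the actions to a closed set \<open>F\<close> makes \<open>INF a\<in>F. f (s, a)\<close> lower semicontinuous, hence
  Borel in \<open>s\<close>; the measurable selection of minimizers uses this for all closed \<open>F\<close>.
\<close>
lemma seq_K_inf_compact_closed_actions:
  assumes "closedin A F"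
  shows "seq_K_inf_compact S (subtopology A F) f"
  unfolding seq_K_inf_compact_def
proof (intro allI impI)
  fix \<sigma> s as l
  assume *: "range \<sigma> \<subseteq> topspace S" "limitin S \<sigma> s sequentially" "range as \<subseteq> topspace (subtopology A F)"
    "l < top" "\<forall>n. f (\<sigma> n, as n) \<le> l"
  obtain r a where r: "strict_mono (r::nat \<Rightarrow> nat)" "limitin A (as \<circ> r) a sequentially" "f (s, a) \<le> l"
    using seq_K_inf_compactD[OF f *(1,2) _ *(4), of as] * by auto
  have asF: "as n \<in> F" for n using *(3) by auto
  have "a \<in> F" by (rule limitin_closedin[OF r(2) assms]) (simp_all add: asF)
  then have "limitin (subtopology A F) (as \<circ> r) a sequentially"
    using r(2) by (simp add: limitin_subtopology asF)
  then show "\<exists>r a. strict_mono (r::nat \<Rightarrow> nat) \<and> limitin (subtopology A F) (as \<circ> r) a sequentially \<and> f (s, a) \<le> l"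
    using r by blast
qed

lemma compactin_sublevel_section:
  assumes s: "s \<in> topspace S" and l: "l < top"
  shows "compactin A {a \<in> topspace A. f (s, a) \<le> l}"
  unfolding metrizable_compactin_sequentially[OF A]
proof (intro conjI allI impI)
  fix as :: "nat \<Rightarrow> 'a" assume as: "range as \<subseteq> {a \<in> topspace A. f (s, a) \<le> l}"
  have const: "range (\<lambda>_::nat. s) \<subseteq> topspace S" "limitin S (\<lambda>_. s) s sequentially"
    using s by (auto simp: limitin_const)
  obtain r a where "strict_mono (r::nat \<Rightarrow> nat)" "limitin A (as \<circ> r) a sequentially" "f (s, a) \<le> l"
    using seq_K_inf_compactD[OF f const _ l, of as] as by blast
  then show "\<exists>a r. a \<in> {a \<in> topspace A. f (s, a) \<le> l} \<and> strict_mono r \<and> limitin A (as \<circ> r) a sequentially"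
    by (auto dest: limitin_topspace)
qed auto

end

text \<open>
  Where the minimum \<open>v s\<close> is finite, the minimizers form a nonempty compact set, which meets a closed
  set \<open>F\<close> iff the minimum over \<open>F\<close> is at most \<open>v s\<close>; both minima are Borel in \<open>s\<close>.
\<close>
lemma exists_measurable_minimizer:
  assumes S: "metrizable_space S" and A: "metrizable_space A" "second_countable A" "topspace A \<noteq> {}"
    and f: "seq_K_inf_compact S A f"
  shows "\<exists>\<phi>\<in>borel_of S \<rightarrow>\<^sub>M borel_of A. \<forall>s\<in>topspace S. f (s, \<phi> s) = (INF a\<in>topspace A. f (s, a))"
proof -
  define m where "m F s = (INF a\<in>topspace (subtopology A F). f (s, a))" for F s
  define v where "v s = (INF a\<in>topspace A. f (s, a))" for s
  obtain a0 where a0: "a0 \<in> topspace A" using A(3) by blast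
  have m[measurable]: "m F \<in> borel_measurable (borel_of S)" if "closedin A F" for F
    unfolding m_def
    by (intro seq_lsc_measurable[OF S] seq_K_inf_compact_INF_lsc metrizable_space_subtopology
          seq_K_inf_compact_closed_actions A f that)
  have v[measurable]: "v \<in> borel_measurable (borel_of S)"
    unfolding v_def by (intro seq_lsc_measurable[OF S] seq_K_inf_compact_INF_lsc A f)
  \<comment> \<open>where the minimum is infinite every action is a minimizer, but the
    action space may fail to be compact; a fixed action is selected there\<close>
  define K where "K s = (if v s = top then {a0} else {a \<in> topspace A. f (s, a) \<le> v s})" for s
  have "hits_measurably (borel_of S) A K"
    unfolding hits_measurably_def
  proof (intro conjI ballI allI impI)
    fix s assume s: "s \<in> space (borel_of S)"
    show "compactin A (K s)"
    proof (cases "v s = top")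
      case False
      then have "K s = {a \<in> topspace A. f (s, a) \<le> v s}" by (simp add: K_def)
      moreover have "v s < top" using False by (simp add: less_top)
      ultimately show ?thesis
        using compactin_sublevel_section[OF A(1) f, of s "v s"] s by simp
    qed (use a0 in \<open>simp add: K_def\<close>)
    show "K s \<noteq> {}"
      using seq_K_inf_compact_attained[OF A(1) f _ A(3), of s] s by (auto simp: K_def v_def[symmetric])
  next
    fix F assume F: "closedin A F"
    have FA: "topspace (subtopology A F) = F" using closedin_subset[OF F] by auto
    have "K s \<inter> F \<noteq> {} \<longleftrightarrow> (if v s = top then a0 \<in> F else m F s \<le> v s)" if s: "s \<in> topspace S" for s
    proof (cases "v s = top")
      case False
      have "K s \<inter> F \<noteq> {}" if le: "m F s \<le> v s"
      proof -
        have "F \<noteq> {}"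
        proof
          assume "F = {}"
          then have "m F s = top" unfolding m_def FA by simp
          then show False using le False by (simp add: top.extremum_unique)
        qed
        with seq_K_inf_compact_attained[OF metrizable_space_subtopology[OF A(1)] seq_K_inf_compact_closed_actions[OF A(1) f F] s]
        obtain a where "a \<in> F" "f (s, a) = m F s" unfolding m_def FA by blast
        then show "K s \<inter> F \<noteq> {}" using le False closedin_subset[OF F] by (auto simp: K_def)
      qed
      moreover have "m F s \<le> v s" if "K s \<inter> F \<noteq> {}"
      proof -
        obtain a where a: "a \<in> F" "f (s, a) \<le> v s" using False \<open>K s \<inter> F \<noteq> {}\<close> by (auto simp: K_def)
        then show "m F s \<le> v s" unfolding m_def FA by (rule INF_lower2)
      qed
      ultimately show ?thesis using False by auto
    qed (simp add: K_def)
    then have "{s \<in> space (borel_of S). K s \<inter> F \<noteq> {}} =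
        {s \<in> space (borel_of S). if v s = top then a0 \<in> F else m F s \<le> v s}"
      by (intro Collect_cong conj_cong refl) simp
    also have "\<dots> \<in> sets (borel_of S)" using m[OF F] v by measurable
    finally show "{s \<in> space (borel_of S). K s \<inter> F \<noteq> {}} \<in> sets (borel_of S)" .
  qed
  from exists_measurable_selection[OF A(1,2) this]
  obtain \<phi> where \<phi>: "\<phi> \<in> borel_of S \<rightarrow>\<^sub>M borel_of A" "\<And>s. s \<in> topspace S \<Longrightarrow> \<phi> s \<in> K s"
    by (metis space_borel_of)
  have "f (s, \<phi> s) = v s" if s: "s \<in> topspace S" for s
  proof -
    have \<phi>A: "\<phi> s \<in> topspace A" using measurable_space[OF \<phi>(1), of s] s by simp
    then have "v s \<le> f (s, \<phi> s)" unfolding v_def by (rule INF_lower)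
    moreover have "f (s, \<phi> s) \<le> v s"
      using \<phi>(2)[OF s] by (cases "v s = top") (auto simp: K_def)
    ultimately show ?thesis by (rule antisym[rotated])
  qed
  with \<phi>(1) show ?thesis unfolding v_def by blast
qed

text \<open>
  A single sublevel set \<open>R\<close>, detached from the type of values. This lets sublevel sets of
  extended-real and of nonnegative extended-real functions be exchanged.
\<close>
definition K_compact_level :: "'s topology \<Rightarrow> 'a topology \<Rightarrow> ('s \<times> 'a \<Rightarrow> bool) \<Rightarrow> bool" where
  "K_compact_level S A R \<longleftrightarrow>
     (\<forall>\<sigma> s as. range \<sigma> \<subseteq> topspace S \<longrightarrow> limitin S \<sigma> s sequentially \<longrightarrow> range as \<subseteq> topspace A \<longrightarrow>
        (\<forall>n. R (\<sigma> n, as n)) \<longrightarrow>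
        (\<exists>r a. strict_mono (r::nat \<Rightarrow> nat) \<and> limitin A (as \<circ> r) a sequentially \<and> R (s, a)))"

lemma K_compact_level_cong:
  assumes eq: "\<And>p. p \<in> topspace S \<times> topspace A \<Longrightarrow> R p \<longleftrightarrow> R2 p" and R: "K_compact_level S A R"
  shows "K_compact_level S A R2"
  unfolding K_compact_level_def
proof (intro allI impI)
  fix \<sigma> s as
  assume *: "range \<sigma> \<subseteq> topspace S" "limitin S \<sigma> s sequentially" "range as \<subseteq> topspace A" "\<forall>n. R2 (\<sigma> n, as n)"
  have "R (\<sigma> n, as n)" for n using * eq[of "(\<sigma> n, as n)"] by auto
  then obtain r a where r: "strict_mono (r::nat \<Rightarrow> nat)" "limitin A (as \<circ> r) a sequentially" "R (s, a)"
    using R[unfolded K_compact_level_def, rule_format, OF *(1-3)] by blast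
  have "R2 (s, a)" using r(3) eq[of "(s, a)"] limitin_topspace[OF *(2)] limitin_topspace[OF r(2)] by simp
  with r show "\<exists>r a. strict_mono (r::nat \<Rightarrow> nat) \<and> limitin A (as \<circ> r) a sequentially \<and> R2 (s, a)" by blast
qed

lemma seq_K_inf_compact_iff_level:
  "seq_K_inf_compact S A h \<longleftrightarrow> (\<forall>l<top. K_compact_level S A (\<lambda>p. h p \<le> l))"
  unfolding seq_K_inf_compact_def K_compact_level_def by blast

text \<open>
  A convergent sequence of states together with its limit is compact, and conversely the states
  of a sequence in \<open>K \<times> A\<close> have a convergent subsequence.
\<close>
lemma K_inf_compact_iff_level:
  assumes S: "metrizable_space S" and A: "metrizable_space A"
  shows "K_inf_compact S A f \<longleftrightarrow> (\<forall>l::real. K_compact_level S A (\<lambda>p. f p \<le> ereal l))"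
    (is "_ \<longleftrightarrow> ?R")
proof
  assume K: "K_inf_compact S A f"
  show ?R
    unfolding K_compact_level_def
  proof (intro allI impI)
    fix l :: real and \<sigma> s as
    assume *: "range \<sigma> \<subseteq> topspace S" "limitin S \<sigma> s sequentially" "range as \<subseteq> topspace A"
      "\<forall>n. f (\<sigma> n, as n) \<le> ereal l"
    let ?K = "insert s (range \<sigma>)"
    let ?P = "prod_topology (subtopology S ?K) A"
    have "compactin S ?K" using *(1,2) by (intro compactin_sequence_with_limit) auto
    then have c: "compactin ?P {p \<in> topspace ?P. f p \<le> ereal l}"
      using K by (auto simp: K_inf_compact_def inf_compact_def)
    have met: "metrizable_space ?P" using S A by (simp add: metrizable_space_prod_topology metrizable_space_subtopology)
    have "range (\<lambda>n. (\<sigma> n, as n)) \<subseteq> {p \<in> topspace ?P. f p \<le> ereal l}" using * by auto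
    then obtain p r where p: "p \<in> {p \<in> topspace ?P. f p \<le> ereal l}" "strict_mono (r::nat \<Rightarrow> nat)"
      "limitin ?P ((\<lambda>n. (\<sigma> n, as n)) \<circ> r) p sequentially"
      using c unfolding metrizable_compactin_sequentially[OF met] by blast
    then have lim: "limitin (subtopology S ?K) (\<sigma> \<circ> r) (fst p) sequentially" "limitin A (as \<circ> r) (snd p) sequentially"
      by (auto simp: limitin_pairwise comp_def)
    have "fst p = s"
      using lim(1) limitin_subsequence[OF p(2) *(2)] limitin_metrizable_unique[OF S]
      by (auto simp: limitin_subtopology)
    then have "f (s, snd p) \<le> ereal l" using p(1) by (metis (no_types, lifting) mem_Collect_eq prod.collapse)
    then show "\<exists>r a. strict_mono (r::nat \<Rightarrow> nat) \<and> limitin A (as \<circ> r) a sequentially \<and> f (s, a) \<le> ereal l"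
      using p(2) lim(2) by blast
  qed
next
  assume R: ?R
  show "K_inf_compact S A f"
    unfolding K_inf_compact_def inf_compact_def
  proof (intro allI impI)
    fix K and l :: real assume K: "compactin S K"
    let ?P = "prod_topology (subtopology S K) A"
    have met: "metrizable_space ?P" using S A by (simp add: metrizable_space_prod_topology metrizable_space_subtopology)
    show "compactin ?P {p \<in> topspace ?P. f p \<le> ereal l}"
      unfolding metrizable_compactin_sequentially[OF met]
    proof (intro conjI allI impI)
      fix p :: "nat \<Rightarrow> 'a \<times> 'b" assume p: "range p \<subseteq> {p \<in> topspace ?P. f p \<le> ereal l}"
      then have p': "fst (p n) \<in> topspace S" "fst (p n) \<in> K" "snd (p n) \<in> topspace A" "f (p n) \<le> ereal l" for n
        by (auto simp: image_subset_iff mem_Times_iff)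
      then have "range (fst \<circ> p) \<subseteq> K" by auto
      then obtain s r where s: "s \<in> K" "strict_mono (r::nat \<Rightarrow> nat)" "limitin S (fst \<circ> p \<circ> r) s sequentially"
        using K unfolding metrizable_compactin_sequentially[OF S] by blast
      have "range (fst \<circ> p \<circ> r) \<subseteq> topspace S" "range (snd \<circ> p \<circ> r) \<subseteq> topspace A"
        "\<forall>n. f ((fst \<circ> p \<circ> r) n, (snd \<circ> p \<circ> r) n) \<le> ereal l"
        using p' by auto
      then obtain r' a where r': "strict_mono (r'::nat \<Rightarrow> nat)" "limitin A (snd \<circ> p \<circ> r \<circ> r') a sequentially" "f (s, a) \<le> ereal l"
        using R[unfolded K_compact_level_def, rule_format, of "fst \<circ> p \<circ> r" s "snd \<circ> p \<circ> r" l] s(3) by auto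
      have "limitin (subtopology S K) (fst \<circ> p \<circ> (r \<circ> r')) s sequentially"
        using limitin_subsequence[OF r'(1) s(3)] s(1) p' by (auto simp: limitin_subtopology comp_def)
      then have "limitin ?P (p \<circ> (r \<circ> r')) (s, a) sequentially"
        using r'(2) by (auto simp: limitin_pairwise comp_def)
      moreover have "(s, a) \<in> {p \<in> topspace ?P. f p \<le> ereal l}"
        using s(1) r'(3) limitin_topspace[OF r'(2)] limitin_topspace[OF s(3)] by auto
      moreover have "strict_mono (r \<circ> r')" by (rule strict_mono_o[OF s(2) r'(1)])
      ultimately show "\<exists>q r. q \<in> {p \<in> topspace ?P. f p \<le> ereal l} \<and> strict_mono r \<and> limitin ?P (p \<circ> r) q sequentially"
        by blast
    qed auto
  qed
qed

section \<open>Markov decision processes with nonnegative costs\<close>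

lemma seq_lsc_nn_integral_kernel:
  assumes S1: "metrizable_space S1" and T: "weakly_continuous_kernel S1 S2 T"
    and f: "seq_lsc (prod_topology S2 S1) f"
  shows "seq_lsc S2 (\<lambda>s. \<integral>\<^sup>+x. f (s, x) \<partial>T s)"
  unfolding seq_lsc_def
proof (intro allI impI)
  fix \<sigma> s assume \<sigma>: "range \<sigma> \<subseteq> topspace S2" "limitin S2 \<sigma> s sequentially"
  have TP: "T s \<in> prob_measures S1" if "s \<in> topspace S2" for s
    using T that by (auto simp: weakly_continuous_kernel_def stochastic_kernel_def)
  show "(\<integral>\<^sup>+x. f (s, x) \<partial>T s) \<le> liminf (\<lambda>n. \<integral>\<^sup>+x. f (\<sigma> n, x) \<partial>T (\<sigma> n))"
  proof (rule fatou_weak_convergence[OF S1])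
    show "converges_weakly S1 (\<lambda>n. T (\<sigma> n)) (T s)"
      using T \<sigma> by (auto simp: weakly_continuous_kernel_def)
    show "T (\<sigma> n) \<in> prob_measures S1" for n using \<sigma>(1) by (intro TP) auto
    show "T s \<in> prob_measures S1" using limitin_topspace[OF \<sigma>(2)] by (rule TP)
    fix x x' assume x: "range x \<subseteq> topspace S1" "limitin S1 x x' sequentially"
    have "f (s, x') \<le> liminf (\<lambda>n. f ((\<lambda>n. (\<sigma> n, x n)) n))"
      by (rule seq_lscD[OF f]) (use \<sigma> x in \<open>auto simp: limitin_pairwise comp_def\<close>)
    then show "f (s, x') \<le> liminf (\<lambda>n. f (\<sigma> n, x n))" by simp
  qed
qed

lemma seq_lsc_add:
  assumes "seq_lsc S f" "seq_lsc S h"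
  shows "seq_lsc S (\<lambda>s. f s + h s)"
  unfolding seq_lsc_def
proof (intro allI impI)
  fix \<sigma> s assume \<sigma>: "range \<sigma> \<subseteq> topspace S" "limitin S \<sigma> s sequentially"
  let ?f = "\<lambda>n. INF m\<in>{n..}. f (\<sigma> m)" and ?h = "\<lambda>n. INF m\<in>{n..}. h (\<sigma> m)"
  have "f s + h s \<le> liminf (\<lambda>n. f (\<sigma> n)) + liminf (\<lambda>n. h (\<sigma> n))"
    using assms \<sigma> by (intro add_mono seq_lscD)
  also have "\<dots> = (SUP n. ?f n + ?h n)"
    unfolding liminf_SUP_INF
    by (rule ennreal_SUP_add[symmetric]) (auto simp: incseq_def intro!: INF_superset_mono)
  also have "\<dots> \<le> (SUP n. INF m\<in>{n..}. f (\<sigma> m) + h (\<sigma> m))"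
    by (intro SUP_mono bexI INF_greatest add_mono INF_lower) auto
  also have "\<dots> = liminf (\<lambda>n. f (\<sigma> n) + h (\<sigma> n))" by (simp add: liminf_SUP_INF)
  finally show "f s + h s \<le> liminf (\<lambda>n. f (\<sigma> n) + h (\<sigma> n))" .
qed

lemma seq_lsc_cmult:
  assumes "seq_lsc S f"
  shows "seq_lsc S (\<lambda>s. c * f s)"
  unfolding seq_lsc_def
proof (intro allI impI)
  fix \<sigma> s assume \<sigma>: "range \<sigma> \<subseteq> topspace S" "limitin S \<sigma> s sequentially"
  have "c * f s \<le> c * liminf (\<lambda>n. f (\<sigma> n))"
    using assms \<sigma> by (intro mult_left_mono seq_lscD) auto
  also have "\<dots> = (SUP n. c * (INF m\<in>{n..}. f (\<sigma> m)))"
    unfolding liminf_SUP_INF by (rule SUP_mult_left_ennreal)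
  also have "\<dots> \<le> (SUP n. INF m\<in>{n..}. c * f (\<sigma> m))"
    by (intro SUP_mono bexI INF_greatest mult_left_mono INF_lower) auto
  also have "\<dots> = liminf (\<lambda>n. c * f (\<sigma> n))" by (simp add: liminf_SUP_INF)
  finally show "c * f s \<le> liminf (\<lambda>n. c * f (\<sigma> n))" .
qed

lemma seq_lsc_SUP:
  assumes "\<And>i. seq_lsc S (f i)"
  shows "seq_lsc S (\<lambda>s. SUP i. f i s)"
  unfolding seq_lsc_def
proof (intro allI impI SUP_least)
  fix \<sigma> s i assume \<sigma>: "range \<sigma> \<subseteq> topspace S" "limitin S \<sigma> s sequentially"
  have "f i s \<le> liminf (\<lambda>n. f i (\<sigma> n))" by (rule seq_lscD[OF assms \<sigma>])
  also have "\<dots> \<le> liminf (\<lambda>n. SUP i. f i (\<sigma> n))"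
    by (intro Liminf_mono always_eventually allI SUP_upper) auto
  finally show "f i s \<le> liminf (\<lambda>n. SUP i. f i (\<sigma> n))" .
qed

lemma seq_lsc_const: "seq_lsc S (\<lambda>_. c)"
  by (simp add: seq_lsc_def Liminf_const)

text \<open>
  The cost of the process is replaced by \<open>g\<close> with values in \<open>[0, \<infinity>]\<close>, and the discount factor \<open>\<beta>\<close> is
  an arbitrary element of \<open>[0, \<infinity>]\<close>, so that all sums, integrals and limits exist.
\<close>
locale inf_compact_mdp =
  fixes D :: "('s, 'a) mdp" and g :: "'s \<times> 'a \<Rightarrow> ennreal" and \<beta> :: ennreal
  assumes S_met: "metrizable_space (state_space D)" and S_sc: "second_countable (state_space D)"
    and A_met: "metrizable_space (action_space D)" and A_sc: "second_countable (action_space D)"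
    and A_ne: "topspace (action_space D) \<noteq> {}"
    and q_cont: "weakly_continuous_kernel (state_space D) (prod_topology (state_space D) (action_space D))
                   (transition D)"
    and g_K: "seq_K_inf_compact (state_space D) (action_space D) g"
begin

abbreviation "S \<equiv> state_space D"
abbreviation "A \<equiv> action_space D"
abbreviation "q \<equiv> transition D"
abbreviation "BS \<equiv> borel_of S"
abbreviation "BA \<equiv> borel_of A"
abbreviation "H (t::nat) \<equiv> PiM {0..<t} (\<lambda>_. BS \<Otimes>\<^sub>M BA)"

lemma SA_met: "metrizable_space (prod_topology S A)"
  using S_met A_met by (simp add: metrizable_space_prod_topology)

lemma sets_SA: "sets (borel_of (prod_topology S A)) = sets (BS \<Otimes>\<^sub>M BA)"
  by (rule sets_borel_of_prod_topology[OF S_sc A_sc])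

lemma q_kernel: "stochastic_kernel BS (BS \<Otimes>\<^sub>M BA) q"
  using q_cont measurable_cong_sets[OF sets_SA refl]
  by (auto simp: weakly_continuous_kernel_def stochastic_kernel_iff)

lemma q_measurable [measurable]: "q \<in> BS \<Otimes>\<^sub>M BA \<rightarrow>\<^sub>M prob_algebra BS"
  using q_kernel by (simp add: stochastic_kernel_iff)

lemma lsc_measurable_SA: "seq_lsc (prod_topology S A) f \<Longrightarrow> f \<in> borel_measurable (BS \<Otimes>\<^sub>M BA)"
  using seq_lsc_measurable[OF SA_met, of f] measurable_cong_sets[OF sets_SA refl] by auto

lemma g_measurable [measurable]: "g \<in> borel_measurable (BS \<Otimes>\<^sub>M BA)"
  by (rule lsc_measurable_SA[OF seq_K_inf_compact_imp_lsc[OF A_met g_K]])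

text \<open>
  The Bellman operator before the minimization over the actions.
\<close>
definition L :: "('s \<Rightarrow> ennreal) \<Rightarrow> 's \<times> 'a \<Rightarrow> ennreal" where
  "L u p = g p + \<beta> * (\<integral>\<^sup>+s'. u s' \<partial>q p)"

lemma L_lsc: "seq_lsc S u \<Longrightarrow> seq_lsc (prod_topology S A) (L u)"
proof -
  assume u: "seq_lsc S u"
  have "seq_lsc (prod_topology (prod_topology S A) S) (\<lambda>p. u (snd p))"
    unfolding seq_lsc_def
  proof (intro allI impI)
    fix \<sigma> p assume "range \<sigma> \<subseteq> topspace (prod_topology (prod_topology S A) S)"
      "limitin (prod_topology (prod_topology S A) S) \<sigma> p sequentially"
    then show "u (snd p) \<le> liminf (\<lambda>n. u (snd (\<sigma> n)))"
      using seq_lscD[OF u, of "snd \<circ> \<sigma>" "snd p"] by (auto simp: limitin_pairwise image_subset_iff mem_Times_iff)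
  qed
  from seq_lsc_nn_integral_kernel[OF S_met q_cont this]
  have "seq_lsc (prod_topology S A) (\<lambda>p. \<integral>\<^sup>+s'. u s' \<partial>q p)" by simp
  then show ?thesis
    unfolding L_def
    by (intro seq_lsc_add seq_lsc_cmult seq_K_inf_compact_imp_lsc[OF A_met g_K])
qed

lemma L_measurable: "u \<in> borel_measurable BS \<Longrightarrow> L u \<in> borel_measurable (BS \<Otimes>\<^sub>M BA)"
proof -
  assume [measurable]: "u \<in> borel_measurable BS"
  have [measurable]: "q \<in> BS \<Otimes>\<^sub>M BA \<rightarrow>\<^sub>M subprob_algebra BS" by (rule measurable_prob_algebraD) measurable
  show ?thesis unfolding L_def by measurable
qed

text \<open>
  The integral in the Bellman operator is nonnegative, so a bound on \<open>L u\<close> bounds \<open>g\<close> and makes the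
  actions accumulate; lower semicontinuity of \<open>L u\<close> preserves the bound in the limit.
\<close>
lemma L_K: "seq_lsc S u \<Longrightarrow> seq_K_inf_compact S A (L u)"
  unfolding seq_K_inf_compact_def
proof (intro allI impI)
  fix \<sigma> s as l
  assume u: "seq_lsc S u" and *: "range \<sigma> \<subseteq> topspace S" "limitin S \<sigma> s sequentially" "range as \<subseteq> topspace A"
    "l < top" "\<forall>n. L u (\<sigma> n, as n) \<le> l"
  have "g (\<sigma> n, as n) \<le> l" for n
    using *(5) unfolding L_def by (meson add_increasing2 order_trans zero_le order_refl)
  then obtain r a where r: "strict_mono (r::nat \<Rightarrow> nat)" "limitin A (as \<circ> r) a sequentially"
    using seq_K_inf_compactD[OF g_K *(1-4)] by blast
  have "L u (s, a) \<le> liminf (\<lambda>n. L u (\<sigma> (r n), as (r n)))"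
  proof (rule seq_lscD[OF L_lsc[OF u], of "\<lambda>n. (\<sigma> (r n), as (r n))" "(s, a)"])
    show "limitin (prod_topology S A) (\<lambda>n. (\<sigma> (r n), as (r n))) (s, a) sequentially"
      using limitin_subsequence[OF r(1) *(2)] r(2) by (simp add: limitin_pairwise comp_def)
  qed (use *(1,3) in auto)
  also have "\<dots> \<le> l" using *(5) by (intro Liminf_le) auto
  finally show "\<exists>r a. strict_mono (r::nat \<Rightarrow> nat) \<and> limitin A (as \<circ> r) a sequentially \<and> L u (s, a) \<le> l"
    using r by blast
qed

lemma L_mono: "(\<And>s. u s \<le> v s) \<Longrightarrow> L u p \<le> L v p"
  unfolding L_def by (intro add_left_mono mult_left_mono nn_integral_mono) auto

lemma L_cong: "p \<in> topspace S \<times> topspace A \<Longrightarrow> (\<And>s. s \<in> topspace S \<Longrightarrow> u s = v s) \<Longrightarrow> L u p = L v p"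
proof -
  assume p: "p \<in> topspace S \<times> topspace A" and uv: "\<And>s. s \<in> topspace S \<Longrightarrow> u s = v s"
  have "q p \<in> prob_measures S"
    using measurable_space[OF q_measurable, of p] p by (simp add: space_pair_measure)
  then have "(\<integral>\<^sup>+s'. u s' \<partial>q p) = (\<integral>\<^sup>+s'. v s' \<partial>q p)"
    using prob_measuresD(2)[of "q p" S] uv by (intro nn_integral_cong) simp
  then show ?thesis by (simp add: L_def)
qed

lemma L_SUP:
  assumes p: "p \<in> topspace S \<times> topspace A" and u: "\<And>n. u n \<in> borel_measurable BS" and "incseq u"
  shows "L (\<lambda>s. SUP n. u n s) p = (SUP n. L (u n) p)"
proof -
  have "q p \<in> prob_measures S"
    using measurable_space[OF q_measurable, of p] p by (simp add: space_pair_measure)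
  then have "u n \<in> borel_measurable (q p)" for n
    using u prob_measuresD(1)[of "q p" S] by (auto cong: measurable_cong_sets)
  then have "(\<integral>\<^sup>+s'. (SUP n. u n s') \<partial>q p) = (SUP n. \<integral>\<^sup>+s'. u n s' \<partial>q p)"
    by (rule nn_integral_monotone_convergence_SUP[OF \<open>incseq u\<close>])
  then show ?thesis
    by (simp add: L_def SUP_mult_left_ennreal ennreal_SUP_add_right)
qed

section \<open>Value iteration\<close>

primrec W :: "nat \<Rightarrow> 's \<Rightarrow> ennreal" where
  "W 0 = (\<lambda>s. 0)"
| "W (Suc n) = (\<lambda>s. INF a\<in>topspace A. L (W n) (s, a))"

definition W_lim :: "'s \<Rightarrow> ennreal" where
  "W_lim s = (SUP n. W n s)"

lemma W_lsc: "seq_lsc S (W n)"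
proof (induction n)
  case (Suc n)
  then show ?case by (simp add: seq_K_inf_compact_INF_lsc[OF A_met L_K])
qed (simp add: seq_lsc_const)

lemma W_lim_lsc: "seq_lsc S W_lim"
  unfolding W_lim_def[abs_def] by (rule seq_lsc_SUP[OF W_lsc])

lemma W_measurable [measurable]: "W n \<in> borel_measurable BS"
  by (rule seq_lsc_measurable[OF S_met W_lsc])

lemma W_le_Suc: "W n s \<le> W (Suc n) s"
proof (induction n arbitrary: s)
  case (Suc n)
  have "L (W n) p \<le> L (W (Suc n)) p" for p by (rule L_mono) (rule Suc.IH)
  then have "(INF a\<in>topspace A. L (W n) (s, a)) \<le> (INF a\<in>topspace A. L (W (Suc n)) (s, a))"
    by (intro INF_mono) blast
  then show ?case by simp
qed simp

lemma incseq_W: "incseq W"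
  by (rule incseq_SucI) (simp add: le_fun_def W_le_Suc del: W.simps)

lemma W_Suc_attained:
  "s \<in> topspace S \<Longrightarrow> \<exists>a\<in>topspace A. L (W n) (s, a) = W (Suc n) s"
  using seq_K_inf_compact_attained[OF A_met L_K[OF W_lsc] _ A_ne] by simp

text \<open>
  The inequality \<open>\<ge>\<close> rests on compactness: minimizers \<open>as n\<close> of \<open>L (W n) (s, _)\<close> have cost at most \<open>W_lim s\<close>,
  so they accumulate at some \<open>a\<close>. Since \<open>W n \<le> W m\<close> for \<open>m \<ge> n\<close>, lower semicontinuity gives
  \<open>L (W n) (s, a) \<le> W_lim s\<close> for every \<open>n\<close>, and monotone convergence turns this into
  \<open>L W_lim (s, a) \<le> W_lim s\<close>.
\<close>
lemma W_lim_fixed_point: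
  assumes s: "s \<in> topspace S"
  shows "W_lim s = (INF a\<in>topspace A. L W_lim (s, a))"
proof (rule antisym)
  have "W n s \<le> L W_lim (s, a)" if "a \<in> topspace A" for n a
  proof -
    have "W (Suc n) s \<le> L (W n) (s, a)" using that by (auto intro: INF_lower)
    also have "\<dots> \<le> L W_lim (s, a)" by (rule L_mono) (auto simp: W_lim_def intro: SUP_upper)
    finally show ?thesis using W_le_Suc[of n s] by (rule order_trans[rotated])
  qed
  then show "W_lim s \<le> (INF a\<in>topspace A. L W_lim (s, a))"
    unfolding W_lim_def[of s] by (intro SUP_least INF_greatest) blast
next
  show "(INF a\<in>topspace A. L W_lim (s, a)) \<le> W_lim s"
  proof (cases "W_lim s = top")
    case False
    then have fin: "W_lim s < top" by (simp add: less_top)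
    obtain as where as: "\<And>n. as n \<in> topspace A" "\<And>n. L (W n) (s, as n) = W (Suc n) s"
      using W_Suc_attained[OF s] by metis
    have le: "L (W n) (s, as n) \<le> W_lim s" for n
      unfolding as(2) W_lim_def by (rule SUP_upper) simp
    have const: "range (\<lambda>_::nat. s) \<subseteq> topspace S" "limitin S (\<lambda>_. s) s sequentially"
      using s by (auto simp: limitin_const)
    have "g (s, as n) \<le> W_lim s" for n
      using le[of n] unfolding L_def by (meson add_increasing2 order_trans zero_le order_refl)
    then obtain r a where r: "strict_mono (r::nat \<Rightarrow> nat)" "limitin A (as \<circ> r) a sequentially"
      using seq_K_inf_compactD[OF g_K const _ fin, of as] as(1) by blast
    have aA: "a \<in> topspace A" using r(2) by (rule limitin_topspace)
    have "L (W n) (s, a) \<le> W_lim s" for n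
    proof -
      have "L (W n) (s, a) \<le> liminf (\<lambda>k. L (W n) (s, as (r k)))"
        using seq_lscD[OF L_lsc[OF W_lsc], of "\<lambda>k. (s, as (r k))" "(s, a)"] r(2) const(2) as(1) s
        by (auto simp: limitin_pairwise comp_def)
      also have "\<dots> \<le> W_lim s"
      proof (rule Liminf_le)
        show "\<forall>\<^sub>F k in sequentially. L (W n) (s, as (r k)) \<le> W_lim s"
          using eventually_ge_at_top[of n]
        proof eventually_elim
          case (elim k)
          then have "n \<le> r k" using seq_suble[OF r(1), of k] by linarith
          then have "L (W n) (s, as (r k)) \<le> L (W (r k)) (s, as (r k))"
            using incseq_W by (intro L_mono) (auto simp: incseq_def le_fun_def)
          then show ?case using le[of "r k"] by (rule order_trans)
        qed
      qed simp
      finally show ?thesis .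
    qed
    then have "L W_lim (s, a) \<le> W_lim s"
      using L_SUP[OF _ W_measurable incseq_W, of "(s, a)"] s aA
      by (simp add: W_lim_def[abs_def] SUP_le_iff)
    then show ?thesis using aA by (rule INF_lower2[rotated])
  qed simp
qed

lemma W_lim_attained: "s \<in> topspace S \<Longrightarrow> \<exists>a\<in>topspace A. L W_lim (s, a) = W_lim s"
  using seq_K_inf_compact_attained[OF A_met L_K[OF W_lim_lsc] _ A_ne] W_lim_fixed_point by simp

lemma W_greedy: "\<exists>\<phi>\<in>BS \<rightarrow>\<^sub>M BA. \<forall>s\<in>topspace S. L (W n) (s, \<phi> s) = W (Suc n) s"
  using exists_measurable_minimizer[OF S_met A_met A_sc A_ne L_K[OF W_lsc]] by simp

lemma W_lim_greedy: "\<exists>\<phi>\<in>BS \<rightarrow>\<^sub>M BA. \<forall>s\<in>topspace S. L W_lim (s, \<phi> s) = W_lim s"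
  using exists_measurable_minimizer[OF S_met A_met A_sc A_ne L_K[OF W_lim_lsc]] W_lim_fixed_point by simp

text \<open>
  If \<open>v s \<le> l\<close>, a minimizing action \<open>a\<close> puts \<open>(s, a)\<close> into the compact set where \<open>g \<le> l\<close>. Hence the
  states with \<open>v s \<le> l\<close> accumulate, and lower semicontinuity of \<open>v\<close> keeps the limit among them.
\<close>
lemma compactin_sublevel_values:
  assumes g: "\<And>l. l < top \<Longrightarrow> compactin (prod_topology S A) {p \<in> topspace (prod_topology S A). g p \<le> l}"
    and u: "seq_lsc S u" and v: "seq_lsc S v" and l: "l < top"
    and att: "\<And>s. s \<in> topspace S \<Longrightarrow> \<exists>a\<in>topspace A. L u (s, a) = v s"
  shows "compactin S {s \<in> topspace S. v s \<le> l}"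
  unfolding metrizable_compactin_sequentially[OF S_met]
proof (intro conjI allI impI)
  fix \<sigma> :: "nat \<Rightarrow> 's" assume \<sigma>: "range \<sigma> \<subseteq> {s \<in> topspace S. v s \<le> l}"
  then have \<sigma>S: "\<sigma> n \<in> topspace S" "v (\<sigma> n) \<le> l" for n by auto
  have "\<forall>n. \<exists>a\<in>topspace A. L u (\<sigma> n, a) = v (\<sigma> n)" using att[OF \<sigma>S(1)] by blast
  then obtain as where as: "\<And>n. as n \<in> topspace A" "\<And>n. L u (\<sigma> n, as n) = v (\<sigma> n)" by metis
  have "g (\<sigma> n, as n) \<le> l" for n
    using \<sigma>S(2)[of n] as(2)[of n] unfolding L_def by (metis add_increasing2 order_trans zero_le order_refl)
  then have "range (\<lambda>n. (\<sigma> n, as n)) \<subseteq> {p \<in> topspace (prod_topology S A). g p \<le> l}"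
    using \<sigma>S as by auto
  then obtain p r where p: "strict_mono (r::nat \<Rightarrow> nat)" "limitin (prod_topology S A) ((\<lambda>n. (\<sigma> n, as n)) \<circ> r) p sequentially"
    using g[OF l] unfolding metrizable_compactin_sequentially[OF SA_met] by blast
  then have lim: "limitin S (\<sigma> \<circ> r) (fst p) sequentially" by (simp add: limitin_pairwise comp_def)
  have "v (fst p) \<le> liminf (\<lambda>n. v ((\<sigma> \<circ> r) n))" by (rule seq_lscD[OF v _ lim]) (use \<sigma>S in auto)
  also have "\<dots> \<le> l" using \<sigma>S(2) by (intro Liminf_le) auto
  finally show "\<exists>s r. s \<in> {s \<in> topspace S. v s \<le> l} \<and> strict_mono r \<and> limitin S (\<sigma> \<circ> r) s sequentially"
    using p(1) lim limitin_topspace[OF lim] by blast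
qed auto

end

section \<open>Costs of policies along trajectories\<close>

lemma (in Ionescu_Tulcea) nn_integral_lim_restrict:
  assumes f [measurable]: "f \<in> borel_measurable (PiM {0..<n} M)"
  shows "(\<integral>\<^sup>+\<omega>. f (restrict \<omega> {0..<n}) \<partial>PF.lim) = (\<integral>\<^sup>+\<omega>. f \<omega> \<partial>C 0 n (\<lambda>_. undefined))"
proof -
  have und: "(\<lambda>_. undefined) \<in> space (PiM {0..<0::nat} M)" by (simp add: space_PiM)
  have up: "up_to {0..<n} \<le> n" by (simp add: up_to_iff)
  have "CI {0..<n} = C 0 n (\<lambda>_. undefined)"
  proof (rule measure_eqI)
    show "sets (CI {0..<n}) = sets (C 0 n (\<lambda>_. undefined))"
      by (simp add: CI_def sets_C[OF und])
    fix X assume "X \<in> sets (CI {0..<n})"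
    then have X: "X \<in> sets (PiM {0..<n} M)" by (simp add: CI_def)
    have "emeasure (CI {0..<n}) X = emeasure (C 0 n (\<lambda>_. undefined)) (PF.emb {0..<n} {0..<n} X)"
      by (rule emeasure_CI[OF _ X]) simp
    also have "PF.emb {0..<n} {0..<n} X = X"
      using sets.sets_into_space[OF X] by (intro prod_emb_id) (auto simp: space_PiM)
    finally show "emeasure (CI {0..<n}) X = emeasure (C 0 n (\<lambda>_. undefined)) X" .
  qed
  then have "distr PF.lim (PiM {0..<n} M) (\<lambda>x. restrict x {0..<n}) = C 0 n (\<lambda>_. undefined)"
    using distr_lim[of "{0..<n}"] by simp
  then have "(\<integral>\<^sup>+\<omega>. f \<omega> \<partial>C 0 n (\<lambda>_. undefined)) =
      (\<integral>\<^sup>+\<omega>. f \<omega> \<partial>distr PF.lim (PiM {0..<n} M) (\<lambda>x. restrict x {0..<n}))"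
    by simp
  also have "\<dots> = (\<integral>\<^sup>+\<omega>. f (restrict \<omega> {0..<n}) \<partial>PF.lim)"
  proof (rule nn_integral_distr)
    have "(\<lambda>x. restrict x {0..<n}) \<in> PiM UNIV M \<rightarrow>\<^sub>M PiM {0..<n} M"
      by (rule measurable_restrict_subset) simp
    then show "(\<lambda>x. restrict x {0..<n}) \<in> PF.lim \<rightarrow>\<^sub>M PiM {0..<n} M"
      by (simp add: measurable_cong_sets[OF PF.sets_lim refl])
  qed simp
  finally show ?thesis ..
qed

context inf_compact_mdp
begin

abbreviation "policies \<equiv> {\<delta>. is_policy D \<delta>}"

definition partial_cost :: "nat \<Rightarrow> (nat \<Rightarrow> 's \<times> 'a) \<Rightarrow> ennreal" where
  "partial_cost n \<omega> = (\<Sum>t<n. \<beta> ^ t * g (\<omega> t))"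

text \<open>
  Expected costs of a policy over \<open>n\<close> stages and over the infinite horizon.
\<close>
definition J :: "nat \<Rightarrow> ('s, 'a) policy \<Rightarrow> 's \<Rightarrow> ennreal" where
  "J n \<delta> z = (\<integral>\<^sup>+\<omega>. partial_cost n \<omega> \<partial>trajectory_law D \<delta> z)"

definition J_lim :: "('s, 'a) policy \<Rightarrow> 's \<Rightarrow> ennreal" where
  "J_lim \<delta> z = (\<integral>\<^sup>+\<omega>. (\<Sum>t. \<beta> ^ t * g (\<omega> t)) \<partial>trajectory_law D \<delta> z)"

text \<open>
  The conditional law of the state at time \<open>t\<close> given the earlier states and actions.
\<close>
definition state_law :: "'s \<Rightarrow> nat \<Rightarrow> (nat \<Rightarrow> 's \<times> 'a) \<Rightarrow> 's measure" where
  "state_law z t \<omega> = (if t = 0 then return BS z else q (\<omega> (t - 1)))"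

lemma partial_cost_measurable:
  "{0..<n} \<subseteq> I \<Longrightarrow> partial_cost n \<in> borel_measurable (PiM I (\<lambda>_. BS \<Otimes>\<^sub>M BA))"
  unfolding partial_cost_def
proof (intro borel_measurable_sum borel_measurable_times_ennreal measurable_const)
  fix t assume "{0..<n} \<subseteq> I" "t \<in> {..<n}"
  then have "(\<lambda>\<omega>. \<omega> t) \<in> PiM I (\<lambda>_. BS \<Otimes>\<^sub>M BA) \<rightarrow>\<^sub>M BS \<Otimes>\<^sub>M BA"
    by (intro measurable_component_singleton) auto
  then show "(\<lambda>\<omega>. g (\<omega> t)) \<in> borel_measurable (PiM I (\<lambda>_. BS \<Otimes>\<^sub>M BA))"
    by (rule measurable_compose[OF _ g_measurable])
qed simp

lemma partial_cost_measurable_H [measurable]: "partial_cost n \<in> borel_measurable (H n)"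
  by (rule partial_cost_measurable) simp

context
  fixes \<delta> :: "('s, 'a) policy" and z :: 's
  assumes \<delta>: "is_policy D \<delta>" and z: "z \<in> topspace S"
begin

interpretation IT: Ionescu_Tulcea "step_kernel D \<delta> z" "\<lambda>_. BS \<Otimes>\<^sub>M BA"
  by (rule Ionescu_Tulcea_step_kernel[OF q_kernel \<delta> z])

text \<open>
  The law of the first \<open>n\<close> state-action pairs.
\<close>
abbreviation "past n \<equiv> IT.C 0 n (\<lambda>_. undefined)"

lemma und: "(\<lambda>_. undefined) \<in> space (H 0)"
  by (simp add: space_PiM)

lemma space_past: "space (past n) = space (H n)"
  using IT.space_C[OF und, of n] by simp

lemma sets_past [measurable_cong]: "sets (past n) = sets (H n)"
  using IT.sets_C[OF und, of n] by simp

lemma trajectory_law_prob: "prob_space (trajectory_law D \<delta> z)"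
proof (rule prob_space_distrD)
  have "(\<lambda>x. restrict x {0..<0::nat}) \<in> PiM UNIV (\<lambda>_. BS \<Otimes>\<^sub>M BA) \<rightarrow>\<^sub>M PiM {0..<0} (\<lambda>_. BS \<Otimes>\<^sub>M BA)"
    by (rule measurable_restrict_subset) simp
  then show "(\<lambda>x. restrict x {0..<0::nat}) \<in> trajectory_law D \<delta> z \<rightarrow>\<^sub>M PiM {0..<0} (\<lambda>_. BS \<Otimes>\<^sub>M BA)"
    unfolding trajectory_law_def measurable_cong_sets[OF IT.PF.sets_lim refl] .
  show "prob_space (distr (trajectory_law D \<delta> z) (PiM {0..<0} (\<lambda>_. BS \<Otimes>\<^sub>M BA)) (\<lambda>x. restrict x {0..<0::nat}))"
    unfolding trajectory_law_def
    by (subst IT.distr_lim) (simp_all add: IT.PF.prob_space_P)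
qed

lemma sets_trajectory_law: "sets (trajectory_law D \<delta> z) = sets (PiM UNIV (\<lambda>_. BS \<Otimes>\<^sub>M BA))"
  unfolding trajectory_law_def by (rule IT.PF.sets_lim)

lemma policy_measurable: "\<delta> t \<in> H t \<Otimes>\<^sub>M BS \<rightarrow>\<^sub>M prob_algebra BA"
  using \<delta> by (simp add: is_policy_def stochastic_kernel_iff)

lemma state_law_measurable: "state_law z t \<in> H t \<rightarrow>\<^sub>M prob_algebra BS"
proof (cases t)
  case 0
  then show ?thesis
    using z by (auto simp: state_law_def[abs_def] space_prob_algebra intro!: measurable_const prob_space_return)
next
  case (Suc n)
  then have "(\<lambda>\<omega>. \<omega> n) \<in> H t \<rightarrow>\<^sub>M BS \<Otimes>\<^sub>M BA"
    by (intro measurable_component_singleton) auto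
  from measurable_compose[OF this q_measurable] Suc show ?thesis by (simp add: state_law_def[abs_def])
qed

lemma J_eq_past: "J n \<delta> z = (\<integral>\<^sup>+\<omega>. partial_cost n \<omega> \<partial>past n)"
proof -
  have "J n \<delta> z = (\<integral>\<^sup>+\<omega>. partial_cost n (restrict \<omega> {0..<n}) \<partial>trajectory_law D \<delta> z)"
    unfolding J_def by (intro nn_integral_cong) (simp add: partial_cost_def)
  also have "\<dots> = (\<integral>\<^sup>+\<omega>. partial_cost n \<omega> \<partial>past n)"
    unfolding trajectory_law_def by (rule IT.nn_integral_lim_restrict) measurable
  finally show ?thesis .
qed

lemma nn_integral_step_kernel:
  assumes \<omega>: "\<omega> \<in> space (H n)" and f [measurable]: "f \<in> borel_measurable (BS \<Otimes>\<^sub>M BA)"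
  shows "(\<integral>\<^sup>+p. f p \<partial>step_kernel D \<delta> z n \<omega>) = (\<integral>\<^sup>+s. \<integral>\<^sup>+a. f (s, a) \<partial>\<delta> n (\<omega>, s) \<partial>state_law z n \<omega>)"
proof -
  have sl: "state_law z n \<omega> \<in> prob_measures S"
    using measurable_space[OF state_law_measurable \<omega>] .
  have [measurable_cong]: "sets (state_law z n \<omega>) = sets BS" using prob_measuresD(1)[OF sl] .
  have spl: "space (state_law z n \<omega>) = topspace S" using prob_measuresD(2)[OF sl] .
  have [measurable]: "(\<lambda>s. \<delta> n (\<omega>, s)) \<in> BS \<rightarrow>\<^sub>M prob_algebra BA"
    by (rule measurable_compose[OF _ policy_measurable]) (use \<omega> in measurable)
  have [measurable]: "(\<lambda>s. \<delta> n (\<omega>, s)) \<in> BS \<rightarrow>\<^sub>M subprob_algebra BA"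
    by (rule measurable_prob_algebraD) measurable
  let ?N = "\<lambda>s. \<delta> n (\<omega>, s) \<bind> (\<lambda>a. return (BS \<Otimes>\<^sub>M BA) (s, a))"
  have N: "?N \<in> BS \<rightarrow>\<^sub>M subprob_algebra (BS \<Otimes>\<^sub>M BA)" by measurable
  have "(\<integral>\<^sup>+p. f p \<partial>step_kernel D \<delta> z n \<omega>) = (\<integral>\<^sup>+p. f p \<partial>(state_law z n \<omega> \<bind> ?N))"
    by (simp add: step_kernel_def state_law_def)
  also have "\<dots> = (\<integral>\<^sup>+s. (\<integral>\<^sup>+p. f p \<partial>?N s) \<partial>state_law z n \<omega>)"
    by (rule nn_integral_bind[where B="BS \<Otimes>\<^sub>M BA"]) (use f N in measurable)
  also have "\<dots> = (\<integral>\<^sup>+s. \<integral>\<^sup>+a. f (s, a) \<partial>\<delta> n (\<omega>, s) \<partial>state_law z n \<omega>)"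
  proof (rule nn_integral_cong)
    fix s assume "s \<in> space (state_law z n \<omega>)"
    then have s: "s \<in> topspace S" by (simp add: spl)
    have dl: "\<delta> n (\<omega>, s) \<in> prob_measures A"
      using \<omega> s by (intro measurable_space[OF policy_measurable]) (simp add: space_pair_measure)
    have ret: "(\<lambda>a. return (BS \<Otimes>\<^sub>M BA) (s, a)) \<in> \<delta> n (\<omega>, s) \<rightarrow>\<^sub>M subprob_algebra (BS \<Otimes>\<^sub>M BA)"
      using s by (simp add: measurable_cong_sets[OF prob_measuresD(1)[OF dl] refl])
    have "(\<integral>\<^sup>+p. f p \<partial>?N s) = (\<integral>\<^sup>+a. \<integral>\<^sup>+p. f p \<partial>return (BS \<Otimes>\<^sub>M BA) (s, a) \<partial>\<delta> n (\<omega>, s))"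
      by (rule nn_integral_bind[OF f ret])
    also have "\<dots> = (\<integral>\<^sup>+a. f (s, a) \<partial>\<delta> n (\<omega>, s))"
      using s prob_measuresD(2)[OF dl]
      by (intro nn_integral_cong nn_integral_return) (auto simp: space_pair_measure)
    finally show "(\<integral>\<^sup>+p. f p \<partial>?N s) = (\<integral>\<^sup>+a. f (s, a) \<partial>\<delta> n (\<omega>, s))" .
  qed
  finally show ?thesis .
qed

text \<open>
  The expected cost of the first \<open>n\<close> stages when, in addition, \<open>u\<close> is charged for the state at time
  \<open>n\<close>. At \<open>n = 0\<close> this is \<open>u z\<close>, and with \<open>u = 0\<close> it is the cost over \<open>n\<close> stages.
\<close>
definition "cost_to_go u n =
  (\<integral>\<^sup>+\<omega>. partial_cost n \<omega> + \<beta> ^ n * (\<integral>\<^sup>+s. u s \<partial>state_law z n \<omega>) \<partial>past n)"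

lemma cost_to_go_0: "u \<in> borel_measurable BS \<Longrightarrow> cost_to_go u 0 = u z"
proof -
  assume u: "u \<in> borel_measurable BS"
  interpret prob_space "past 0" by (rule IT.prob_space_C[OF und])
  have "cost_to_go u 0 = (\<integral>\<^sup>+\<omega>. u z \<partial>past 0)"
    unfolding cost_to_go_def using u z
    by (intro nn_integral_cong) (simp add: partial_cost_def state_law_def nn_integral_return)
  also have "\<dots> = u z" by (simp add: emeasure_space_1)
  finally show ?thesis .
qed

text \<open>
  Integrating out the state at time \<open>n + 1\<close> turns the terminal charge into the Bellman operator,
  applied to the state and action at time \<open>n\<close>.
\<close>
lemma cost_to_go_Suc:
  assumes u [measurable]: "u \<in> borel_measurable BS"
  shows "cost_to_go u (Suc n) =
    (\<integral>\<^sup>+\<omega>. (\<integral>\<^sup>+s. \<integral>\<^sup>+a. partial_cost n \<omega> + \<beta> ^ n * L u (s, a) \<partial>\<delta> n (\<omega>, s) \<partial>state_law z n \<omega>) \<partial>past n)"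
proof -
  have [measurable]: "L u \<in> borel_measurable (BS \<Otimes>\<^sub>M BA)" by (rule L_measurable[OF u])
  let ?f = "\<lambda>\<omega>. partial_cost (Suc n) \<omega> + \<beta> ^ Suc n * (\<integral>\<^sup>+s. u s \<partial>state_law z (Suc n) \<omega>)"
  have [measurable]: "state_law z (Suc n) \<in> H (Suc n) \<rightarrow>\<^sub>M subprob_algebra BS"
    by (rule measurable_prob_algebraD[OF state_law_measurable])
  have [measurable]: "partial_cost (Suc n) \<in> borel_measurable (H (Suc n))"
    by (rule partial_cost_measurable_H)
  have f: "?f \<in> borel_measurable (H (Suc n))" by measurable
  have "cost_to_go u (Suc n) = (\<integral>\<^sup>+\<omega>. ?f \<omega> \<partial>(past n \<bind> IT.eP n))"
    by (simp add: cost_to_go_def)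
  also have "\<dots> = (\<integral>\<^sup>+\<omega>. (\<integral>\<^sup>+\<omega>'. ?f \<omega>' \<partial>IT.eP n \<omega>) \<partial>past n)"
    using IT.measurable_eP[of n] f
    by (intro nn_integral_bind[where B="H (Suc n)"]) (simp_all add: measurable_cong_sets[OF sets_past refl])
  also have "\<dots> = (\<integral>\<^sup>+\<omega>. (\<integral>\<^sup>+s. \<integral>\<^sup>+a. partial_cost n \<omega> + \<beta> ^ n * L u (s, a) \<partial>\<delta> n (\<omega>, s) \<partial>state_law z n \<omega>) \<partial>past n)"
  proof (rule nn_integral_cong)
    fix \<omega> assume "\<omega> \<in> space (past n)"
    then have \<omega>: "\<omega> \<in> space (H n)" by (simp add: space_past)
    have "(\<integral>\<^sup>+\<omega>'. ?f \<omega>' \<partial>IT.eP n \<omega>) = (\<integral>\<^sup>+p. ?f (fun_upd \<omega> n p) \<partial>step_kernel D \<delta> z n \<omega>)"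
      by (rule IT.nn_integral_eP[OF \<omega> f])
    also have "(\<integral>\<^sup>+p. ?f (fun_upd \<omega> n p) \<partial>step_kernel D \<delta> z n \<omega>) =
        (\<integral>\<^sup>+p. partial_cost n \<omega> + \<beta> ^ n * L u p \<partial>step_kernel D \<delta> z n \<omega>)"
      by (intro nn_integral_cong)
         (simp add: partial_cost_def state_law_def L_def distrib_left mult.assoc add.assoc power_commutes[symmetric])
    also have "\<dots> = (\<integral>\<^sup>+s. \<integral>\<^sup>+a. partial_cost n \<omega> + \<beta> ^ n * L u (s, a) \<partial>\<delta> n (\<omega>, s) \<partial>state_law z n \<omega>)"
      by (rule nn_integral_step_kernel[OF \<omega>]) measurable
    finally show "(\<integral>\<^sup>+\<omega>'. ?f \<omega>' \<partial>IT.eP n \<omega>) =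
        (\<integral>\<^sup>+s. \<integral>\<^sup>+a. partial_cost n \<omega> + \<beta> ^ n * L u (s, a) \<partial>\<delta> n (\<omega>, s) \<partial>state_law z n \<omega>)" .
  qed
  finally show ?thesis .
qed

text \<open>
  The terminal charge does not depend on the action at time \<open>n\<close>. Integrating over that action as
  well brings the quantity into the shape of \<open>cost_to_go_Suc\<close>, and the two can be compared pointwise.
\<close>
lemma cost_to_go_eq:
  assumes u [measurable]: "u \<in> borel_measurable BS"
  shows "cost_to_go u n =
    (\<integral>\<^sup>+\<omega>. (\<integral>\<^sup>+s. \<integral>\<^sup>+a. partial_cost n \<omega> + \<beta> ^ n * u s \<partial>\<delta> n (\<omega>, s) \<partial>state_law z n \<omega>) \<partial>past n)"
  unfolding cost_to_go_def
proof (rule nn_integral_cong)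
  fix \<omega> assume "\<omega> \<in> space (past n)"
  then have \<omega>: "\<omega> \<in> space (H n)" by (simp add: space_past)
  have sl: "state_law z n \<omega> \<in> prob_measures S"
    using measurable_space[OF state_law_measurable \<omega>] .
  have [measurable_cong]: "sets (state_law z n \<omega>) = sets BS" using prob_measuresD(1)[OF sl] .
  interpret sl: prob_space "state_law z n \<omega>" using prob_measuresD(3)[OF sl] .
  have "(\<integral>\<^sup>+s. \<integral>\<^sup>+a. partial_cost n \<omega> + \<beta> ^ n * u s \<partial>\<delta> n (\<omega>, s) \<partial>state_law z n \<omega>) =
      (\<integral>\<^sup>+s. partial_cost n \<omega> + \<beta> ^ n * u s \<partial>state_law z n \<omega>)"
  proof (rule nn_integral_cong)
    fix s assume "s \<in> space (state_law z n \<omega>)"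
    then have s: "s \<in> topspace S" using prob_measuresD(2)[OF sl] by simp
    have dl: "\<delta> n (\<omega>, s) \<in> prob_measures A"
      using \<omega> s by (intro measurable_space[OF policy_measurable]) (simp add: space_pair_measure)
    interpret dl: prob_space "\<delta> n (\<omega>, s)" using prob_measuresD(3)[OF dl] .
    show "(\<integral>\<^sup>+a. partial_cost n \<omega> + \<beta> ^ n * u s \<partial>\<delta> n (\<omega>, s)) = partial_cost n \<omega> + \<beta> ^ n * u s"
      by (simp add: dl.emeasure_space_1)
  qed
  also have "\<dots> = partial_cost n \<omega> + \<beta> ^ n * (\<integral>\<^sup>+s. u s \<partial>state_law z n \<omega>)"
    by (simp add: nn_integral_add nn_integral_cmult sl.emeasure_space_1)
  finally show "partial_cost n \<omega> + \<beta> ^ n * (\<integral>\<^sup>+s. u s \<partial>state_law z n \<omega>) =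
      (\<integral>\<^sup>+s. \<integral>\<^sup>+a. partial_cost n \<omega> + \<beta> ^ n * u s \<partial>\<delta> n (\<omega>, s) \<partial>state_law z n \<omega>)" ..
qed

lemma cost_to_go_compare:
  assumes "\<And>\<omega> s a. \<omega> \<in> space (H n) \<Longrightarrow> s \<in> topspace S \<Longrightarrow> a \<in> topspace A \<Longrightarrow> f \<omega> s a \<le> h \<omega> s a"
  shows "(\<integral>\<^sup>+\<omega>. (\<integral>\<^sup>+s. \<integral>\<^sup>+a. f \<omega> s a \<partial>\<delta> n (\<omega>, s) \<partial>state_law z n \<omega>) \<partial>past n) \<le>
         (\<integral>\<^sup>+\<omega>. (\<integral>\<^sup>+s. \<integral>\<^sup>+a. h \<omega> s a \<partial>\<delta> n (\<omega>, s) \<partial>state_law z n \<omega>) \<partial>past n)"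
proof (intro nn_integral_mono)
  fix \<omega> s a assume "\<omega> \<in> space (past n)" and s': "s \<in> space (state_law z n \<omega>)" and a': "a \<in> space (\<delta> n (\<omega>, s))"
  then have \<omega>: "\<omega> \<in> space (H n)" by (simp add: space_past)
  have s: "s \<in> topspace S"
    using prob_measuresD(2)[OF measurable_space[OF state_law_measurable \<omega>]] s' by simp
  have "\<delta> n (\<omega>, s) \<in> prob_measures A"
    using \<omega> s by (intro measurable_space[OF policy_measurable]) (simp add: space_pair_measure)
  then have "a \<in> topspace A" using prob_measuresD(2)[of "\<delta> n (\<omega>, s)" A] a' by simp
  with assms \<omega> s show "f \<omega> s a \<le> h \<omega> s a" by blast
qed

text \<open>
  A Bellman inequality for the functions \<open>u n\<close> makes \<open>cost_to_go (u n) n\<close> increase with \<open>n\<close>.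
\<close>
lemma le_J:
  assumes u: "\<And>n. u n \<in> borel_measurable BS"
    and le: "\<And>n s a. n < T \<Longrightarrow> s \<in> topspace S \<Longrightarrow> a \<in> topspace A \<Longrightarrow> u n s \<le> L (u (Suc n)) (s, a)"
    and 0: "u T = (\<lambda>_. 0)"
  shows "u 0 z \<le> J T \<delta> z"
proof -
  have "n \<le> T \<Longrightarrow> u 0 z \<le> cost_to_go (u n) n" for n
  proof (induction n)
    case (Suc n)
    then have "u 0 z \<le> cost_to_go (u n) n" by simp
    also have "\<dots> \<le> cost_to_go (u (Suc n)) (Suc n)"
      unfolding cost_to_go_Suc[OF u[of "Suc n"], of n] cost_to_go_eq[OF u[of n], of n]
      using Suc.prems by (intro cost_to_go_compare add_left_mono mult_left_mono le) auto
    finally show ?case .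
  qed (simp add: cost_to_go_0[OF u])
  from this[of T] have "u 0 z \<le> cost_to_go (\<lambda>_. 0) T" using 0 by simp
  then show ?thesis by (simp add: cost_to_go_def J_eq_past)
qed

lemma J_lim_eq_SUP: "J_lim \<delta> z = (SUP n. J n \<delta> z)"
proof -
  have "J_lim \<delta> z = (\<integral>\<^sup>+\<omega>. (SUP n. partial_cost n \<omega>) \<partial>trajectory_law D \<delta> z)"
    unfolding J_lim_def partial_cost_def by (simp add: suminf_eq_SUP)
  also have "\<dots> = (SUP n. J n \<delta> z)"
    unfolding J_def
  proof (rule nn_integral_monotone_convergence_SUP)
    show "incseq partial_cost"
      by (rule incseq_SucI) (simp add: le_fun_def partial_cost_def)
    show "partial_cost n \<in> borel_measurable (trajectory_law D \<delta> z)" for n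
      using partial_cost_measurable[of n UNIV] measurable_cong_sets[OF sets_trajectory_law refl] by auto
  qed
  finally show ?thesis .
qed

text \<open>
  The comparison functions are the iterates indexed by the time to go, \<open>W (T - n)\<close> at time \<open>n\<close>.
\<close>
lemma W_le_J: "W T z \<le> J T \<delta> z"
proof -
  have "W (T - 0) z \<le> J T \<delta> z"
  proof (rule le_J[of "\<lambda>n. W (T - n)"])
    fix n s a assume "n < T" and a: "a \<in> topspace A"
    then have "T - n = Suc (T - Suc n)" by simp
    then show "W (T - n) s \<le> L (W (T - Suc n)) (s, a)" using a by (simp, intro INF_lower)
  qed auto
  then show ?thesis by simp
qed

lemma W_lim_le_J_lim: "W_lim z \<le> J_lim \<delta> z"
  unfolding J_lim_eq_SUP W_lim_def by (rule SUP_least) (rule SUP_upper2[OF UNIV_I], rule W_le_J)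

end

context
  fixes \<phi> :: "nat \<Rightarrow> 's \<Rightarrow> 'a"
  assumes \<phi>: "is_markov D \<phi>"
begin

lemma is_policy_markov_policy: "is_policy D (markov_policy D \<phi>)"
proof -
  have \<phi>m: "\<phi> t \<in> BS \<rightarrow>\<^sub>M BA" for t using \<phi> by (simp add: is_markov_def)
  have "(\<lambda>p. return BA (\<phi> t (snd p))) \<in> H t \<Otimes>\<^sub>M BS \<rightarrow>\<^sub>M prob_algebra BA" for t
    by (rule measurable_compose[OF measurable_compose[OF measurable_snd \<phi>m] measurable_return_prob_space])
  then show ?thesis
    by (simp add: is_policy_def stochastic_kernel_iff markov_policy_def split_beta')
qed

text \<open>
  With equality in the Bellman inequality along the policy, \<open>cost_to_go (u n) n\<close> is constant in \<open>n\<close>.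
  Without a condition on \<open>u T\<close> an inequality remains, as the terminal charge is nonnegative; it serves
  for the infinite horizon.
\<close>
lemma J_markov:
  assumes z: "z \<in> topspace S" and u: "\<And>n. u n \<in> borel_measurable BS"
    and eq: "\<And>n s. n < T \<Longrightarrow> s \<in> topspace S \<Longrightarrow> u n s = L (u (Suc n)) (s, \<phi> n s)"
  shows "J T (markov_policy D \<phi>) z \<le> u 0 z" "u T = (\<lambda>_. 0) \<Longrightarrow> J T (markov_policy D \<phi>) z = u 0 z"
proof -
  let ?\<delta> = "markov_policy D \<phi>"
  note \<delta> = is_policy_markov_policy
  have ctg: "n \<le> T \<Longrightarrow> cost_to_go ?\<delta> z (u n) n = u 0 z" for n
  proof (induction n)
    case (Suc n)
    let ?C = "Ionescu_Tulcea.C (step_kernel D ?\<delta> z) (\<lambda>_. BS \<Otimes>\<^sub>M BA) 0 n (\<lambda>_. undefined)"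
    have "(\<integral>\<^sup>+a. partial_cost n \<omega> + \<beta> ^ n * L (u (Suc n)) (s, a) \<partial>?\<delta> n (\<omega>, s)) =
        (\<integral>\<^sup>+a. partial_cost n \<omega> + \<beta> ^ n * u n s \<partial>?\<delta> n (\<omega>, s))" if s: "s \<in> topspace S" for s \<omega>
    proof -
      have \<phi>s: "\<phi> n s \<in> space BA"
        using measurable_space[of "\<phi> n" BS BA s] \<phi> s by (simp add: is_markov_def)
      have [measurable]: "L (u (Suc n)) \<in> borel_measurable (BS \<Otimes>\<^sub>M BA)" by (rule L_measurable[OF u])
      have [measurable]: "s \<in> space BS" using s by simp
      have "(\<lambda>a. partial_cost n \<omega> + \<beta> ^ n * L (u (Suc n)) (s, a)) \<in> borel_measurable BA"
        by measurable
      then show ?thesis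
        using \<phi>s Suc.prems eq[OF _ s, of n] sets.top[of BA]
        by (simp add: markov_policy_def nn_integral_return emeasure_return)
    qed
    then have "cost_to_go ?\<delta> z (u (Suc n)) (Suc n) = cost_to_go ?\<delta> z (u n) n"
      unfolding cost_to_go_Suc[OF \<delta> z u[of "Suc n"], of n] cost_to_go_eq[OF \<delta> z u[of n], of n]
      using space_past[OF \<delta> z, of n] measurable_space[OF state_law_measurable[OF \<delta> z, of n]]
      by (intro nn_integral_cong[of "Ionescu_Tulcea.C _ _ _ _ _"] nn_integral_cong[of "state_law z n _"])
         (simp add: prob_measuresD(2)[of _ S])
    with Suc show ?case by simp
  qed (simp add: cost_to_go_0[OF \<delta> z u])
  have "J T ?\<delta> z \<le> cost_to_go ?\<delta> z (u T) T"
    unfolding J_eq_past[OF \<delta> z] cost_to_go_def[OF \<delta> z] by (intro nn_integral_mono) simp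
  then show "J T ?\<delta> z \<le> u 0 z" using ctg[of T] by simp
  assume "u T = (\<lambda>_. 0)"
  then have "J T ?\<delta> z = cost_to_go ?\<delta> z (u T) T"
    unfolding J_eq_past[OF \<delta> z] cost_to_go_def[OF \<delta> z] by simp
  then show "J T ?\<delta> z = u 0 z" using ctg[of T] by simp
qed

lemma J_greedy:
  assumes z: "z \<in> topspace S"
    and greedy: "\<And>s t. s \<in> topspace S \<Longrightarrow> t < T \<Longrightarrow> L (W t) (s, \<phi> (T - 1 - t) s) = W (Suc t) s"
  shows "J T (markov_policy D \<phi>) z = W T z"
proof -
  have "J T (markov_policy D \<phi>) z = W (T - 0) z"
  proof (rule J_markov(2)[of z "\<lambda>n. W (T - n)", OF z])
    fix n s assume n: "n < T" and s: "s \<in> topspace S"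
    have "T - 1 - (T - Suc n) = n" "Suc (T - Suc n) = T - n" using n by auto
    then show "W (T - n) s = L (W (T - Suc n)) (s, \<phi> n s)"
      using greedy[OF s, of "T - Suc n"] n by (simp del: W.simps)
  qed auto
  then show ?thesis by simp
qed

end

text \<open>
  Along the policy, \<open>W_lim\<close> is a solution of the Bellman equation that does not depend on time, so it bounds the
  cost over every finite number of stages and thus also the total cost.
\<close>
lemma J_lim_greedy:
  assumes \<phi>: "is_markov D (\<lambda>_. \<phi>)" and z: "z \<in> topspace S"
    and greedy: "\<And>s. s \<in> topspace S \<Longrightarrow> L W_lim (s, \<phi> s) = W_lim s"
  shows "J_lim (markov_policy D (\<lambda>_. \<phi>)) z = W_lim z"
proof (rule antisym)
  show "J_lim (markov_policy D (\<lambda>_. \<phi>)) z \<le> W_lim z"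
    unfolding J_lim_eq_SUP[OF is_policy_markov_policy[OF \<phi>] z]
  proof (rule SUP_least)
    fix n
    show "J n (markov_policy D (\<lambda>_. \<phi>)) z \<le> W_lim z"
      by (rule J_markov(1)[OF \<phi> z, of "\<lambda>_. W_lim"]) (simp_all add: greedy seq_lsc_measurable[OF S_met W_lim_lsc])
  qed
  show "W_lim z \<le> J_lim (markov_policy D (\<lambda>_. \<phi>)) z"
    by (rule W_lim_le_J_lim[OF is_policy_markov_policy[OF \<phi>] z])
qed

text \<open>
  For a stationary policy the cost over \<open>n + 1\<close> stages arises from the cost over \<open>n\<close> stages by one
  application of the Bellman operator with the action of the policy, and the limit passes through
  the operator by monotone convergence.
\<close>
lemma J_lim_stationary:
  assumes \<phi>: "is_markov D (\<lambda>_. \<phi>)" and z: "z \<in> topspace S"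
  shows "J_lim (markov_policy D (\<lambda>_. \<phi>)) z = L (J_lim (markov_policy D (\<lambda>_. \<phi>))) (z, \<phi> z)"
proof -
  have \<phi>m [measurable]: "\<phi> \<in> BS \<rightarrow>\<^sub>M BA" using \<phi> by (simp add: is_markov_def)
  define U where "U = rec_nat (\<lambda>_. 0 :: ennreal) (\<lambda>n u s. L u (s, \<phi> s))"
  have U0: "U 0 = (\<lambda>_. 0)" and US: "U (Suc n) = (\<lambda>s. L (U n) (s, \<phi> s))" for n
    by (simp_all add: U_def)
  have Um: "U n \<in> borel_measurable BS" for n
  proof (induction n)
    case (Suc n)
    note [measurable] = L_measurable[OF Suc]
    show ?case unfolding US by measurable
  qed (simp add: U0)
  have J_U: "J n (markov_policy D (\<lambda>_. \<phi>)) s = U n s" if s: "s \<in> topspace S" for n s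
  proof -
    have "J n (markov_policy D (\<lambda>_. \<phi>)) s = U (n - 0) s"
    proof (rule J_markov(2)[OF \<phi> s, of "\<lambda>k. U (n - k)"])
      fix k s assume "k < n"
      then show "U (n - k) s = L (U (n - Suc k)) (s, \<phi> s)"
        by (simp add: Suc_diff_Suc[symmetric] US del: Suc_diff_Suc)
    qed (auto simp: Um U0)
    then show ?thesis by simp
  qed
  have U_inc: "incseq U"
  proof (rule incseq_SucI)
    show "U n \<le> U (Suc n)" for n
    proof (induction n)
      case (Suc n)
      then show ?case by (auto simp: US[of "Suc n"] US[of n] le_fun_def intro!: L_mono)
    qed (simp add: U0 le_fun_def)
  qed
  have J_lim_U: "J_lim (markov_policy D (\<lambda>_. \<phi>)) s = (SUP n. U n s)" if s: "s \<in> topspace S" for s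
    unfolding J_lim_eq_SUP[OF is_policy_markov_policy[OF \<phi>] s] using J_U[OF s] by simp
  have p: "(z, \<phi> z) \<in> topspace S \<times> topspace A"
    using z measurable_space[OF \<phi>m, of z] by simp
  have "J_lim (markov_policy D (\<lambda>_. \<phi>)) z = (SUP n. U n z)" by (rule J_lim_U[OF z])
  also have "\<dots> = (SUP n. U (Suc n) z)"
  proof (rule SUP_eq)
    have "U n z \<le> U (Suc n) z" for n using incseq_SucD[OF U_inc, of n] by (simp add: le_fun_def)
    then show "\<exists>j\<in>UNIV. U n z \<le> U (Suc j) z" for n by blast
  qed auto
  also have "\<dots> = L (\<lambda>s. SUP n. U n s) (z, \<phi> z)"
    unfolding US by (rule L_SUP[OF p Um U_inc, symmetric])
  also have "\<dots> = L (J_lim (markov_policy D (\<lambda>_. \<phi>))) (z, \<phi> z)"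
    by (rule L_cong[OF p]) (simp add: J_lim_U)
  finally show ?thesis .
qed

lemma exists_optimal_markov:
  "\<exists>\<phi>. is_markov D \<phi> \<and> (\<forall>z\<in>topspace S. J T (markov_policy D \<phi>) z = W T z)"
proof -
  obtain \<psi> where \<psi>: "\<And>n. \<psi> n \<in> BS \<rightarrow>\<^sub>M BA" "\<And>n s. s \<in> topspace S \<Longrightarrow> L (W n) (s, \<psi> n s) = W (Suc n) s"
    using W_greedy by metis
  have m: "is_markov D (\<lambda>n. \<psi> (T - 1 - n))" using \<psi>(1) by (simp add: is_markov_def)
  have "J T (markov_policy D (\<lambda>n. \<psi> (T - 1 - n))) z = W T z" if z: "z \<in> topspace S" for z
  proof (rule J_greedy[OF m z])
    fix s t assume "s \<in> topspace S" "t < T"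
    then have "T - 1 - (T - 1 - t) = t" by auto
    then show "L (W t) (s, \<psi> (T - 1 - (T - 1 - t)) s) = W (Suc t) s"
      using \<psi>(2)[OF \<open>s \<in> topspace S\<close>, of t] by simp
  qed
  with m show ?thesis by blast
qed

lemma exists_optimal_stationary:
  "\<exists>\<phi>. is_markov D (\<lambda>_. \<phi>) \<and> (\<forall>z\<in>topspace S. J_lim (markov_policy D (\<lambda>_. \<phi>)) z = W_lim z)"
proof -
  obtain \<psi> where \<psi>: "\<psi> \<in> BS \<rightarrow>\<^sub>M BA" "\<And>s. s \<in> topspace S \<Longrightarrow> L W_lim (s, \<psi> s) = W_lim s"
    using W_lim_greedy by blast
  have m: "is_markov D (\<lambda>_. \<psi>)" using \<psi>(1) by (simp add: is_markov_def)
  have "J_lim (markov_policy D (\<lambda>_. \<psi>)) z = W_lim z" if "z \<in> topspace S" for z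
    by (rule J_lim_greedy[OF m that \<psi>(2)])
  with m show ?thesis by blast
qed

end

section \<open>Costs bounded below\<close>

text \<open>
  An extended real bounded below by \<open>- c\<close> is written as \<open>enn2ereal x - ereal c\<close> with \<open>x\<close> in
  \<open>[0, \<infinity>]\<close>.
\<close>
lemma shift_le_iff: "enn2ereal x - ereal c \<le> enn2ereal y - ereal c \<longleftrightarrow> x \<le> y"
  by (cases x; cases y) (auto simp: enn2ereal_ennreal top_unique)

lemma shift_eq_iff: "enn2ereal x - ereal c = enn2ereal y - ereal c \<longleftrightarrow> x = y"
  by (auto intro: antisym simp: shift_le_iff[of _ c, symmetric])

lemma shift_eq_infty_iff: "enn2ereal x - ereal c = \<infinity> \<longleftrightarrow> x = top"
  by (cases x) (auto simp: enn2ereal_ennreal)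

lemma shift_le_real_iff: "enn2ereal x - ereal c \<le> ereal l \<longleftrightarrow> 0 \<le> l + c \<and> x \<le> ennreal (l + c)"
  by (cases x) (auto simp: enn2ereal_ennreal top_unique ennreal_le_iff2)

text \<open>
  One step of the Bellman operator, or of a discounted sum, in terms of the shifted quantities: the
  offsets follow the same recursion. For \<open>\<alpha> = 0\<close> the convention \<open>0 * \<infinity> = 0\<close> applies on both sides.
\<close>
lemma shift_add_mult:
  "0 \<le> \<alpha> \<Longrightarrow> (enn2ereal x - ereal b) + ereal \<alpha> * (enn2ereal y - ereal c) =
     enn2ereal (x + ennreal \<alpha> * y) - ereal (b + \<alpha> * c)"
proof (cases x; cases y)
  fix r r' :: real assume "0 \<le> \<alpha>" "0 \<le> r" "x = ennreal r" "0 \<le> r'" "y = ennreal r'"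
  then have "x + ennreal \<alpha> * y = ennreal (r + \<alpha> * r')" by (simp add: ennreal_mult)
  then show ?thesis using \<open>0 \<le> \<alpha>\<close> \<open>0 \<le> r\<close> \<open>x = ennreal r\<close> \<open>0 \<le> r'\<close> \<open>y = ennreal r'\<close>
    by (simp add: enn2ereal_ennreal algebra_simps del: ennreal_plus)
next
  fix r :: real assume *: "0 \<le> \<alpha>" "0 \<le> r" "x = ennreal r" "y = top"
  show ?thesis
  proof (cases "\<alpha> = 0")
    case False
    then have "x + ennreal \<alpha> * y = top" using * by (simp add: ennreal_mult_top)
    then show ?thesis using * False by (simp add: enn2ereal_ennreal)
  qed (use * in \<open>simp add: enn2ereal_ennreal\<close>)
next
  fix r :: real assume *: "0 \<le> \<alpha>" "x = top" "0 \<le> r" "y = ennreal r"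
  then show ?thesis by (simp add: enn2ereal_ennreal)
next
  assume *: "0 \<le> \<alpha>" "x = top" "y = top"
  then show ?thesis by (cases "\<alpha> = 0") auto
qed

text \<open>
  Positive and negative part of \<open>G - c\<close> satisfy \<open>(G - c)\<^sup>+ + c = G + (c - G)\<^sup>+\<close>, and
  \<open>(c - G)\<^sup>+ \<le> c\<close> has a finite integral, which may be subtracted.
\<close>
lemma ereal_integral_shift:
  assumes M: "prob_space M" and G [measurable]: "G \<in> borel_measurable M" and c: "0 \<le> c"
    and f: "\<And>x. x \<in> space M \<Longrightarrow> f x = enn2ereal (G x) - ereal c"
  shows "ereal_integral M f = enn2ereal (\<integral>\<^sup>+x. G x \<partial>M) - ereal c"
proof -
  interpret prob_space M by fact
  have pos: "e2ennreal (f x) = G x - ennreal c" if "x \<in> space M" for x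
    using f[OF that] c by (cases "G x") (auto simp: enn2ereal_ennreal ennreal_minus ennreal.rep_eq[symmetric] e2ennreal_ereal)
  have neg: "e2ennreal (- f x) = ennreal c - G x" if "x \<in> space M" for x
    using f[OF that] c by (cases "G x") (auto simp: enn2ereal_ennreal ennreal_minus e2ennreal_ereal e2ennreal_neg)
  have "(\<integral>\<^sup>+x. e2ennreal (f x) \<partial>M) = (\<integral>\<^sup>+x. G x - ennreal c \<partial>M)"
    by (intro nn_integral_cong pos)
  moreover have "(\<integral>\<^sup>+x. e2ennreal (- f x) \<partial>M) = (\<integral>\<^sup>+x. ennreal c - G x \<partial>M)"
    by (intro nn_integral_cong neg)
  ultimately have int: "ereal_integral M f = enn2ereal (\<integral>\<^sup>+x. G x - ennreal c \<partial>M) - enn2ereal (\<integral>\<^sup>+x. ennreal c - G x \<partial>M)"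
    by (simp add: ereal_integral_def)
  have "(\<integral>\<^sup>+x. G x - ennreal c \<partial>M) + ennreal c = (\<integral>\<^sup>+x. (G x - ennreal c) + ennreal c \<partial>M)"
    by (simp add: nn_integral_add emeasure_space_1)
  also have "\<dots> = (\<integral>\<^sup>+x. G x + (ennreal c - G x) \<partial>M)"
  proof (intro nn_integral_cong)
    fix x
    show "G x - ennreal c + ennreal c = G x + (ennreal c - G x)"
    proof (cases "G x")
      case (real r)
      then show ?thesis
        using c by (cases "c \<le> r") (auto simp: ennreal_minus ennreal_neg ennreal_plus[symmetric] simp del: ennreal_plus)
    qed simp
  qed
  also have "\<dots> = (\<integral>\<^sup>+x. G x \<partial>M) + (\<integral>\<^sup>+x. ennreal c - G x \<partial>M)"
    by (simp add: nn_integral_add)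
  finally have sum: "(\<integral>\<^sup>+x. G x - ennreal c \<partial>M) + ennreal c = (\<integral>\<^sup>+x. G x \<partial>M) + (\<integral>\<^sup>+x. ennreal c - G x \<partial>M)" .
  have "(\<integral>\<^sup>+x. ennreal c - G x \<partial>M) \<le> (\<integral>\<^sup>+x. ennreal c \<partial>M)" by (intro nn_integral_mono) simp
  then have "(\<integral>\<^sup>+x. ennreal c - G x \<partial>M) < top"
    by (simp add: emeasure_space_1 order_le_less_trans)
  with sum show ?thesis
    unfolding int using c
    by (cases "\<integral>\<^sup>+x. G x - ennreal c \<partial>M"; cases "\<integral>\<^sup>+x. G x \<partial>M"; cases "\<integral>\<^sup>+x. ennreal c - G x \<partial>M")
       (auto simp: enn2ereal_ennreal ennreal_plus[symmetric] simp del: ennreal_plus)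
qed

lemma K_inf_compact_shift_iff:
  assumes S: "metrizable_space S" and A: "metrizable_space A"
    and f: "\<And>p. p \<in> topspace S \<times> topspace A \<Longrightarrow> f p = enn2ereal (h p) - ereal b"
  shows "K_inf_compact S A f \<longleftrightarrow> seq_K_inf_compact S A h"
proof -
  have level: "K_compact_level S A (\<lambda>p. f p \<le> ereal l) \<longleftrightarrow> K_compact_level S A (\<lambda>p. h p \<le> ennreal (l + b))"
    if "0 \<le> l + b" for l
    using that by (intro iffI; elim K_compact_level_cong[rotated]) (simp_all add: f shift_le_real_iff)
  show ?thesis
    unfolding K_inf_compact_iff_level[OF S A] seq_K_inf_compact_iff_level
  proof (intro iffI allI impI)
    fix l :: ennreal assume K: "\<forall>l. K_compact_level S A (\<lambda>p. f p \<le> ereal l)" and "l < top"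
    then obtain l' where "l = ennreal l'" "0 \<le> l'" by (cases l) auto
    then show "K_compact_level S A (\<lambda>p. h p \<le> l)" using K level[of "l' - b"] by simp
  next
    fix l :: real assume K: "\<forall>l<top. K_compact_level S A (\<lambda>p. h p \<le> l)"
    show "K_compact_level S A (\<lambda>p. f p \<le> ereal l)"
    proof (cases "0 \<le> l + b")
      case True
      then show ?thesis using K level by simp
    next
      case False
      have "K_compact_level S A (\<lambda>_. False)" by (simp add: K_compact_level_def)
      then show ?thesis
        by (rule K_compact_level_cong[rotated]) (use False in \<open>simp add: f shift_le_real_iff\<close>)
    qed
  qed
qed

lemma eq_shift:
  assumes "- ereal b \<le> x"
  shows "x = enn2ereal (e2ennreal (x + ereal b)) - ereal b"
proof -
  have "0 \<le> x + ereal b" using assms by (cases x) auto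
  then have "enn2ereal (e2ennreal (x + ereal b)) = x + ereal b" by (simp add: enn2ereal_e2ennreal)
  then show ?thesis by (cases x) auto
qed

text \<open>
  Either alternative on cost and discount factor provides a bound: a bound \<open>b > 0\<close> comes with
  \<open>\<alpha> < 1\<close>, and a nonnegative cost allows \<open>b = 0\<close>.
\<close>
locale shifted_mdp =
  fixes D :: "('s, 'a) mdp" and \<alpha> b :: real
  assumes S_met': "metrizable_space (state_space D)" and S_sc': "second_countable (state_space D)"
    and A_met': "metrizable_space (action_space D)" and A_sc': "second_countable (action_space D)"
    and A_ne': "topspace (action_space D) \<noteq> {}"
    and q_cont': "weakly_continuous_kernel (state_space D) (prod_topology (state_space D) (action_space D))
                   (transition D)"
    and cost_K: "K_inf_compact (state_space D) (action_space D) (step_cost D)"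
    and cost_ge: "\<And>s a. s \<in> topspace (state_space D) \<Longrightarrow> a \<in> topspace (action_space D) \<Longrightarrow>
        - ereal b \<le> step_cost D (s, a)"
    and b_nonneg: "0 \<le> b" and \<alpha>_nonneg: "0 \<le> \<alpha>" and discount: "b = 0 \<or> \<alpha> < 1"
begin

definition shifted_cost :: "'s \<times> 'a \<Rightarrow> ennreal" where
  "shifted_cost p = e2ennreal (step_cost D p + ereal b)"

lemma step_cost_eq:
  "p \<in> topspace (state_space D) \<times> topspace (action_space D) \<Longrightarrow>
     step_cost D p = enn2ereal (shifted_cost p) - ereal b"
  unfolding shifted_cost_def by (rule eq_shift) (use cost_ge in auto)

lemma shifted_cost_K: "seq_K_inf_compact (state_space D) (action_space D) shifted_cost"
  using K_inf_compact_shift_iff[OF S_met' A_met', of "step_cost D" shifted_cost b] step_cost_eq cost_K by simp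

sublocale inf_compact_mdp D shifted_cost "ennreal \<alpha>"
  using S_met' S_sc' A_met' A_sc' A_ne' q_cont' shifted_cost_K by unfold_locales

text \<open>
  The total discounted cost of the constant one-stage cost \<open>b\<close> over the horizon \<open>T\<close>.
\<close>
definition offset :: "enat \<Rightarrow> real" where
  "offset T = (case T of enat n \<Rightarrow> (\<Sum>t<n. \<alpha> ^ t * b) | \<infinity> \<Rightarrow> (\<Sum>t. \<alpha> ^ t * b))"

text \<open>
  With horizons in \<^typ>\<open>enat\<close>, the Bellman equation for the step from \<open>T\<close> to \<open>eSuc T\<close> covers the
  finite horizons and, as \<open>eSuc \<infinity> = \<infinity>\<close>, the fixed point equation at once.
\<close>
definition shifted_value :: "enat \<Rightarrow> 's \<Rightarrow> ennreal" where
  "shifted_value T = (case T of enat n \<Rightarrow> W n | \<infinity> \<Rightarrow> W_lim)"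

definition total_cost :: "enat \<Rightarrow> ('s, 'a) policy \<Rightarrow> 's \<Rightarrow> ennreal" where
  "total_cost T = (case T of enat n \<Rightarrow> J n | \<infinity> \<Rightarrow> J_lim)"

lemma offset_summable: "summable (\<lambda>t. \<alpha> ^ t * b)"
  using discount \<alpha>_nonneg by (cases "b = 0") (auto intro!: summable_mult2 summable_geometric)

lemma offset_tendsto: "(\<lambda>n. offset (enat n)) \<longlonglongrightarrow> offset \<infinity>"
  using offset_summable by (simp add: offset_def summable_LIMSEQ)

lemma offset_nonneg: "0 \<le> offset T"
  using \<alpha>_nonneg b_nonneg offset_summable
  by (auto simp: offset_def split: enat.split intro!: sum_nonneg suminf_nonneg)

lemma offset_eSuc: "offset (eSuc T) = b + \<alpha> * offset T"
proof (cases T)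
  case (enat n)
  then show ?thesis
    by (simp add: offset_def eSuc_enat sum.lessThan_Suc_shift sum_distrib_left mult.assoc del: sum.lessThan_Suc)
next
  case infinity
  have "(\<Sum>t. \<alpha> ^ t * b) = \<alpha> ^ 0 * b + (\<Sum>t. \<alpha> ^ Suc t * b)"
    using suminf_split_head[OF offset_summable] by simp
  also have "(\<Sum>t. \<alpha> ^ Suc t * b) = \<alpha> * (\<Sum>t. \<alpha> ^ t * b)"
    using suminf_mult[OF offset_summable, of \<alpha>] by (simp add: mult.assoc)
  finally show ?thesis using infinity by (simp add: offset_def)
qed

lemma partial_sum_cost:
  assumes "\<omega> \<in> space (PiM UNIV (\<lambda>_::nat. BS \<Otimes>\<^sub>M BA))"
  shows "(\<Sum>t<n. ereal (\<alpha> ^ t) * step_cost D (\<omega> t)) = enn2ereal (partial_cost n \<omega>) - ereal (offset (enat n))"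
proof (induction n)
  case (Suc n)
  have p: "\<omega> n \<in> topspace S \<times> topspace A"
    using assms by (auto simp: space_PiM space_pair_measure)
  have pw: "ennreal (\<alpha> ^ n) = ennreal \<alpha> ^ n" using \<alpha>_nonneg by (simp add: ennreal_power)
  show ?case
    using shift_add_mult[of "\<alpha> ^ n" "partial_cost n \<omega>" "offset (enat n)" "shifted_cost (\<omega> n)" b] \<alpha>_nonneg Suc pw
    by (simp add: step_cost_eq[OF p] partial_cost_def offset_def)
qed (simp add: partial_cost_def offset_def zero_ennreal.rep_eq)

text \<open>
  On each trajectory the discounted costs of the first \<open>n\<close> stages differ from their nonnegative
  counterparts by the offset. For the infinite horizon the offsets converge, so the series
  of possibly negative terms converges as well.
\<close>
lemma policy_cost_eq:
  assumes \<delta>: "is_policy D \<delta>" and z: "z \<in> topspace S"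
  shows "policy_cost D \<alpha> T \<delta> z = enn2ereal (total_cost T \<delta> z) - ereal (offset T)"
proof -
  note P = trajectory_law_prob[OF \<delta> z] and sets = sets_trajectory_law[OF \<delta> z]
  have sp: "space (trajectory_law D \<delta> z) = space (PiM UNIV (\<lambda>_::nat. BS \<Otimes>\<^sub>M BA))"
    by (rule sets_eq_imp_space_eq[OF sets])
  have meas: "partial_cost n \<in> borel_measurable (trajectory_law D \<delta> z)" for n
    using partial_cost_measurable[of n UNIV] measurable_cong_sets[OF sets refl] by auto
  show ?thesis
  proof (cases T)
    case (enat n)
    have "policy_cost D \<alpha> T \<delta> z = enn2ereal (\<integral>\<^sup>+\<omega>. partial_cost n \<omega> \<partial>trajectory_law D \<delta> z) - ereal (offset T)"
      unfolding policy_cost_def enat enat.case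
      by (rule ereal_integral_shift[OF P meas offset_nonneg]) (simp add: partial_sum_cost sp)
    then show ?thesis by (simp add: total_cost_def enat J_def)
  next
    case infinity
    let ?G = "\<lambda>\<omega>. \<Sum>t. ennreal \<alpha> ^ t * shifted_cost (\<omega> t)"
    have lim: "(\<lambda>n. partial_cost n \<omega>) \<longlonglongrightarrow> ?G \<omega>" for \<omega>
      unfolding partial_cost_def by (rule summable_LIMSEQ) simp
    have G: "?G \<in> borel_measurable (trajectory_law D \<delta> z)"
    proof -
      have "?G = (\<lambda>\<omega>. SUP n. partial_cost n \<omega>)" by (simp add: suminf_eq_SUP partial_cost_def)
      then show ?thesis using meas by simp
    qed
    have "(\<Sum>t. ereal (\<alpha> ^ t) * step_cost D (\<omega> t)) = enn2ereal (?G \<omega>) - ereal (offset \<infinity>)"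
      if \<omega>: "\<omega> \<in> space (trajectory_law D \<delta> z)" for \<omega>
    proof -
      have "(\<lambda>n. enn2ereal (partial_cost n \<omega>) - ereal (offset (enat n))) \<longlonglongrightarrow>
          enn2ereal (?G \<omega>) - ereal (offset \<infinity>)"
        using lim[of \<omega>] offset_tendsto
        by (intro tendsto_diff_ereal_general) auto
      then have "(\<lambda>t. ereal (\<alpha> ^ t) * step_cost D (\<omega> t)) sums (enn2ereal (?G \<omega>) - ereal (offset \<infinity>))"
        using \<omega> unfolding sp by (simp only: sums_def partial_sum_cost)
      then show ?thesis by (rule sums_unique[symmetric])
    qed
    then have "policy_cost D \<alpha> T \<delta> z = enn2ereal (\<integral>\<^sup>+\<omega>. ?G \<omega> \<partial>trajectory_law D \<delta> z) - ereal (offset T)"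
      unfolding policy_cost_def infinity enat.case
      by (rule ereal_integral_shift[OF P G offset_nonneg])
    then show ?thesis by (simp add: total_cost_def infinity J_lim_def)
  qed
qed

lemma shifted_value_le_total_cost:
  "is_policy D \<delta> \<Longrightarrow> z \<in> topspace S \<Longrightarrow> shifted_value T z \<le> total_cost T \<delta> z"
  by (auto simp: shifted_value_def total_cost_def W_le_J W_lim_le_J_lim split: enat.split)

lemma exists_optimal_policy:
  "\<exists>\<phi>. is_markov D \<phi> \<and> (\<forall>z\<in>topspace S. total_cost T (markov_policy D \<phi>) z = shifted_value T z)"
  using exists_optimal_markov exists_optimal_stationary
  by (cases T) (auto simp: shifted_value_def total_cost_def)

lemma opt_value_eq:
  assumes z: "z \<in> topspace S"
  shows "opt_value D \<alpha> T z = enn2ereal (shifted_value T z) - ereal (offset T)"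
proof (rule antisym)
  obtain \<phi> where \<phi>: "is_markov D \<phi>" "total_cost T (markov_policy D \<phi>) z = shifted_value T z"
    using exists_optimal_policy z by blast
  have "opt_value D \<alpha> T z \<le> policy_cost D \<alpha> T (markov_policy D \<phi>) z"
    unfolding opt_value_def using is_policy_markov_policy[OF \<phi>(1)] by (intro INF_lower) simp
  then show "opt_value D \<alpha> T z \<le> enn2ereal (shifted_value T z) - ereal (offset T)"
    using policy_cost_eq[OF is_policy_markov_policy[OF \<phi>(1)] z] \<phi>(2) by simp
  show "enn2ereal (shifted_value T z) - ereal (offset T) \<le> opt_value D \<alpha> T z"
    unfolding opt_value_def
    using z by (intro INF_greatest) (simp add: policy_cost_eq shift_le_iff shifted_value_le_total_cost)
qed

lemma is_optimal_iff:
  "is_policy D \<delta> \<Longrightarrow> is_optimal D \<alpha> T \<delta> \<longleftrightarrow> (\<forall>z\<in>topspace S. total_cost T \<delta> z = shifted_value T z)"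
  by (simp add: is_optimal_def policy_cost_eq opt_value_eq shift_eq_iff)

lemma shifted_value_lsc: "seq_lsc S (shifted_value T)"
  by (cases T) (simp_all add: shifted_value_def W_lsc W_lim_lsc)

lemma shifted_value_measurable: "shifted_value T \<in> borel_measurable BS"
  by (rule seq_lsc_measurable[OF S_met shifted_value_lsc])

lemma bellman_eq:
  assumes z: "z \<in> topspace S" and a: "a \<in> topspace A"
  shows "bellman D \<alpha> (opt_value D \<alpha> T) z a = enn2ereal (L (shifted_value T) (z, a)) - ereal (offset (eSuc T))"
proof -
  have "q (z, a) \<in> prob_measures S"
    using measurable_space[OF q_measurable, of "(z, a)"] z a by (simp add: space_pair_measure)
  note q = prob_measuresD[OF this]
  have "ereal_integral (q (z, a)) (opt_value D \<alpha> T) = enn2ereal (\<integral>\<^sup>+s. shifted_value T s \<partial>q (z, a)) - ereal (offset T)"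
    by (rule ereal_integral_shift[OF q(3) _ offset_nonneg])
       (use shifted_value_measurable[of T] in \<open>simp_all add: q opt_value_eq measurable_cong_sets[OF q(1) refl]\<close>)
  then show ?thesis
    using z a \<alpha>_nonneg by (simp add: bellman_def step_cost_eq L_def shift_add_mult offset_eSuc)
qed

lemma shifted_value_eSuc_attained:
  assumes z: "z \<in> topspace S"
  shows "\<exists>a\<in>topspace A. L (shifted_value T) (z, a) = shifted_value (eSuc T) z"
    and "a \<in> topspace A \<Longrightarrow> shifted_value (eSuc T) z \<le> L (shifted_value T) (z, a)"
proof -
  show "\<exists>a\<in>topspace A. L (shifted_value T) (z, a) = shifted_value (eSuc T) z"
    using W_Suc_attained[OF z] W_lim_attained[OF z] by (cases T) (simp_all add: shifted_value_def eSuc_enat del: W.simps)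
  show "a \<in> topspace A \<Longrightarrow> shifted_value (eSuc T) z \<le> L (shifted_value T) (z, a)"
    using W_lim_fixed_point[OF z] by (cases T) (auto simp: shifted_value_def eSuc_enat intro: INF_lower)
qed

lemma opt_actions_eq:
  assumes z: "z \<in> topspace S"
  shows "opt_actions D \<alpha> T z = {a \<in> topspace A. L (shifted_value T) (z, a) = shifted_value (eSuc T) z}"
  unfolding opt_actions_def using z
  by (auto simp: opt_value_eq bellman_eq shift_eq_iff)

lemma optimality:
  assumes z: "z \<in> topspace S"
  shows "is_min (topspace A) (bellman D \<alpha> (opt_value D \<alpha> T) z) (opt_value D \<alpha> (eSuc T) z)"
    and "opt_actions D \<alpha> T z \<noteq> {}"
    and "opt_value D \<alpha> (eSuc T) z = \<infinity> \<Longrightarrow> opt_actions D \<alpha> T z = topspace A"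
    and "opt_value D \<alpha> (eSuc T) z < \<infinity> \<Longrightarrow> compactin A (opt_actions D \<alpha> T z)"
proof -
  note att = shifted_value_eSuc_attained[OF z, where T=T]
  show "is_min (topspace A) (bellman D \<alpha> (opt_value D \<alpha> T) z) (opt_value D \<alpha> (eSuc T) z)"
    using att z by (auto simp: is_min_def bellman_eq opt_value_eq shift_eq_iff shift_le_iff)
  show "opt_actions D \<alpha> T z \<noteq> {}" using att by (auto simp: opt_actions_eq[OF z])
  show "opt_actions D \<alpha> T z = topspace A" if "opt_value D \<alpha> (eSuc T) z = \<infinity>"
    using that att(2) z by (auto simp: opt_actions_eq opt_value_eq shift_eq_infty_iff top_unique)
  assume "opt_value D \<alpha> (eSuc T) z < \<infinity>"
  then have fin: "shifted_value (eSuc T) z < top" using z by (simp add: opt_value_eq shift_eq_infty_iff less_top)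
  have "opt_actions D \<alpha> T z = {a \<in> topspace A. L (shifted_value T) (z, a) \<le> shifted_value (eSuc T) z}"
    using att(2) by (auto simp: opt_actions_eq[OF z] intro: antisym)
  then show "compactin A (opt_actions D \<alpha> T z)"
    using compactin_sublevel_section[OF A_met L_K[OF shifted_value_lsc] z fin] by simp
qed

lemma opt_actions_graph:
  "{(z, a). z \<in> topspace S \<and> a \<in> opt_actions D \<alpha> T z} \<in> sets (borel_of (prod_topology S A))"
proof -
  note [measurable] = shifted_value_measurable L_measurable[OF shifted_value_measurable]
  have "{(z, a). z \<in> topspace S \<and> a \<in> opt_actions D \<alpha> T z} =
      {p \<in> space (BS \<Otimes>\<^sub>M BA). L (shifted_value T) p = shifted_value (eSuc T) (fst p)}"
    by (auto simp: opt_actions_eq space_pair_measure)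
  also have "\<dots> \<in> sets (BS \<Otimes>\<^sub>M BA)" by measurable
  finally show ?thesis by (simp only: sets_SA)
qed

lemma property_O1: "property_O1 D \<alpha>"
  unfolding property_O1_def
proof (intro conjI allI ballI)
  have lsc: "lower_semicontinuous S (opt_value D \<alpha> T)" for T
    unfolding lower_semicontinuous_def
  proof
    fix l
    \<comment> \<open>for a level below \<open>- offset T\<close> the set is the whole space; otherwise
      the level corresponds to one of the shifted function\<close>
    have iff: "l < enn2ereal x - ereal (offset T) \<longleftrightarrow> l + ereal (offset T) < 0 \<or> e2ennreal (l + ereal (offset T)) < x" for x
    proof (cases "l + ereal (offset T) < 0")
      case True
      then show ?thesis using enn2ereal_nonneg[of x] by (cases l; cases x) (auto simp: enn2ereal_ennreal)
    next
      case False
      then show ?thesis by (cases l; cases x) (auto simp: enn2ereal_ennreal e2ennreal_ereal ennreal_less_iff)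
    qed
    have "{s \<in> topspace S. l < opt_value D \<alpha> T s} =
        (if l + ereal (offset T) < 0 then topspace S else {s \<in> topspace S. e2ennreal (l + ereal (offset T)) < shifted_value T s})"
      by (auto simp: opt_value_eq iff)
    then show "openin S {s \<in> topspace S. l < opt_value D \<alpha> T s}"
      using seq_lsc_openin[OF S_met shifted_value_lsc] by simp
  qed
  show "lower_semicontinuous S (opt_value D \<alpha> (enat t))" "lower_semicontinuous S (opt_value D \<alpha> \<infinity>)" for t
    by (rule lsc)+
  fix z assume z: "z \<in> topspace S"
  have "(\<lambda>n. W n z) \<longlonglongrightarrow> W_lim z"
    unfolding W_lim_def using incseq_W by (intro LIMSEQ_SUP) (auto simp: incseq_def le_fun_def)
  then have "(\<lambda>n. enn2ereal (W n z) - ereal (offset (enat n))) \<longlonglongrightarrow> enn2ereal (W_lim z) - ereal (offset \<infinity>)"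
    using offset_tendsto by (intro tendsto_diff_ereal_general) auto
  then show "(\<lambda>t. opt_value D \<alpha> (enat t) z) \<longlonglongrightarrow> opt_value D \<alpha> \<infinity> z"
    using z by (simp add: opt_value_eq shifted_value_def)
qed

lemma property_O3: "property_O3 D \<alpha>"
  unfolding property_O3_def
proof (intro allI impI conjI)
  fix T :: nat
  show "\<exists>\<phi>. is_markov D \<phi> \<and> is_optimal D \<alpha> (enat T) (markov_policy D \<phi>)"
    using exists_optimal_policy[of "enat T"] is_optimal_iff is_policy_markov_policy by blast
  fix \<phi> assume *: "is_markov D \<phi> \<and> (\<forall>z\<in>topspace S. \<forall>t<T. \<phi> (T - 1 - t) z \<in> opt_actions D \<alpha> (enat t) z)"
  then have "L (W t) (s, \<phi> (T - 1 - t) s) = W (Suc t) s" if "s \<in> topspace S" "t < T" for s t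
    using that opt_actions_eq[OF that(1), of "enat t"] by (auto simp: shifted_value_def eSuc_enat simp del: W.simps)
  with * show "is_optimal D \<alpha> (enat T) (markov_policy D \<phi>)"
    by (simp add: is_optimal_iff is_policy_markov_policy total_cost_def shifted_value_def J_greedy)
qed

text \<open>
  The cost \<open>J_lim\<close> of a stationary policy satisfies \<open>J_lim = L J_lim\<close> along the policy. If the policy
  is optimal, \<open>J_lim\<close> is \<open>W_lim\<close>, so its actions attain the minimum in the Bellman equation.
\<close>
lemma property_O5: "property_O5 D \<alpha>"
  unfolding property_O5_def
proof (intro conjI allI impI)
  show "\<exists>\<phi>. is_markov D (\<lambda>_. \<phi>) \<and> is_optimal D \<alpha> \<infinity> (markov_policy D (\<lambda>_. \<phi>))"
    using exists_optimal_stationary is_optimal_iff[of _ "\<infinity>"] is_policy_markov_policy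
    by (simp add: total_cost_def shifted_value_def) blast
  fix \<phi> assume \<phi>: "is_markov D (\<lambda>_. \<phi>)"
  let ?\<delta> = "markov_policy D (\<lambda>_. \<phi>)"
  have \<phi>A: "\<phi> z \<in> topspace A" if "z \<in> topspace S" for z
    using \<phi> measurable_space[of \<phi> BS BA z] that by (simp add: is_markov_def)
  have "is_optimal D \<alpha> \<infinity> ?\<delta> \<longleftrightarrow> (\<forall>z\<in>topspace S. J_lim ?\<delta> z = W_lim z)"
    using is_optimal_iff[OF is_policy_markov_policy[OF \<phi>], of "\<infinity>"] by (simp add: total_cost_def shifted_value_def)
  also have "\<dots> \<longleftrightarrow> (\<forall>z\<in>topspace S. L W_lim (z, \<phi> z) = W_lim z)"
  proof
    assume opt: "\<forall>z\<in>topspace S. J_lim ?\<delta> z = W_lim z"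
    show "\<forall>z\<in>topspace S. L W_lim (z, \<phi> z) = W_lim z"
    proof
      fix z assume z: "z \<in> topspace S"
      have "L (J_lim ?\<delta>) (z, \<phi> z) = L W_lim (z, \<phi> z)"
        using opt z \<phi>A by (intro L_cong) auto
      then show "L W_lim (z, \<phi> z) = W_lim z"
        using J_lim_stationary[OF \<phi> z] opt z by simp
    qed
  qed (use J_lim_greedy[OF \<phi>] in blast)
  also have "\<dots> \<longleftrightarrow> (\<forall>z\<in>topspace S. \<phi> z \<in> opt_actions D \<alpha> \<infinity> z)"
    using \<phi>A by (simp add: opt_actions_eq shifted_value_def)
  finally show "is_optimal D \<alpha> \<infinity> ?\<delta> \<longleftrightarrow> (\<forall>z\<in>topspace S. \<phi> z \<in> opt_actions D \<alpha> \<infinity> z)" .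
qed

lemma property_O6: "property_O6 D \<alpha>"
  unfolding property_O6_def
proof (intro impI)
  assume ic: "inf_compact (prod_topology S A) (step_cost D)"
  have g: "compactin (prod_topology S A) {p \<in> topspace (prod_topology S A). shifted_cost p \<le> l}" if "l < top" for l
  proof -
    from that obtain l' where l': "l = ennreal l'" "0 \<le> l'" by (cases l) auto
    have "{p \<in> topspace (prod_topology S A). shifted_cost p \<le> l} =
        {p \<in> topspace (prod_topology S A). step_cost D p \<le> ereal (l' - b)}"
      using l' by (intro Collect_cong conj_cong refl) (simp add: step_cost_eq shift_le_real_iff)
    then show ?thesis using ic by (simp add: inf_compact_def)
  qed
  have "inf_compact S (opt_value D \<alpha> (eSuc T))" for T
    unfolding inf_compact_def
  proof
    fix l
    show "compactin S {s \<in> topspace S. opt_value D \<alpha> (eSuc T) s \<le> ereal l}"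
    proof (cases "0 \<le> l + offset (eSuc T)")
      case True
      then have "{s \<in> topspace S. opt_value D \<alpha> (eSuc T) s \<le> ereal l} =
          {s \<in> topspace S. shifted_value (eSuc T) s \<le> ennreal (l + offset (eSuc T))}"
        by (auto simp: opt_value_eq shift_le_real_iff)
      then show ?thesis
        using compactin_sublevel_values[OF g shifted_value_lsc shifted_value_lsc _ shifted_value_eSuc_attained(1)] by simp
    next
      case False
      then have "{s \<in> topspace S. opt_value D \<alpha> (eSuc T) s \<le> ereal l} = {}"
        by (auto simp: opt_value_eq shift_le_real_iff)
      then show ?thesis by (simp only: compactin_empty)
    qed
  qed
  from this[of "\<infinity>"] this[of "enat _"]
  show "(\<forall>t\<ge>1. inf_compact S (opt_value D \<alpha> (enat t))) \<and> inf_compact S (opt_value D \<alpha> \<infinity>)"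
    by (auto simp: eSuc_enat Suc_le_eq gr0_conv_Suc)
qed

end

section \<open>Integrals of the cost, and convergence of kernels\<close>

text \<open>
  If no subsequence of \<open>as\<close> converged, then \<open>k (\<sigma> n, as n) \<rightarrow> \<infinity>\<close> along every convergent sequence \<open>\<sigma>\<close> of
  states, for otherwise a bounded subsequence of costs would make the actions accumulate. Fatou's
  lemma with the constant limit integrand \<open>\<infinity>\<close> then contradicts the bound on the integrals. Along a
  convergent subsequence Fatou's lemma applies once more, to the lower semicontinuous \<open>k\<close>.
\<close>
lemma nn_integral_seq_K_inf_compact:
  assumes S: "metrizable_space S" "second_countable S" and A: "metrizable_space A"
    and k: "seq_K_inf_compact S A k"
  shows "seq_K_inf_compact (weak_topology S) A (\<lambda>(z, a). \<integral>\<^sup>+x. k (x, a) \<partial>z)"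
  unfolding seq_K_inf_compact_def prod.case
proof (intro allI impI)
  fix zs z as l
  assume zs: "range zs \<subseteq> topspace (weak_topology S)" and z: "limitin (weak_topology S) zs z sequentially"
    and as: "range as \<subseteq> topspace A" and l: "l < top" and le: "\<forall>n. (\<integral>\<^sup>+x. k (x, as n) \<partial>zs n) \<le> l"
  have zsP: "zs n \<in> prob_measures S" for n using zs by auto
  have zP: "z \<in> prob_measures S" using limitin_topspace[OF z] by simp
  have conv: "converges_weakly S zs z"
    using z zs zP limitin_weak_topology[of zs S z] by simp
  have "\<exists>r a. strict_mono (r::nat \<Rightarrow> nat) \<and> limitin A (as \<circ> r) a sequentially"
  proof (rule ccontr)
    assume none: "\<not> ?thesis"
    have "top \<le> liminf (\<lambda>n. k (\<sigma> n, as n))"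
      if \<sigma>: "range \<sigma> \<subseteq> topspace S" "limitin S \<sigma> x sequentially" for \<sigma> x
    proof (rule ccontr)
      assume "\<not> top \<le> liminf (\<lambda>n. k (\<sigma> n, as n))"
      then have "liminf (\<lambda>n. k (\<sigma> n, as n)) < top" by (simp only: not_le)
      then obtain l' where l': "liminf (\<lambda>n. k (\<sigma> n, as n)) < l'" "l' < top" using dense by blast
      from liminf_less_imp_subseq[OF l'(1)] obtain r :: "nat \<Rightarrow> nat"
        where r: "strict_mono r" "\<And>n. k (\<sigma> (r n), as (r n)) \<le> l'" by blast
      have "range (\<sigma> \<circ> r) \<subseteq> topspace S" "range (as \<circ> r) \<subseteq> topspace A"
        "\<And>n. k ((\<sigma> \<circ> r) n, (as \<circ> r) n) \<le> l'"
        using \<sigma>(1) as r(2) by auto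
      from seq_K_inf_compactD[OF k this(1) limitin_subsequence[OF r(1) \<sigma>(2)] this(2) l'(2) this(3)]
      obtain r' a where "strict_mono (r'::nat \<Rightarrow> nat)" "limitin A (as \<circ> r \<circ> r') a sequentially"
        by blast
      then show False using none strict_mono_o[OF r(1), of r'] unfolding comp_assoc by blast
    qed
    then have "(\<integral>\<^sup>+x. top \<partial>z) \<le> liminf (\<lambda>n. \<integral>\<^sup>+x. k (x, as n) \<partial>zs n)"
      by (rule fatou_weak_convergence[OF S(1) conv zsP zP])
    also have "\<dots> \<le> l" using le by (intro Liminf_le) auto
    finally show False
      using l prob_space.emeasure_space_1[OF prob_measuresD(3)[OF zP]] by (simp add: top_unique)
  qed
  then obtain r a where r: "strict_mono (r::nat \<Rightarrow> nat)" and a: "limitin A (as \<circ> r) a sequentially" by blast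
  have conv_r: "converges_weakly S (\<lambda>n. zs (r n)) z"
    using conv r unfolding converges_weakly_def by (auto intro: LIMSEQ_subseq_LIMSEQ[unfolded comp_def])
  have "(\<integral>\<^sup>+x. k (x, a) \<partial>z) \<le> liminf (\<lambda>n. \<integral>\<^sup>+x. k (x, as (r n)) \<partial>zs (r n))"
  proof (rule fatou_weak_convergence[OF S(1) conv_r zsP zP])
    fix \<sigma> x assume \<sigma>: "range \<sigma> \<subseteq> topspace S" "limitin S \<sigma> x sequentially"
    show "k (x, a) \<le> liminf (\<lambda>n. k (\<sigma> n, as (r n)))"
      using seq_lscD[OF seq_K_inf_compact_imp_lsc[OF A k], of "\<lambda>n. (\<sigma> n, as (r n))" "(x, a)"] \<sigma> as a
      by (auto simp: limitin_pairwise comp_def image_subset_iff)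
  qed
  also have "\<dots> \<le> l" using le by (intro Liminf_le) auto
  finally show "\<exists>r a. strict_mono (r::nat \<Rightarrow> nat) \<and> limitin A (as \<circ> r) a sequentially \<and> (\<integral>\<^sup>+x. k (x, a) \<partial>z) \<le> l"
    using r a by blast
qed

text \<open>
  Applied to \<open>f + B\<close> and to \<open>B - f\<close>, the lower bounds give both halves of the convergence of the
  integrals of \<open>f\<close>.
\<close>
lemma converges_weakly_lscI:
  assumes \<mu>s: "\<And>n. \<mu>s n \<in> prob_measures S" and \<mu>: "\<mu> \<in> prob_measures S"
    and le: "\<And>f. bounded_continuous S f \<Longrightarrow> (\<And>x. x \<in> topspace S \<Longrightarrow> 0 \<le> f x) \<Longrightarrow>
        (\<integral>\<^sup>+x. ennreal (f x) \<partial>\<mu>) \<le> liminf (\<lambda>n. \<integral>\<^sup>+x. ennreal (f x) \<partial>\<mu>s n)"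
  shows "converges_weakly S \<mu>s \<mu>"
proof -
  have lower: "\<forall>\<^sub>F n in sequentially. t < (\<integral>x. f x \<partial>\<mu>s n)"
    if f: "bounded_continuous S f" and t: "t < (\<integral>x. f x \<partial>\<mu>)" for f t
  proof -
    from f obtain B0 where B0: "\<And>x. x \<in> topspace S \<Longrightarrow> \<bar>f x\<bar> \<le> B0" by (auto simp: bounded_continuous_def bounded_iff)
    \<comment> \<open>\<open>B \<ge> - t\<close> makes the level \<open>t + B\<close> nonnegative as well\<close>
    define B where "B = max B0 (- t)"
    have B: "\<bar>f x\<bar> \<le> B" if "x \<in> topspace S" for x using B0[OF that] by (simp add: B_def)
    note f' = bounded_continuous_shift[OF f, of B]
    have nn: "0 \<le> f x + B" if "x \<in> topspace S" for x using B[OF that] by (simp add: abs_le_iff)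
    have int: "(\<integral>\<^sup>+x. ennreal (f x + B) \<partial>\<nu>) = ennreal ((\<integral>x. f x \<partial>\<nu>) + B)" if \<nu>: "\<nu> \<in> prob_measures S" for \<nu>
      by (simp add: nn_integral_bounded_continuous[OF f' nn \<nu>] integral_shift[OF f \<nu>])
    have "ennreal (t + B) < ennreal ((\<integral>x. f x \<partial>\<mu>) + B)"
      using t by (intro ennreal_lessI) (auto simp: B_def)
    also have "\<dots> \<le> liminf (\<lambda>n. ennreal ((\<integral>x. f x \<partial>\<mu>s n) + B))"
      using le[OF f' nn] by (simp add: int \<mu> \<mu>s)
    finally have "\<forall>\<^sub>F n in sequentially. ennreal (t + B) < ennreal ((\<integral>x. f x \<partial>\<mu>s n) + B)"
      by (rule less_LiminfD)
    then show ?thesis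
      by eventually_elim (auto simp: ennreal_less_iff B_def)
  qed
  show ?thesis
    unfolding converges_weakly_def
  proof (intro allI impI order_tendstoI)
    fix f t assume f: "bounded_continuous S f"
    show "\<forall>\<^sub>F n in sequentially. t < (\<integral>x. f x \<partial>\<mu>s n)" if "t < (\<integral>x. f x \<partial>\<mu>)"
      by (rule lower[OF f that])
    show "\<forall>\<^sub>F n in sequentially. (\<integral>x. f x \<partial>\<mu>s n) < t" if "(\<integral>x. f x \<partial>\<mu>) < t"
      using lower[OF bounded_continuous_uminus[OF f], of "- t"] that by simp
  qed
qed

lemma weakly_continuous_kernel_lscI:
  assumes S1: "metrizable_space S1" and S2: "metrizable_space S2"
    and T: "\<And>s. s \<in> topspace S2 \<Longrightarrow> T s \<in> prob_measures S1"
    and lsc: "\<And>f. bounded_continuous S1 f \<Longrightarrow> (\<And>x. x \<in> topspace S1 \<Longrightarrow> 0 \<le> f x) \<Longrightarrow>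
        seq_lsc S2 (\<lambda>s. \<integral>\<^sup>+x. ennreal (f x) \<partial>T s)"
  shows "weakly_continuous_kernel S1 S2 T"
proof (rule weakly_continuous_kernelI[OF S1 S2 T])
  fix \<sigma> s assume \<sigma>: "range \<sigma> \<subseteq> topspace S2" "limitin S2 \<sigma> s sequentially"
  show "converges_weakly S1 (\<lambda>n. T (\<sigma> n)) (T s)"
  proof (rule converges_weakly_lscI)
    show "T (\<sigma> n) \<in> prob_measures S1" for n using \<sigma>(1) by (intro T) auto
    show "T s \<in> prob_measures S1" using limitin_topspace[OF \<sigma>(2)] by (rule T)
    fix f assume f: "bounded_continuous S1 f" "\<And>x. x \<in> topspace S1 \<Longrightarrow> 0 \<le> f x"
    show "(\<integral>\<^sup>+x. ennreal (f x) \<partial>T s) \<le> liminf (\<lambda>n. \<integral>\<^sup>+x. ennreal (f x) \<partial>T (\<sigma> n))"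
      by (rule seq_lscD[OF lsc[OF f] \<sigma>])
  qed
qed

lemma weakly_continuous_kernel_compose:
  assumes T: "weakly_continuous_kernel S1 S2 T" and h: "continuous_map S3 S2 h"
  shows "weakly_continuous_kernel S1 S3 (\<lambda>s. T (h s))"
  unfolding weakly_continuous_kernel_def
proof (intro conjI allI impI; (elim conjE)?)
  show "stochastic_kernel (borel_of S1) (borel_of S3) (\<lambda>s. T (h s))"
    using T measurable_compose[OF continuous_map_borel_of_measurable[OF h]]
    by (auto simp: weakly_continuous_kernel_def stochastic_kernel_iff)
  fix \<sigma> s assume \<sigma>: "range \<sigma> \<subseteq> topspace S3" "limitin S3 \<sigma> s sequentially"
  have "range (h \<circ> \<sigma>) \<subseteq> topspace S2" using \<sigma>(1) h by (auto simp: continuous_map_def)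
  moreover have "limitin S2 (h \<circ> \<sigma>) (h s) sequentially" by (rule continuous_map_limit[OF h \<sigma>(2)])
  ultimately show "converges_weakly S1 (\<lambda>n. T (h (\<sigma> n))) (T (h s))"
    using T by (fastforce simp: weakly_continuous_kernel_def comp_def)
qed

text \<open>
  The truncated infima \<open>min (inf {f n x | n \<ge> N}) N\<close> are bounded Borel functions, on which setwise
  convergence acts, and increase to \<open>liminf (f n x)\<close>. Unlike in \<open>fatou_weak_convergence\<close> the point \<open>x\<close> stays
  fixed, and the pointwise bound may fail on a null set.
\<close>
lemma fatou_setwise_convergence:
  fixes F :: "'a \<Rightarrow> ennreal"
  assumes conv: "converges_setwise S \<mu>s \<mu>"
    and \<mu>s: "\<And>n. \<mu>s n \<in> prob_measures S" and \<mu>: "\<mu> \<in> prob_measures S"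
    and f [measurable]: "\<And>n. f n \<in> borel_measurable (borel_of S)"
    and F: "AE x in \<mu>. F x \<le> liminf (\<lambda>n. f n x)"
  shows "(\<integral>\<^sup>+x. F x \<partial>\<mu>) \<le> liminf (\<lambda>n. \<integral>\<^sup>+x. f n x \<partial>\<mu>s n)"
proof -
  define g where "g N x = min (INF n\<in>{N..}. f n x) (of_nat N)" for N x
  have g [measurable]: "g N \<in> borel_measurable (borel_of S)" for N
    unfolding g_def by measurable
  have g_le: "g N x \<le> f n x" if "N \<le> n" for N n x
    unfolding g_def using that by (intro min.coboundedI1 INF_lower) auto
  have g_bd: "g N x \<le> of_nat N" for N x by (simp add: g_def)
  define h where "h N x = enn2real (g N x)" for N x
  have gh: "g N x = ennreal (h N x)" for N x
  proof -
    have "g N x < top" using g_bd[of N x] by (rule le_less_trans) (simp add: ennreal_of_nat_eq_real_of_nat)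
    then show ?thesis by (simp add: h_def)
  qed
  have h_nn: "0 \<le> h N x" for N x by (simp add: h_def)
  have h_bd: "h N x \<le> real N" for N x
    using g_bd[of N x] unfolding h_def by (intro enn2real_leI) (simp_all add: ennreal_of_nat_eq_real_of_nat)
  have h_meas [measurable]: "h N \<in> borel_measurable (borel_of S)" for N
    unfolding h_def by measurable
  have int: "(\<integral>\<^sup>+x. g N x \<partial>\<nu>) = ennreal (\<integral>x. h N x \<partial>\<nu>)" if \<nu>: "\<nu> \<in> prob_measures S" for N \<nu>
  proof -
    interpret prob_space \<nu> using prob_measuresD(3)[OF \<nu>] .
    have "h N \<in> borel_measurable \<nu>"
      by (subst measurable_cong_sets[OF prob_measuresD(1)[OF \<nu>] refl]) (rule h_meas)
    then have "integrable \<nu> (h N)"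
      using h_nn h_bd by (intro integrable_const_bound[where B="real N"]) auto
    then show ?thesis unfolding gh by (intro nn_integral_eq_integral) (auto simp: h_nn)
  qed
  have sup: "liminf (\<lambda>n. f n x) \<le> (SUP N. g N x)" for x
  proof (rule ccontr)
    assume "\<not> ?thesis"
    then have "(SUP N. g N x) < liminf (\<lambda>n. f n x)" by (simp only: not_le)
    then obtain t where t: "(SUP N. g N x) < t" "t < liminf (\<lambda>n. f n x)" using dense by blast
    then have "t < top" using less_le_trans[OF t(2) top_greatest] by simp
    then obtain m :: nat where m: "t \<le> of_nat m"
    proof (cases t)
      case (real r)
      obtain m where "r \<le> real m" using real_arch_simple by blast
      with real that show ?thesis by (simp add: ennreal_of_nat_eq_real_of_nat ennreal_leI)
    qed auto
    from less_LiminfD[OF t(2)] obtain N where N: "\<And>n. n \<ge> N \<Longrightarrow> t < f n x" by (auto simp: eventually_sequentially)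
    have "t \<le> g (max N m) x"
      unfolding g_def
    proof (intro min.boundedI INF_greatest)
      show "t \<le> of_nat (max N m)" using m by (rule order_trans) simp
    qed (use N in \<open>auto intro: less_imp_le\<close>)
    also have "\<dots> \<le> (SUP N. g N x)" by (rule SUP_upper) simp
    finally show False using t(1) by simp
  qed
  show ?thesis
  proof (rule fatou_of_approximation)
    have "bounded (h N ` topspace S)" for N
      using h_nn h_bd by (auto simp: bounded_iff intro!: exI[of _ "real N"])
    then have "(\<lambda>n. \<integral>x. h N x \<partial>\<mu>s n) \<longlonglongrightarrow> (\<integral>x. h N x \<partial>\<mu>)" for N
      using conv h_meas[of N] by (simp add: converges_setwise_def)
    then show "(\<lambda>n. \<integral>\<^sup>+x. g N x \<partial>\<mu>s n) \<longlonglongrightarrow> (\<integral>\<^sup>+x. g N x \<partial>\<mu>)" for N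
      by (simp add: int \<mu> \<mu>s tendsto_ennrealI)
    show "incseq g"
      unfolding incseq_def le_fun_def g_def
      by (intro allI impI min.mono INF_superset_mono) auto
    show "g N \<in> borel_measurable \<mu>" for N
      by (subst measurable_cong_sets[OF prob_measuresD(1)[OF \<mu>] refl]) (rule g)
    show "AE x in \<mu>. F x \<le> (SUP N. g N x)"
      using F by (rule eventually_mono) (rule order_trans[OF _ sup])
  qed (rule g_le)
qed

text \<open>
  For each fixed \<open>B\<close> the functions \<open>y \<mapsto> H1 y B\<close> and \<open>y \<mapsto> H2 y B\<close> are densities of the same measure
  and agree almost everywhere. A countable generating family of sets that is closed under
  intersections collects the exceptional sets into one null set.
\<close>
lemma AE_eq_of_emeasure_eq:
  assumes S: "second_countable S" and R: "prob_space R"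
    and H1: "H1 \<in> R \<rightarrow>\<^sub>M prob_algebra (borel_of S)" and H2: "H2 \<in> R \<rightarrow>\<^sub>M prob_algebra (borel_of S)"
    and eq: "\<And>B C. B \<in> sets (borel_of S) \<Longrightarrow> C \<in> sets R \<Longrightarrow>
        (\<integral>\<^sup>+y\<in>C. emeasure (H1 y) B \<partial>R) = (\<integral>\<^sup>+y\<in>C. emeasure (H2 y) B \<partial>R)"
  shows "AE y in R. H1 y = H2 y"
proof -
  interpret prob_space R by fact
  from S obtain B where B: "countable B" "\<forall>V\<in>B. openin S V"
    "\<forall>U x. openin S U \<and> x \<in> U \<longrightarrow> (\<exists>V\<in>B. x \<in> V \<and> V \<subseteq> U)"
    unfolding second_countable_def by blast
  define G where "G = (\<lambda>K. topspace S \<inter> \<Inter>K) ` {K. finite K \<and> K \<subseteq> B}"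
  have cG: "countable G" unfolding G_def by (intro countable_image countable_Collect_finite_subset B(1))
  have stable: "Int_stable G"
  proof (rule Int_stableI)
    fix a b assume "a \<in> G" "b \<in> G"
    then obtain K K' where "finite K" "K \<subseteq> B" "a = topspace S \<inter> \<Inter>K" "finite K'" "K' \<subseteq> B" "b = topspace S \<inter> \<Inter>K'"
      by (auto simp: G_def)
    then have "a \<inter> b = topspace S \<inter> \<Inter>(K \<union> K')" "finite (K \<union> K')" "K \<union> K' \<subseteq> B" by auto
    then show "a \<inter> b \<in> G" unfolding G_def by blast
  qed
  have G_open: "openin S U" if "U \<in> G" for U
  proof -
    from that obtain K where K: "finite K" "K \<subseteq> B" "U = topspace S \<inter> \<Inter>K" by (auto simp: G_def)
    have "openin S (topspace S \<inter> \<Inter>K)"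
      using K(1,2)
    proof (induction K)
      case (insert V K)
      have "topspace S \<inter> \<Inter>(insert V K) = V \<inter> (topspace S \<inter> \<Inter>K)" by auto
      then show ?case using insert B(2) by (simp add: openin_Int)
    qed simp
    then show ?thesis using K(3) by simp
  qed
  have BG: "V \<in> G" if "V \<in> B" for V
  proof -
    have "V = topspace S \<inter> \<Inter>{V}" using that B(2) openin_subset by auto
    then show ?thesis unfolding G_def using that by (intro image_eqI[of _ _ "{V}"]) auto
  qed
  have topG: "topspace S \<in> G" unfolding G_def by (intro image_eqI[of _ _ "{}"]) auto
  have gen: "sets (borel_of S) = sigma_sets (topspace S) G"
  proof
    show "sigma_sets (topspace S) G \<subseteq> sets (borel_of S)"
      unfolding sets_borel_of by (rule sigma_sets_mono') (use G_open in auto)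
    have "U \<in> sigma_sets (topspace S) G" if U: "openin S U" for U
    proof -
      have "U = \<Union>{V\<in>B. V \<subseteq> U}" using B(3) U by blast
      moreover have "\<Union>{V\<in>B. V \<subseteq> U} \<in> sigma_sets (topspace S) G"
        by (rule sigma_sets_UNION) (use B(1) BG in \<open>auto intro: sigma_sets.Basic countable_subset[OF _ B(1)]\<close>)
      ultimately show ?thesis by simp
    qed
    then show "sets (borel_of S) \<subseteq> sigma_sets (topspace S) G"
      unfolding sets_borel_of by (intro sigma_sets_mono) auto
  qed
  have "AE y in R. emeasure (H1 y) U = emeasure (H2 y) U" if "U \<in> G" for U
  proof (rule density_unique2)
    have U: "U \<in> sets (borel_of S)" using G_open[OF that] by (rule openin_sets_borel_of)
    show "(\<lambda>y. emeasure (H1 y) U) \<in> borel_measurable R" "(\<lambda>y. emeasure (H2 y) U) \<in> borel_measurable R"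
      using measurable_emeasure_kernel[OF measurable_prob_algebraD[OF H1] U]
        measurable_emeasure_kernel[OF measurable_prob_algebraD[OF H2] U] by auto
    show "(\<integral>\<^sup>+y\<in>C. emeasure (H1 y) U \<partial>R) = (\<integral>\<^sup>+y\<in>C. emeasure (H2 y) U \<partial>R)" if "C \<in> sets R" for C
      by (rule eq[OF U that])
  qed
  then have "AE y in R. \<forall>U\<in>G. emeasure (H1 y) U = emeasure (H2 y) U"
    using cG by (intro AE_ball_countable') auto
  then show ?thesis
    using AE_space
  proof eventually_elim
    case (elim y)
    note P1 = prob_measuresD[OF measurable_space[OF H1 elim(2)]]
    note P2 = prob_measuresD[OF measurable_space[OF H2 elim(2)]]
    show ?case
    proof (rule measure_eqI_generator_eq[OF stable, where A="\<lambda>_. topspace S"])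
      show "G \<subseteq> Pow (topspace S)" by (auto simp: G_def)
      show "sets (H1 y) = sigma_sets (topspace S) G" "sets (H2 y) = sigma_sets (topspace S) G"
        using P1(1) P2(1) gen by simp_all
      show "range (\<lambda>_::nat. topspace S) \<subseteq> G" using topG by auto
      show "emeasure (H1 y) (topspace S) \<noteq> \<infinity>"
        using prob_space.emeasure_space_1[OF P1(3)] P1(2) by simp
    qed (use elim(1) in auto)
  qed
qed

section \<open>The belief process\<close>

lemma continuous_map_fstI:
  "continuous_map Z (prod_topology S T) f \<Longrightarrow> continuous_map Z S (\<lambda>x. fst (f x))"
  using continuous_map_compose[OF _ continuous_map_fst, of Z S T f] by (simp add: comp_def)

lemma continuous_map_sndI:
  "continuous_map Z (prod_topology S T) f \<Longrightarrow> continuous_map Z T (\<lambda>x. snd (f x))"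
  using continuous_map_compose[OF _ continuous_map_snd, of Z S T f] by (simp add: comp_def)

lemma continuous_map_ident: "continuous_map S S (\<lambda>x. x)"
  by simp

text \<open>
  \<open>H\<close> is the filter in the definition of the COMDP. The filters that the continuity
  hypotheses provide may differ from it and appear as \<open>H'\<close> below.
\<close>
locale pomdp_filter =
  fixes M :: "('x::polish_space, 'y::polish_space, 'a::polish_space) pomdp"
    and H :: "'x measure \<times> 'a \<times> 'y \<Rightarrow> 'x measure"
  assumes pomdp: "is_POMDP M" and filter: "filter_kernel M H"
begin

abbreviation "X \<equiv> X_top M"
abbreviation "Y \<equiv> Y_top M"
abbreviation "A \<equiv> A_top M"
abbreviation "PX \<equiv> PX_top M"
abbreviation "P \<equiv> trans_kernel M"
abbreviation "Q \<equiv> obs_kernel M"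
abbreviation "q \<equiv> transition (COMDP M H)"

lemma spaces:
  "metrizable_space X" "second_countable X" "metrizable_space Y" "second_countable Y"
  "metrizable_space A" "second_countable A"
  by (intro metrizable_space_subtopology[OF metrizable_space_euclidean]
        second_countable_subtopology[OF second_countable_euclidean])+

lemmas PX_spaces = metrizable_second_countable_weak_topology[OF spaces(1,2)]

lemma P_section: "a \<in> actions M \<Longrightarrow> (\<lambda>x. P (x, a)) \<in> borel_of X \<rightarrow>\<^sub>M prob_algebra (borel_of X)"
proof -
  assume a: "a \<in> actions M"
  have "(\<lambda>x. (x, a)) \<in> borel_of X \<rightarrow>\<^sub>M borel_of (prod_topology X A)"
    using a by (intro continuous_map_borel_of_measurable) (auto intro!: continuous_map_pairedI continuous_intros)
  from measurable_compose[OF this, of P] show ?thesis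
    using pomdp by (simp add: is_POMDP_def stochastic_kernel_iff)
qed

lemma Q_section: "a \<in> actions M \<Longrightarrow> (\<lambda>x. Q (a, x)) \<in> borel_of X \<rightarrow>\<^sub>M prob_algebra (borel_of Y)"
proof -
  assume a: "a \<in> actions M"
  have "(\<lambda>x. (a, x)) \<in> borel_of X \<rightarrow>\<^sub>M borel_of (prod_topology A X)"
    using a by (intro continuous_map_borel_of_measurable) (auto intro!: continuous_map_pairedI continuous_intros)
  from measurable_compose[OF this, of Q] show ?thesis
    using pomdp by (simp add: is_POMDP_def stochastic_kernel_iff)
qed

lemma H_section:
  assumes H': "filter_kernel M H'" and z: "z \<in> prob_measures X" and a: "a \<in> actions M"
  shows "(\<lambda>y. H' (z, a, y)) \<in> borel_of Y \<rightarrow>\<^sub>M prob_algebra (borel_of X)"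
    and "(\<lambda>y. H' (z, a, y)) \<in> borel_of Y \<rightarrow>\<^sub>M borel_of PX"
proof -
  have "(\<lambda>y. (z, a, y)) \<in> borel_of Y \<rightarrow>\<^sub>M borel_of (prod_topology PX (prod_topology A Y))"
    using a z by (intro continuous_map_borel_of_measurable) (auto intro!: continuous_map_pairedI continuous_intros)
  from measurable_compose[OF this, of H']
  show *: "(\<lambda>y. H' (z, a, y)) \<in> borel_of Y \<rightarrow>\<^sub>M prob_algebra (borel_of X)"
    using H' by (simp add: filter_kernel_def stochastic_kernel_iff)
  then show "(\<lambda>y. H' (z, a, y)) \<in> borel_of Y \<rightarrow>\<^sub>M borel_of PX"
    by (simp add: measurable_weak_topology_iff[OF spaces(1,2)])
qed

context
  fixes z a
  assumes z: "z \<in> prob_measures X" and a: "a \<in> actions M"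
begin

lemma PQ_measurable: "(\<lambda>x. P (x, a) \<bind> (\<lambda>x'. Q (a, x'))) \<in> borel_of X \<rightarrow>\<^sub>M prob_algebra (borel_of Y)"
  by (rule measurable_bind_prob_space[OF P_section[OF a] Q_section[OF a]])

text \<open>
  As an iterated Markov composition, \<open>R'\<close> is a probability measure, and integrals against it
  become iterated integrals against \<open>z\<close>, \<open>P\<close> and \<open>Q\<close>.
\<close>
lemma R'_eq_bind: "R' M (z, a) = z \<bind> (\<lambda>x. P (x, a) \<bind> (\<lambda>x'. Q (a, x')))" (is "_ = ?N")
proof (rule measure_eqI)
  have setsN: "sets ?N = sets (borel_of Y)" by (rule sets_bind'[OF z PQ_measurable])
  have setsR: "sets (R' M (z, a)) = sets (borel_of Y)"
    unfolding R'_def prod.case using sets.space_closed[of "borel_of Y"] sets.sigma_sets_eq[of "borel_of Y"]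
    by (simp add: sets_measure_of)
  show "sets (R' M (z, a)) = sets ?N" by (simp only: setsN setsR)
  fix C assume "C \<in> sets (R' M (z, a))"
  then have C: "C \<in> sets (borel_of Y)" by (simp only: setsR)
  have "emeasure (R' M (z, a)) C = R_rect M z a (states M) C"
    by (rule emeasure_R'[OF pomdp z a C])
  also have "\<dots> = (\<integral>\<^sup>+x. (\<integral>\<^sup>+x'. emeasure (Q (a, x')) C \<partial>P (x, a)) \<partial>z)"
    unfolding R_rect_def
  proof (intro nn_integral_cong)
    fix x x' assume "x \<in> space z" and x': "x' \<in> space (P (x, a))"
    then have "x \<in> space (borel_of X)" using prob_measuresD(2)[OF z] by simp
    then have "x' \<in> states M" using prob_measuresD(2)[OF measurable_space[OF P_section[OF a]]] x' by simp
    then show "emeasure (Q (a, x')) C * indicator (states M) x' = emeasure (Q (a, x')) C" by simp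
  qed
  also have "\<dots> = (\<integral>\<^sup>+x. emeasure (P (x, a) \<bind> (\<lambda>x'. Q (a, x'))) C \<partial>z)"
  proof (intro nn_integral_cong)
    fix x assume "x \<in> space z"
    then have "x \<in> space (borel_of X)" using prob_measuresD(2)[OF z] by simp
    from emeasure_bind_prob_algebra[OF measurable_space[OF P_section[OF a] this] Q_section[OF a] C]
    show "(\<integral>\<^sup>+x'. emeasure (Q (a, x')) C \<partial>P (x, a)) = emeasure (P (x, a) \<bind> (\<lambda>x'. Q (a, x'))) C" ..
  qed
  also have "\<dots> = emeasure ?N C"
    by (rule emeasure_bind_prob_algebra[OF z PQ_measurable C, symmetric])
  finally show "emeasure (R' M (z, a)) C = emeasure ?N C" .
qed

lemma R'_prob: "R' M (z, a) \<in> prob_measures Y"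
proof -
  have "(\<lambda>z. z \<bind> (\<lambda>x. P (x, a) \<bind> (\<lambda>x'. Q (a, x')))) \<in> prob_algebra (borel_of X) \<rightarrow>\<^sub>M prob_algebra (borel_of Y)"
    by (rule measurable_bind_prob_space[OF _ PQ_measurable]) simp
  from measurable_space[OF this z] show ?thesis by (simp only: R'_eq_bind)
qed

lemma nn_integral_R':
  assumes f: "f \<in> borel_measurable (borel_of Y)"
  shows "(\<integral>\<^sup>+y. f y \<partial>R' M (z, a)) = (\<integral>\<^sup>+x. \<integral>\<^sup>+x'. \<integral>\<^sup>+y. f y \<partial>Q (a, x') \<partial>P (x, a) \<partial>z)"
proof -
  have "(\<integral>\<^sup>+y. f y \<partial>R' M (z, a)) = (\<integral>\<^sup>+x. \<integral>\<^sup>+y. f y \<partial>(P (x, a) \<bind> (\<lambda>x'. Q (a, x'))) \<partial>z)"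
    unfolding R'_eq_bind
    by (rule nn_integral_bind[OF f])
       (subst measurable_cong_sets[OF prob_measuresD(1)[OF z] refl],
        rule measurable_prob_algebraD[OF PQ_measurable])
  also have "\<dots> = (\<integral>\<^sup>+x. \<integral>\<^sup>+x'. \<integral>\<^sup>+y. f y \<partial>Q (a, x') \<partial>P (x, a) \<partial>z)"
  proof (rule nn_integral_cong)
    fix x assume "x \<in> space z"
    then have "x \<in> space (borel_of X)" using prob_measuresD(2)[OF z] by simp
    note Px = measurable_space[OF P_section[OF a] this]
    show "(\<integral>\<^sup>+y. f y \<partial>(P (x, a) \<bind> (\<lambda>x'. Q (a, x')))) = (\<integral>\<^sup>+x'. \<integral>\<^sup>+y. f y \<partial>Q (a, x') \<partial>P (x, a))"
      by (rule nn_integral_bind[OF f])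
         (subst measurable_cong_sets[OF prob_measuresD(1)[OF Px] refl],
          rule measurable_prob_algebraD[OF Q_section[OF a]])
  qed
  finally show ?thesis .
qed

lemma H_measurable_R':
  assumes H': "filter_kernel M H'"
  shows "(\<lambda>y. H' (z, a, y)) \<in> R' M (z, a) \<rightarrow>\<^sub>M prob_algebra (borel_of X)"
    and "(\<lambda>y. H' (z, a, y)) \<in> R' M (z, a) \<rightarrow>\<^sub>M borel_of PX"
  using H_section[OF H' z a]
  by (simp_all add: measurable_cong_sets[OF prob_measuresD(1)[OF R'_prob] refl])

lemma AE_filter_unique:
  assumes H': "filter_kernel M H'"
  shows "AE y in R' M (z, a). H (z, a, y) = H' (z, a, y)"
proof (rule AE_eq_of_emeasure_eq[OF spaces(2) prob_measuresD(3)[OF R'_prob] H_measurable_R'(1)[OF filter] H_measurable_R'(1)[OF H']])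
  fix B C assume B: "B \<in> sets (borel_of X)" and "C \<in> sets (R' M (z, a))"
  then have C: "C \<in> sets (borel_of Y)" by (simp only: prob_measuresD(1)[OF R'_prob])
  have "R_rect M z a B C = (\<integral>\<^sup>+y\<in>C. emeasure (K (z, a, y)) B \<partial>R' M (z, a))" if "filter_kernel M K" for K
    using that B C z a by (simp add: filter_kernel_def)
  from this[OF filter] this[OF H']
  show "(\<integral>\<^sup>+y\<in>C. emeasure (H (z, a, y)) B \<partial>R' M (z, a)) = (\<integral>\<^sup>+y\<in>C. emeasure (H' (z, a, y)) B \<partial>R' M (z, a))"
    by simp
qed

lemma q_eq_distr:
  assumes H': "filter_kernel M H'"
  shows "q (z, a) = distr (R' M (z, a)) (borel_of PX) (\<lambda>y. H' (z, a, y))"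
proof -
  have "q (z, a) = distr (R' M (z, a)) (borel_of PX) (\<lambda>y. H (z, a, y))" by (simp add: COMDP_def)
  also have "\<dots> = distr (R' M (z, a)) (borel_of PX) (\<lambda>y. H' (z, a, y))"
    by (rule distr_cong_AE[OF refl refl AE_filter_unique[OF H'] H_measurable_R'(2)[OF filter] H_measurable_R'(2)[OF H']])
  finally show ?thesis .
qed

lemma nn_integral_q:
  assumes H': "filter_kernel M H'" and f: "f \<in> borel_measurable (borel_of PX)"
  shows "(\<integral>\<^sup>+z'. f z' \<partial>q (z, a)) = (\<integral>\<^sup>+y. f (H' (z, a, y)) \<partial>R' M (z, a))"
  unfolding q_eq_distr[OF H']
  by (rule nn_integral_distr[OF H_measurable_R'(2)[OF H']]) (use f in simp)

lemma q_prob: "q (z, a) \<in> prob_measures PX"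
  unfolding q_eq_distr[OF filter]
  using prob_space.prob_space_distr[OF prob_measuresD(3)[OF R'_prob] H_measurable_R'(2)[OF filter]]
  by (simp add: space_prob_algebra)

end

lemma limitin_A: "limitin A as a sequentially \<Longrightarrow> as \<longlonglongrightarrow> a"
  by (simp add: limitin_subtopology)

lemma bounded_continuous_ennreal_measurable:
  "bounded_continuous PX f \<Longrightarrow> (\<lambda>z. ennreal (f z)) \<in> borel_measurable (borel_of PX)"
  using continuous_map_real_borel_of[of PX f] by (simp add: bounded_continuous_def)

lemma tendsto_bounded_continuous_weak:
  assumes f: "bounded_continuous PX f" and zs: "range zs \<subseteq> prob_measures X" "z \<in> prob_measures X"
    and conv: "converges_weakly X zs z"
  shows "(\<lambda>n. ennreal (f (zs n))) \<longlonglongrightarrow> ennreal (f z)"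
proof -
  have "limitin PX zs z sequentially" using conv zs by (simp add: limitin_weak_topology)
  then have "limitin euclideanreal (f \<circ> zs) (f z) sequentially"
    using f by (intro continuous_map_limit[of PX]) (auto simp: bounded_continuous_def)
  then show ?thesis by (simp add: comp_def tendsto_ennrealI)
qed

text \<open>
  If lower semicontinuity of \<open>\<integral>f dq\<close> failed, the integrals would stay below some \<open>l < \<integral>f dq(z, a)\<close>
  along a subsequence. Assumption (H) provides a further subsequence along which
  \<open>f (H' (z\<^sub>k, a\<^sub>k, y)) \<rightarrow> f (H' (z, a, y))\<close> for almost every \<open>y\<close>, and Fatou's lemma for the setwise convergent
  measures \<open>R'\<close> contradicts this bound.
\<close>
lemma q_weakly_continuous_of_setwise:
  assumes R': "setwise_continuous_kernel Y (prod_topology PX A) (R' M)" and "assumption_H M"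
  shows "weakly_continuous_kernel PX (prod_topology PX A) q"
proof (rule weakly_continuous_kernel_lscI)
  show "metrizable_space PX" by (rule PX_spaces)
  show "metrizable_space (prod_topology PX A)"
    using PX_spaces spaces by (simp add: metrizable_space_prod_topology)
  show "q p \<in> prob_measures PX" if "p \<in> topspace (prod_topology PX A)" for p
    using that q_prob by (cases p) auto
  from \<open>assumption_H M\<close> obtain H' where H': "filter_kernel M H'"
    and sub: "\<forall>zs z as a.
      range zs \<subseteq> prob_measures X \<and> z \<in> prob_measures X \<and> converges_weakly X zs z \<and>
      range as \<subseteq> actions M \<and> a \<in> actions M \<and> as \<longlonglongrightarrow> a \<longrightarrow>
      (\<exists>r C. strict_mono (r :: nat \<Rightarrow> nat) \<and> C \<in> sets (borel_of Y) \<and> emeasure (R' M (z, a)) C = 1 \<and>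
         (\<forall>y\<in>C. converges_weakly X (\<lambda>k. H' (zs (r k), as (r k), y)) (H' (z, a, y))))"
    unfolding assumption_H_def by blast
  fix f assume f: "bounded_continuous PX f" "\<And>z. z \<in> topspace PX \<Longrightarrow> 0 \<le> f z"
  show "seq_lsc (prod_topology PX A) (\<lambda>p. \<integral>\<^sup>+z'. ennreal (f z') \<partial>q p)"
    unfolding seq_lsc_def
  proof (intro allI impI, rule ccontr)
    fix \<sigma> p
    assume \<sigma>: "range \<sigma> \<subseteq> topspace (prod_topology PX A)" "limitin (prod_topology PX A) \<sigma> p sequentially"
      and "\<not> (\<integral>\<^sup>+z'. ennreal (f z') \<partial>q p) \<le> liminf (\<lambda>n. \<integral>\<^sup>+z'. ennreal (f z') \<partial>q (\<sigma> n))"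
    then have "liminf (\<lambda>n. \<integral>\<^sup>+z'. ennreal (f z') \<partial>q (\<sigma> n)) < (\<integral>\<^sup>+z'. ennreal (f z') \<partial>q p)" by (simp only: not_le)
    then obtain l where l: "liminf (\<lambda>n. \<integral>\<^sup>+z'. ennreal (f z') \<partial>q (\<sigma> n)) < l" "l < (\<integral>\<^sup>+z'. ennreal (f z') \<partial>q p)"
      using dense by blast
    from liminf_less_imp_subseq[OF l(1)] obtain r :: "nat \<Rightarrow> nat"
      where r: "strict_mono r" "\<And>n. (\<integral>\<^sup>+z'. ennreal (f z') \<partial>q (\<sigma> (r n))) \<le> l" by blast
    define zs where "zs n = fst (\<sigma> (r n))" for n
    define as where "as n = snd (\<sigma> (r n))" for n
    obtain z a where p: "p = (z, a)" by (cases p) blast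
    have \<sigma>r: "\<sigma> (r n) = (zs n, as n)" for n by (simp add: zs_def as_def)
    have za: "z \<in> prob_measures X" "a \<in> actions M" using limitin_topspace[OF \<sigma>(2)] by (auto simp: p)
    have zsn: "zs n \<in> prob_measures X" and asn: "as n \<in> actions M" for n
      using \<sigma>(1) \<sigma>r[of n] by (auto simp: image_subset_iff dest: spec[of _ "r n"])
    have lim: "limitin (prod_topology PX A) (\<lambda>n. (zs n, as n)) (z, a) sequentially"
      using limitin_subsequence[OF r(1) \<sigma>(2)] by (simp add: p comp_def \<sigma>r)
    then have lim': "limitin PX zs z sequentially" "limitin A as a sequentially"
      by (simp_all add: limitin_pairwise comp_def)
    have "converges_weakly X zs z"
      using lim'(1) limitin_weak_topology[of zs X z] zsn za by auto
    moreover have "range zs \<subseteq> prob_measures X" "range as \<subseteq> actions M" using zsn asn by auto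
    ultimately obtain r' C where r': "strict_mono (r' :: nat \<Rightarrow> nat)" and C: "C \<in> sets (borel_of Y)" "emeasure (R' M (z, a)) C = 1"
      "\<And>y. y \<in> C \<Longrightarrow> converges_weakly X (\<lambda>k. H' (zs (r' k), as (r' k), y)) (H' (z, a, y))"
      using sub[rule_format, of zs z as a] za limitin_A[OF lim'(2)] by blast
    interpret R: prob_space "R' M (z, a)" by (rule prob_measuresD(3)[OF R'_prob[OF za]])
    have "C \<in> sets (R' M (z, a))" using C(1) by (simp only: prob_measuresD(1)[OF R'_prob[OF za]])
    then have "AE y in R' M (z, a). y \<in> C"
      using C(2) by (simp add: R.AE_in_set_eq_1 R.emeasure_eq_measure)
    then have AE: "AE y in R' M (z, a). ennreal (f (H' (z, a, y))) \<le> liminf (\<lambda>k. ennreal (f (H' (zs (r' k), as (r' k), y))))"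
      using AE_space
    proof eventually_elim
      case (elim y)
      then have y: "y \<in> space (borel_of Y)" using prob_measuresD(2)[OF R'_prob[OF za]] by simp
      have "(\<lambda>k. ennreal (f (H' (zs (r' k), as (r' k), y)))) \<longlonglongrightarrow> ennreal (f (H' (z, a, y)))"
        by (rule tendsto_bounded_continuous_weak[OF f(1) _ _ C(3)[OF elim(1)]])
           (use y measurable_space[OF H_section(1)[OF H' zsn asn]] measurable_space[OF H_section(1)[OF H' za]] in auto)
      then show ?case by (simp add: lim_imp_Liminf)
    qed
    have setwise: "converges_setwise Y (\<lambda>k. R' M (zs (r' k), as (r' k))) (R' M (z, a))"
    proof -
      have "range (\<lambda>k. (zs (r' k), as (r' k))) \<subseteq> topspace (prod_topology PX A)" using zsn asn by auto
      moreover have "limitin (prod_topology PX A) (\<lambda>k. (zs (r' k), as (r' k))) (z, a) sequentially"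
        using limitin_subsequence[OF r' lim] by (simp add: comp_def)
      ultimately show ?thesis using R' unfolding setwise_continuous_kernel_def by blast
    qed
    have "(\<integral>\<^sup>+z'. ennreal (f z') \<partial>q p) = (\<integral>\<^sup>+y. ennreal (f (H' (z, a, y))) \<partial>R' M (z, a))"
      unfolding p by (rule nn_integral_q[OF za H' bounded_continuous_ennreal_measurable[OF f(1)]])
    also have "\<dots> \<le> liminf (\<lambda>k. \<integral>\<^sup>+y. ennreal (f (H' (zs (r' k), as (r' k), y))) \<partial>R' M (zs (r' k), as (r' k)))"
      by (rule fatou_setwise_convergence[OF setwise R'_prob[OF zsn asn] R'_prob[OF za] _ AE])
         (rule measurable_compose[OF H_section(2)[OF H' zsn asn] bounded_continuous_ennreal_measurable[OF f(1)]])
    also have "\<dots> = liminf (\<lambda>k. \<integral>\<^sup>+z'. ennreal (f z') \<partial>q (\<sigma> (r (r' k))))"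
      by (simp add: \<sigma>r nn_integral_q[OF zsn asn H' bounded_continuous_ennreal_measurable[OF f(1)]])
    also have "\<dots> \<le> l" using r(2) by (intro Liminf_le) auto
    finally show False using l(2) by simp
  qed
qed

text \<open>
  \<open>f (H' (z, a, y))\<close> is continuous in \<open>(z, a, y)\<close>. Seen as a function of \<open>(z, a, x, x', y)\<close>, it is
  integrated against the kernels \<open>Q\<close>, \<open>P\<close> and \<open>z \<mapsto> z\<close> in turn, each weakly continuous in the
  variables that remain.
\<close>
lemma q_weakly_continuous_of_weak:
  assumes P: "weakly_continuous_kernel X (prod_topology X A) P"
    and Q: "weakly_continuous_kernel Y (prod_topology A X) Q"
    and H': "filter_kernel M H'"
    and H'c: "weakly_continuous_kernel X (prod_topology PX (prod_topology A Y)) H'"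
  shows "weakly_continuous_kernel PX (prod_topology PX A) q"
proof (rule weakly_continuous_kernel_lscI)
  show "metrizable_space PX" by (rule PX_spaces)
  show "metrizable_space (prod_topology PX A)"
    using PX_spaces spaces by (simp add: metrizable_space_prod_topology)
  show "q p \<in> prob_measures PX" if "p \<in> topspace (prod_topology PX A)" for p
    using that q_prob by (cases p) auto
  fix f assume f: "bounded_continuous PX f" "\<And>z. z \<in> topspace PX \<Longrightarrow> 0 \<le> f z"
  let ?T2 = "prod_topology PX A" and ?T3 = "prod_topology (prod_topology PX A) X"
    and ?T4 = "prod_topology (prod_topology (prod_topology PX A) X) X"
  define \<phi> :: "((('x measure \<times> 'a) \<times> 'x) \<times> 'x) \<times> 'y \<Rightarrow> ennreal"
    where "\<phi> = (\<lambda>((((z, a), x), x'), y). ennreal (f (H' (z, a, y))))"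
  have "seq_lsc (prod_topology ?T4 Y) \<phi>"
    unfolding seq_lsc_def
  proof (intro allI impI)
    fix \<sigma> p assume \<sigma>: "range \<sigma> \<subseteq> topspace (prod_topology ?T4 Y)" "limitin (prod_topology ?T4 Y) \<sigma> p sequentially"
    define h :: "((('x measure \<times> 'a) \<times> 'x) \<times> 'x) \<times> 'y \<Rightarrow> 'x measure \<times> 'a \<times> 'y"
      where "h p = (fst (fst (fst (fst p))), snd (fst (fst (fst p))), snd p)" for p
    let ?T = "prod_topology PX (prod_topology A Y)"
    have \<phi>h: "\<phi> p = ennreal (f (H' (h p)))" for p by (simp add: \<phi>_def h_def split_beta)
    have hc: "continuous_map (prod_topology ?T4 Y) ?T h"
      unfolding h_def
      by (intro continuous_map_pairedI continuous_map_fstI continuous_map_sndI; rule continuous_map_ident)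
    have rng: "range (h \<circ> \<sigma>) \<subseteq> topspace ?T"
      using image_mono[OF \<sigma>(1), of h] continuous_map_image_subset_topspace[OF hc] unfolding image_comp by (rule subset_trans)
    have lim: "limitin ?T (h \<circ> \<sigma>) (h p) sequentially" by (rule continuous_map_limit[OF hc \<sigma>(2)])
    have H'P: "H' t \<in> prob_measures X" if "t \<in> topspace ?T" for t
      using H'c that unfolding weakly_continuous_kernel_def stochastic_kernel_def space_borel_of by blast
    have "(\<lambda>n. ennreal (f (H' ((h \<circ> \<sigma>) n)))) \<longlonglongrightarrow> ennreal (f (H' (h p)))"
    proof (rule tendsto_bounded_continuous_weak[OF f(1)])
      show "converges_weakly X (\<lambda>n. H' ((h \<circ> \<sigma>) n)) (H' (h p))"
        using H'c rng lim unfolding weakly_continuous_kernel_def by blast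
      show "range (\<lambda>n. H' ((h \<circ> \<sigma>) n)) \<subseteq> prob_measures X" using rng by (auto intro!: H'P)
      show "H' (h p) \<in> prob_measures X" using limitin_topspace[OF lim] by (rule H'P)
    qed
    then show "\<phi> p \<le> liminf (\<lambda>n. \<phi> (\<sigma> n))" by (simp add: \<phi>h lim_imp_Liminf comp_def)
  qed
  moreover have "weakly_continuous_kernel Y ?T4 (\<lambda>p. Q (snd (fst (fst p)), snd p))"
    by (rule weakly_continuous_kernel_compose[OF Q])
       (intro continuous_map_pairedI continuous_map_fstI continuous_map_sndI; rule continuous_map_ident)
  ultimately have I1: "seq_lsc ?T4 (\<lambda>p. \<integral>\<^sup>+y. \<phi> (p, y) \<partial>Q (snd (fst (fst p)), snd p))"
    by (intro seq_lsc_nn_integral_kernel[OF spaces(3)])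
  have "weakly_continuous_kernel X ?T3 (\<lambda>p. P (snd p, snd (fst p)))"
    by (rule weakly_continuous_kernel_compose[OF P])
       (intro continuous_map_pairedI continuous_map_fstI continuous_map_sndI; rule continuous_map_ident)
  from seq_lsc_nn_integral_kernel[OF spaces(1) this I1]
  have I2: "seq_lsc ?T3 (\<lambda>p. \<integral>\<^sup>+x'. \<integral>\<^sup>+y. \<phi> ((p, x'), y) \<partial>Q (snd (fst p), x') \<partial>P (snd p, snd (fst p)))"
    by simp
  have "weakly_continuous_kernel X ?T2 (\<lambda>p. fst p)"
    by (rule weakly_continuous_kernel_compose[OF weakly_continuous_kernel_id[OF spaces(1,2)]])
       (rule continuous_map_fst)
  from seq_lsc_nn_integral_kernel[OF spaces(1) this I2]
  have I3: "seq_lsc ?T2 (\<lambda>p. \<integral>\<^sup>+x. \<integral>\<^sup>+x'. \<integral>\<^sup>+y. \<phi> (((p, x), x'), y) \<partial>Q (snd p, x') \<partial>P (x, snd p) \<partial>fst p)"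
    by simp
  have eq: "(\<integral>\<^sup>+z'. ennreal (f z') \<partial>q p) =
      (\<integral>\<^sup>+x. \<integral>\<^sup>+x'. \<integral>\<^sup>+y. \<phi> (((p, x), x'), y) \<partial>Q (snd p, x') \<partial>P (x, snd p) \<partial>fst p)"
    if pT: "p \<in> topspace ?T2" for p
  proof -
    obtain z a where p: "p = (z, a)" and za: "z \<in> prob_measures X" "a \<in> actions M" using pT by (cases p) auto
    have fm: "(\<lambda>z. ennreal (f z)) \<in> borel_measurable (borel_of PX)"
      by (rule bounded_continuous_ennreal_measurable[OF f(1)])
    have "(\<integral>\<^sup>+z'. ennreal (f z') \<partial>q p) = (\<integral>\<^sup>+y. ennreal (f (H' (z, a, y))) \<partial>R' M (z, a))"
      unfolding p by (rule nn_integral_q[OF za H' fm])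
    also have "\<dots> = (\<integral>\<^sup>+x. \<integral>\<^sup>+x'. \<integral>\<^sup>+y. ennreal (f (H' (z, a, y))) \<partial>Q (a, x') \<partial>P (x, a) \<partial>z)"
      by (rule nn_integral_R'[OF za measurable_compose[OF H_section(2)[OF H' za] fm]])
    finally show ?thesis by (simp add: p \<phi>_def)
  qed
  show "seq_lsc ?T2 (\<lambda>p. \<integral>\<^sup>+z'. ennreal (f z') \<partial>q p)"
    unfolding seq_lsc_def
  proof (intro allI impI)
    fix \<sigma> p assume \<sigma>: "range \<sigma> \<subseteq> topspace ?T2" "limitin ?T2 \<sigma> p sequentially"
    have "\<sigma> n \<in> topspace ?T2" for n using \<sigma>(1) by blast
    then show "(\<integral>\<^sup>+z'. ennreal (f z') \<partial>q p) \<le> liminf (\<lambda>n. \<integral>\<^sup>+z'. ennreal (f z') \<partial>q (\<sigma> n))"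
      using seq_lscD[OF I3 \<sigma>] eq[OF limitin_topspace[OF \<sigma>(2)]] eq by simp
  qed
qed

context
  fixes b :: real
  assumes b: "0 \<le> b" and cost_ge: "\<And>x a. x \<in> states M \<Longrightarrow> a \<in> actions M \<Longrightarrow> - ereal b \<le> cost M (x, a)"
begin

definition "shifted_cost p = e2ennreal (cost M p + ereal b)"

lemma cost_eq: "p \<in> states M \<times> actions M \<Longrightarrow> cost M p = enn2ereal (shifted_cost p) - ereal b"
  unfolding shifted_cost_def by (rule eq_shift) (use cost_ge in auto)

lemma shifted_cost_section:
  assumes a: "a \<in> actions M"
  shows "(\<lambda>x. shifted_cost (x, a)) \<in> borel_measurable (borel_of X)"
proof -
  have "(\<lambda>x. (x, a)) \<in> borel_of X \<rightarrow>\<^sub>M borel_of (prod_topology X A)"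
    using a by (intro continuous_map_borel_of_measurable) (auto intro!: continuous_map_pairedI continuous_intros)
  from measurable_compose[OF this, of "cost M"] have "(\<lambda>x. cost M (x, a)) \<in> borel_measurable (borel_of X)"
    using pomdp by (simp add: is_POMDP_def)
  then show ?thesis unfolding shifted_cost_def by measurable
qed

lemma step_cost_eq:
  assumes "p \<in> prob_measures X \<times> actions M"
  shows "step_cost (COMDP M H) p = enn2ereal ((\<lambda>(z, a). \<integral>\<^sup>+x. shifted_cost (x, a) \<partial>z) p) - ereal b"
proof -
  obtain z a where p: "p = (z, a)" and z: "z \<in> prob_measures X" and a: "a \<in> actions M" using assms by auto
  have "ereal_integral z (\<lambda>x. cost M (x, a)) = enn2ereal (\<integral>\<^sup>+x. shifted_cost (x, a) \<partial>z) - ereal b"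
  proof (rule ereal_integral_shift[OF prob_measuresD(3)[OF z] _ b])
    show "(\<lambda>x. shifted_cost (x, a)) \<in> borel_measurable z"
      by (subst measurable_cong_sets[OF prob_measuresD(1)[OF z] refl]) (rule shifted_cost_section[OF a])
    show "cost M (x, a) = enn2ereal (shifted_cost (x, a)) - ereal b" if "x \<in> space z" for x
      using that a prob_measuresD(2)[OF z] by (intro cost_eq) simp
  qed
  then show ?thesis by (simp add: p COMDP_def)
qed

text \<open>
  Both costs are shifted by the same constant, as beliefs are probability measures, and the claim becomes
  \<open>nn_integral_seq_K_inf_compact\<close>.
\<close>
lemma comdp_cost_K_inf_compact:
  assumes "K_inf_compact X A (cost M)"
  shows "K_inf_compact PX A (step_cost (COMDP M H))"
proof -
  have "seq_K_inf_compact X A shifted_cost"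
    using K_inf_compact_shift_iff[OF spaces(1,5), of "cost M" shifted_cost b] cost_eq assms by simp
  from nn_integral_seq_K_inf_compact[OF spaces(1,2,5) this]
  show ?thesis
    using K_inf_compact_shift_iff[OF PX_spaces(1) spaces(5), of "step_cost (COMDP M H)"
        "\<lambda>(z, a). \<integral>\<^sup>+x. shifted_cost (x, a) \<partial>z" b] step_cost_eq by simp
qed

lemma shifted_mdp_COMDP:
  assumes "K_inf_compact X A (cost M)" and "weakly_continuous_kernel PX (prod_topology PX A) q"
    and "0 \<le> \<alpha>" "b = 0 \<or> \<alpha> < 1"
  shows "shifted_mdp (COMDP M H) \<alpha> b"
proof
  have sp: "state_space (COMDP M H) = PX" "action_space (COMDP M H) = A" by (simp_all add: COMDP_def)
  show "metrizable_space (state_space (COMDP M H))" "second_countable (state_space (COMDP M H))"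
    "metrizable_space (action_space (COMDP M H))" "second_countable (action_space (COMDP M H))"
    using spaces PX_spaces by (simp_all add: sp)
  show "topspace (action_space (COMDP M H)) \<noteq> {}" using pomdp by (simp add: sp is_POMDP_def)
  show "weakly_continuous_kernel (state_space (COMDP M H))
      (prod_topology (state_space (COMDP M H)) (action_space (COMDP M H))) (transition (COMDP M H))"
    using assms(2) by (simp add: sp)
  show "K_inf_compact (state_space (COMDP M H)) (action_space (COMDP M H)) (step_cost (COMDP M H))"
    using comdp_cost_K_inf_compact[OF assms(1)] by (simp add: sp)
  show "- ereal b \<le> step_cost (COMDP M H) (z, a)"
    if "z \<in> topspace (state_space (COMDP M H))" "a \<in> topspace (action_space (COMDP M H))" for z a
    using that step_cost_eq[of "(z, a)"]
    by (cases "\<integral>\<^sup>+x. shifted_cost (x, a) \<partial>z") (simp_all add: sp enn2ereal_ennreal)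
qed (use b assms in auto)

end

text \<open>
  Both sides are shifts, by the same constant, of integrals of the nonnegative function \<open>w\<close>: iterated
  against \<open>z\<close>, \<open>P\<close>, \<open>Q\<close> on the left, and against \<open>q\<close> on the right.
\<close>
lemma bellman_filter_eq:
  assumes z: "z \<in> prob_measures X" and a: "a \<in> actions M" and c: "0 \<le> c"
    and w: "w \<in> borel_measurable (borel_of PX)"
    and v: "\<And>z. z \<in> prob_measures X \<Longrightarrow> v z = enn2ereal (w z) - ereal c"
  shows "bellman_filter M H \<alpha> v z a = bellman (COMDP M H) \<alpha> v z a"
proof -
  have wH: "(\<lambda>y. w (H (z, a, y))) \<in> borel_measurable (borel_of Y)"
    by (rule measurable_compose[OF H_section(2)[OF filter z a] w])
  have vH: "v (H (z, a, y)) = enn2ereal (w (H (z, a, y))) - ereal c" if "y \<in> space (borel_of Y)" for y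
    by (rule v[OF measurable_space[OF H_section(1)[OF filter z a] that]])
  have g1: "(\<lambda>x'. \<integral>\<^sup>+y. w (H (z, a, y)) \<partial>Q (a, x')) \<in> borel_measurable (borel_of X)"
    by (rule measurable_compose[OF measurable_prob_algebraD[OF Q_section[OF a]] nn_integral_measurable_subprob_algebra[OF wH]])
  have g2: "(\<lambda>x. \<integral>\<^sup>+x'. \<integral>\<^sup>+y. w (H (z, a, y)) \<partial>Q (a, x') \<partial>P (x, a)) \<in> borel_measurable (borel_of X)"
    by (rule measurable_compose[OF measurable_prob_algebraD[OF P_section[OF a]] nn_integral_measurable_subprob_algebra[OF g1]])
  have e1: "ereal_integral (Q (a, x')) (\<lambda>y. v (H (z, a, y))) = enn2ereal (\<integral>\<^sup>+y. w (H (z, a, y)) \<partial>Q (a, x')) - ereal c"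
    if "x' \<in> space (borel_of X)" for x'
  proof -
    note Qx = prob_measuresD[OF measurable_space[OF Q_section[OF a] that]]
    show ?thesis
      by (rule ereal_integral_shift[OF Qx(3) _ c])
         (subst measurable_cong_sets[OF Qx(1) refl], rule wH, rule vH, simp add: Qx(2))
  qed
  have e2: "ereal_integral (P (x, a)) (\<lambda>x'. ereal_integral (Q (a, x')) (\<lambda>y. v (H (z, a, y)))) =
      enn2ereal (\<integral>\<^sup>+x'. \<integral>\<^sup>+y. w (H (z, a, y)) \<partial>Q (a, x') \<partial>P (x, a)) - ereal c"
    if "x \<in> space (borel_of X)" for x
  proof -
    note Px = prob_measuresD[OF measurable_space[OF P_section[OF a] that]]
    show ?thesis
      by (rule ereal_integral_shift[OF Px(3) _ c])
         (subst measurable_cong_sets[OF Px(1) refl], rule g1, rule e1, simp add: Px(2))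
  qed
  note Z = prob_measuresD[OF z]
  have "ereal_integral z (\<lambda>x. ereal_integral (P (x, a)) (\<lambda>x'. ereal_integral (Q (a, x')) (\<lambda>y. v (H (z, a, y))))) =
      enn2ereal (\<integral>\<^sup>+x. \<integral>\<^sup>+x'. \<integral>\<^sup>+y. w (H (z, a, y)) \<partial>Q (a, x') \<partial>P (x, a) \<partial>z) - ereal c"
    by (rule ereal_integral_shift[OF Z(3) _ c])
       (subst measurable_cong_sets[OF Z(1) refl], rule g2, rule e2, simp add: Z(2))
  also have "(\<integral>\<^sup>+x. \<integral>\<^sup>+x'. \<integral>\<^sup>+y. w (H (z, a, y)) \<partial>Q (a, x') \<partial>P (x, a) \<partial>z) = (\<integral>\<^sup>+z'. w z' \<partial>q (z, a))"
    by (simp only: nn_integral_q[OF z a filter w] nn_integral_R'[OF z a wH])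
  also have "enn2ereal (\<integral>\<^sup>+z'. w z' \<partial>q (z, a)) - ereal c = ereal_integral (q (z, a)) v"
  proof (rule ereal_integral_shift[OF prob_measuresD(3)[OF q_prob[OF z a]] _ c, symmetric])
    show "w \<in> borel_measurable (q (z, a))"
      by (subst measurable_cong_sets[OF prob_measuresD(1)[OF q_prob[OF z a]] refl]) (rule w)
    show "v z' = enn2ereal (w z') - ereal c" if "z' \<in> space (q (z, a))" for z'
      using that prob_measuresD(2)[OF q_prob[OF z a]] by (intro v) simp
  qed
  finally show ?thesis by (simp add: bellman_filter_def bellman_def COMDP_def)
qed

lemma comdp_optimality:
  assumes "shifted_mdp (COMDP M H) \<alpha> b"
  shows "optimality_equation M H \<alpha> T"
proof -
  interpret mdp: shifted_mdp "COMDP M H" \<alpha> b by fact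
  have sp: "state_space (COMDP M H) = PX" "action_space (COMDP M H) = A" by (simp_all add: COMDP_def)
  have "bellman_filter M H \<alpha> (opt_value (COMDP M H) \<alpha> T) z a = bellman (COMDP M H) \<alpha> (opt_value (COMDP M H) \<alpha> T) z a"
    if "z \<in> prob_measures X" "a \<in> actions M" for z a
    using mdp.shifted_value_measurable[of T] mdp.opt_value_eq[of _ T]
    by (intro bellman_filter_eq[OF that mdp.offset_nonneg]) (auto simp: sp)
  then have "is_min (actions M) (bellman_filter M H \<alpha> (opt_value (COMDP M H) \<alpha> T) z) m \<longleftrightarrow>
      is_min (actions M) (bellman (COMDP M H) \<alpha> (opt_value (COMDP M H) \<alpha> T) z) m"
    if "z \<in> prob_measures X" for z m
    using that by (simp add: is_min_def)
  then show ?thesis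
    using mdp.optimality[of _ T] mdp.opt_actions_graph[of T]
    unfolding optimality_equation_def Let_def by (simp add: sp)
qed

end

theorem theorem3p2:
  fixes M :: "('x::polish_space, 'y::polish_space, 'a::polish_space) pomdp"
    and \<alpha> :: real
    and H :: "'x measure \<times> 'a \<times> 'y \<Rightarrow> 'x measure"
  assumes pomdp: "is_POMDP M"
    and a: "assumption_D M \<alpha> \<or> assumption_P M \<alpha>"
    and b: "K_inf_compact (X_top M) (A_top M) (cost M)"
    and c: "(setwise_continuous_kernel (Y_top M) (prod_topology (PX_top M) (A_top M)) (R' M) \<and>
              assumption_H M) \<or>
            (weakly_continuous_kernel (X_top M) (prod_topology (X_top M) (A_top M)) (trans_kernel M) \<and>
             weakly_continuous_kernel (Y_top M) (prod_topology (A_top M) (X_top M)) (obs_kernel M) \<and>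
             (\<exists>H'. filter_kernel M H' \<and>
                weakly_continuous_kernel (X_top M)
                  (prod_topology (PX_top M) (prod_topology (A_top M) (Y_top M))) H'))"
    and H: "filter_kernel M H"
  shows "assumption_W_star (COMDP M H) \<and>
         property_O1 (COMDP M H) \<alpha> \<and>
         property_O2 M H \<alpha> \<and>
         property_O3 (COMDP M H) \<alpha> \<and>
         property_O4 M H \<alpha> \<and>
         property_O5 (COMDP M H) \<alpha> \<and>
         property_O6 (COMDP M H) \<alpha>"
proof -
  interpret pomdp_filter M H by (rule pomdp_filter.intro[OF pomdp H])
  have q: "weakly_continuous_kernel PX (prod_topology PX A) q"
    using c q_weakly_continuous_of_setwise q_weakly_continuous_of_weak by blast
  have "\<exists>d. 0 \<le> d \<and> (\<forall>x\<in>states M. \<forall>a\<in>actions M. - ereal d \<le> cost M (x, a)) \<and> (d = 0 \<or> \<alpha> < 1)"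
    using a
  proof
    assume D: "assumption_D M \<alpha>"
    then obtain l where l: "\<forall>x\<in>states M. \<forall>a\<in>actions M. ereal l \<le> cost M (x, a)"
      by (auto simp: assumption_D_def bounded_below_cost_def)
    define m where "m = max 0 (- l)"
    have m: "0 \<le> m" "- ereal m \<le> ereal l" by (simp_all add: m_def max_def)
    then have "\<forall>x\<in>states M. \<forall>a\<in>actions M. - ereal m \<le> cost M (x, a)"
      using l order_trans by blast
    then show ?thesis using D m(1) by (intro exI[of _ m]) (simp add: assumption_D_def)
  next
    assume "assumption_P M \<alpha>"
    then show ?thesis by (intro exI[of _ 0]) (auto simp: assumption_P_def zero_ereal_def)
  qed
  then obtain d where d: "0 \<le> d" "\<And>x a. x \<in> states M \<Longrightarrow> a \<in> actions M \<Longrightarrow> - ereal d \<le> cost M (x, a)"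
    "d = 0 \<or> \<alpha> < 1" by blast
  have \<alpha>: "0 \<le> \<alpha>" using a by (auto simp: assumption_D_def assumption_P_def)
  have mdp: "shifted_mdp (COMDP M H) \<alpha> d"
    by (rule shifted_mdp_COMDP[OF d(1,2) b q \<alpha> d(3)])
  then interpret mdp: shifted_mdp "COMDP M H" \<alpha> d .
  have "assumption_W_star (COMDP M H)"
    unfolding assumption_W_star_def using mdp.cost_K mdp.q_cont' by blast
  then show ?thesis
    using mdp.property_O1 mdp.property_O3 mdp.property_O5 mdp.property_O6 comdp_optimality[OF mdp]
    by (simp add: property_O2_def property_O4_def)
qed

end
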